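(* Let $\mathcal{D}\subset\mathbb{R}^N$ be open, bounded, connected and walk-regular. Then for every continuous $F:\partial\mathcal{D}\to\mathbb{R}$, the family $\{u^\epsilon\}_{\epsilon\in(0,1)}$, $u^\epsilon(x)=\mathbb{E}[F\circ X^{\epsilon,x}]$, satisfies $u^\epsilon\to u$ as $\epsilon\to0$, where $u\in C(\bar{\mathcal{D}})$ is the unique solution of the boundary value problem $\Delta u=0$ in $\mathcal{D}$, $u=F$ on $\partial\mathcal{D}$.
   Context: Probability space: $\Omega_1=B_1(0)\subset\mathbb{R}^N$ with Borel $\sigma$-algebra and normalised Lebesgue measure; $(\Omega,\mathcal{F},\mathbb{P})$ is the countable product $\Omega=(\Omega_1)^{\mathbb{N}}$, $\omega=\{w_i\}_{i\ge1}$. The $\epsilon$-ball walk started at $x\in\mathcal{D}$: $X_0^{\epsilon,x}\equiv x$, $X_n^{\epsilon,x}=X_{n-1}^{\epsilon,x}+\big(\epsilon\wedge\operatorname{dist}(X_{n-1}^{\epsilon,x},\partial\mathcal{D})\big)w_n$ for $n\ge1$; it converges $\mathbb{P}$-a.s. to a random variable $X^{\epsilon,x}:\Omega\to\partial\mathcal{D}$. A point $y_0\in\partial\mathcal{D}$ is walk-regular if for every $\eta,\delta>0$ there exist $\hat\delta\in(0,\delta)$ and $\hat\epsilon\in(0,1)$ such that $\mathbb{P}(X^{\epsilon,x_0}\in B_\delta(y_0))\ge1-\eta$ for all $\epsilon\in(0,\hat\epsilon)$ and all $x_0\in B_{\hat\delta}(y_0)\cap\mathcal{D}$; $\mathcal{D}$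 is walk-regular if every $y_0\in\partial\mathcal{D}$ is walk-regular. *)

theory Defs
  imports "HOL-Probability.Probability"
begin

definition ball_prob :: "'a::euclidean_space measure" where
  "ball_prob = uniform_measure lborel (ball 0 1)"

text \<open>The countable product (Omega_1)^N; coordinate 0 is unused (increments are w_1, w_2, ...).
  We take the completion so that expectations of functions that are a.s. equal to measurable
  ones are well defined.\<close>
definition walk_space :: "(nat \<Rightarrow> 'a::euclidean_space) measure" where
  "walk_space = completion (PiM UNIV (\<lambda>_. ball_prob))"

fun walk :: "'a::euclidean_space set \<Rightarrow> real \<Rightarrow> 'a \<Rightarrow> (nat \<Rightarrow> 'a) \<Rightarrow> nat \<Rightarrow> 'a" where
  "walk D \<epsilon> x \<omega> 0 = x"
| "walk D \<epsilon> x \<omega> (Suc n) =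
     walk D \<epsilon> x \<omega> n + (min \<epsilon> (infdist (walk D \<epsilon> x \<omega> n) (frontier D))) *\<^sub>R \<omega> (Suc n)"

definition walk_limit :: "'a::euclidean_space set \<Rightarrow> real \<Rightarrow> 'a \<Rightarrow> (nat \<Rightarrow> 'a) \<Rightarrow> 'a" where
  "walk_limit D \<epsilon> x \<omega> = lim (walk D \<epsilon> x \<omega>)"

definition walk_regular_point :: "'a::euclidean_space set \<Rightarrow> 'a \<Rightarrow> bool" where
  "walk_regular_point D y0 \<longleftrightarrow>
     (\<forall>\<eta>>0. \<forall>\<delta>>0. \<exists>\<delta>'. 0 < \<delta>' \<and> \<delta>' < \<delta> \<and> (\<exists>\<epsilon>'. 0 < \<epsilon>' \<and> \<epsilon>' < 1 \<and>
        (\<forall>\<epsilon>. 0 < \<epsilon> \<and> \<epsilon> < \<epsilon>' \<longrightarrow> (\<forall>x0 \<in> ball y0 \<delta>' \<inter> D.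
           measure walk_space {\<omega> \<in> space walk_space. walk_limit D \<epsilon> x0 \<omega> \<in> ball y0 \<delta>} \<ge> 1 - \<eta>))))"

definition walk_regular :: "'a::euclidean_space set \<Rightarrow> bool" where
  "walk_regular D \<longleftrightarrow> (\<forall>y0 \<in> frontier D. walk_regular_point D y0)"

definition u_eps :: "'a::euclidean_space set \<Rightarrow> ('a \<Rightarrow> real) \<Rightarrow> real \<Rightarrow> 'a \<Rightarrow> real" where
  "u_eps D F \<epsilon> x = integral\<^sup>L walk_space (\<lambda>\<omega>. F (walk_limit D \<epsilon> x \<omega>))"

definition harmonic_on :: "'a::euclidean_space set \<Rightarrow> ('a \<Rightarrow> real) \<Rightarrow> bool" where
  "harmonic_on D u \<longleftrightarrow>
     (\<exists>u' u''. (\<forall>x\<in>D. (u has_derivative u' x) (at x)) \<and>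
        (\<forall>x\<in>D. \<forall>v. ((\<lambda>y. u' y v) has_derivative u'' x v) (at x)) \<and>
        (\<forall>v w. continuous_on D (\<lambda>y. u'' y v w)) \<and>
        (\<forall>x\<in>D. (\<Sum>i\<in>Basis. u'' x i i) = 0))"

end

theory Submission
  imports Defs "HOL-Complex_Analysis.Great_Picard"
begin

text \<open>
  By the Markov property, \<open>u\<^sub>\<epsilon>\<close> equals its mean over the ball of radius \<open>\<epsilon>\<close> at every point whose
  distance from the boundary is at least \<open>\<epsilon>\<close>, and walk regularity makes \<open>u\<^sub>\<epsilon>\<close> uniformly close to
  \<open>F\<close> near the boundary. The difference \<open>u\<^sub>\<epsilon> (x + h) - u\<^sub>\<epsilon> x\<close> has the same mean value property, so
  a discrete maximum principle makes the family asymptotically equicontinuous, and every sequence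
  \<open>\<epsilon>\<^sub>n \<rightarrow> 0\<close> has a subsequence along which \<open>u\<^sub>\<epsilon>\<close> converges uniformly to some \<open>u\<close> with boundary
  values \<open>F\<close>. Averaging over balls is self-adjoint and satisfies \<open>\<phi>\<^sub>\<epsilon> - \<phi> \<approx> c \<epsilon>\<^sup>2 \<Delta>\<phi>\<close> on test
  functions, hence \<open>\<integral> u \<Delta>\<phi> = 0\<close>. For the kernels \<open>\<phi>\<^sub>k = (s\<^sup>2 - |z|\<^sup>2)\<^sub>+\<^sup>k\<close> the Laplacian is a
  combination of \<open>\<phi>\<^sub>k\<^sub>-\<^sub>1\<close> and \<open>\<phi>\<^sub>k\<^sub>-\<^sub>2\<close>, so the mean of \<open>u\<close> weighted by \<open>\<phi>\<^sub>k\<close> does not depend on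
  \<open>k\<close>; as \<open>k \<rightarrow> \<infinity>\<close> it tends to the value of \<open>u\<close> at the centre. Thus \<open>u\<close> is locally reproduced by
  convolution with a \<open>C\<^sup>2\<close> kernel and is harmonic. The maximum principle makes \<open>u\<close> unique, so the
  whole family converges.
\<close>

subsection \<open>The uniform distribution on the unit ball\<close>

lemma emeasure_lborel_unit_ball:
  "emeasure lborel (ball (0::'a::euclidean_space) 1) \<noteq> 0"
  "emeasure lborel (ball (0::'a::euclidean_space) 1) \<noteq> \<infinity>"
  using emeasure_lborel_ball_finite[of "0::'a" 1] open_not_negligible[of "ball (0::'a) 1"]
  by (auto simp: negligible_iff_emeasure0 null_sets_def)

interpretation ball_prob: prob_space "ball_prob :: 'a::euclidean_space measure"
  unfolding ball_prob_def
  using emeasure_lborel_unit_ball by (intro prob_space_uniform_measure) auto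

lemma sets_ball_prob [measurable_cong, simp]: "sets ball_prob = sets borel"
  by (simp add: ball_prob_def)

lemma space_ball_prob [simp]: "space ball_prob = UNIV"
  by (simp add: ball_prob_def)

lemma measure_ball_prob_UNIV [simp]: "measure (ball_prob :: 'a::euclidean_space measure) UNIV = 1"
  using ball_prob.prob_space[where 'a='a] by simp

lemma AE_ball_prob:
  "(AE w in ball_prob. P w) \<longleftrightarrow> (AE w in lborel. norm (w::'a::euclidean_space) < 1 \<longrightarrow> P w)"
  unfolding ball_prob_def using emeasure_lborel_unit_ball
  by (subst AE_uniform_measure) (auto simp: top.not_eq_extremum)

lemma AE_ball_probI:
  "(\<And>w. norm (w::'a::euclidean_space) < 1 \<Longrightarrow> P w) \<Longrightarrow> AE w in ball_prob. P w"
  by (simp add: AE_ball_prob)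

lemma integrable_ball_prob_bounded:
  fixes f :: "'a::euclidean_space \<Rightarrow> real"
  assumes "f \<in> borel_measurable borel" and "\<And>w. norm w < 1 \<Longrightarrow> \<bar>f w\<bar> \<le> B"
  shows "integrable ball_prob f"
  using assms by (intro ball_prob.integrable_const_bound[of _ B] AE_ball_probI) auto

lemma (in prob_space) abs_expectation_le:
  fixes f :: "'a \<Rightarrow> real"
  assumes "f \<in> borel_measurable M" "AE w in M. \<bar>f w\<bar> \<le> B"
  shows "\<bar>expectation f\<bar> \<le> B"
proof -
  have "integrable M f" using assms by (intro integrable_const_bound[of _ B]) auto
  then have "(\<integral>w. \<bar>f w\<bar> \<partial>M) \<le> (\<integral>w. B \<partial>M)" using assms by (intro integral_mono_AE) auto
  then show ?thesis by (intro order_trans[OF integral_abs_bound]) (simp add: prob_space)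
qed

lemma distr_ball_prob_isometry:
  fixes T :: "'a::euclidean_space \<Rightarrow> 'a"
  assumes [measurable]: "T \<in> borel_measurable borel"
    and T: "distr lborel borel T = lborel" and norm: "\<And>w. norm (T w) = norm w"
  shows "distr ball_prob borel T = ball_prob"
proof (rule measure_eqI)
  show "sets (distr ball_prob borel T) = sets ball_prob" by simp
  fix B assume "B \<in> sets (distr ball_prob borel T)"
  then have B [measurable]: "B \<in> sets borel" by simp
  have [measurable]: "T -` B \<in> sets borel"
    using measurable_sets[OF assms(1) B] by simp
  have "emeasure lborel (ball 0 1 \<inter> T -` B) = emeasure lborel (T -` (ball 0 1 \<inter> B) \<inter> space lborel)"
    by (rule arg_cong[where f="emeasure lborel"]) (auto simp: norm)
  also have "\<dots> = emeasure (distr lborel borel T) (ball 0 1 \<inter> B)"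
    by (subst emeasure_distr) auto
  finally have "emeasure lborel (ball 0 1 \<inter> T -` B) = emeasure lborel (ball 0 1 \<inter> B)"
    by (simp add: T)
  moreover have "emeasure (distr ball_prob borel T) B = emeasure ball_prob (T -` B)"
    by (subst emeasure_distr) auto
  ultimately show "emeasure (distr ball_prob borel T) B = emeasure ball_prob B"
    by (simp add: ball_prob_def)
qed

lemma integral_ball_prob_isometry:
  fixes T :: "'a::euclidean_space \<Rightarrow> 'a" and f :: "'a \<Rightarrow> real"
  assumes "T \<in> borel_measurable borel" "f \<in> borel_measurable borel"
    and "distr lborel borel T = lborel" "\<And>w. norm (T w) = norm w"
  shows "(\<integral>w. f (T w) \<partial>ball_prob) = (\<integral>w. f w \<partial>ball_prob)"
proof -
  have "(\<integral>w. f (T w) \<partial>ball_prob) = integral\<^sup>L (distr ball_prob borel T) f"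
    using assms by (subst integral_distr) auto
  then show ?thesis by (simp add: distr_ball_prob_isometry[OF assms(1,3,4)])
qed

lemma integral_ball_prob_uminus:
  fixes f :: "'a::euclidean_space \<Rightarrow> real"
  assumes "f \<in> borel_measurable borel"
  shows "(\<integral>w. f (- w) \<partial>ball_prob) = (\<integral>w. f w \<partial>ball_prob)"
  using assms lborel_affine[of "-1" "0::'a"]
  by (intro integral_ball_prob_isometry) (auto simp: density_1 simp flip: one_ennreal_def)

lemma norm_eq_of_coordinates:
  fixes x y :: "'a::euclidean_space"
  assumes "(\<Sum>b\<in>Basis. (x \<bullet> b)\<^sup>2) = (\<Sum>b\<in>Basis. (y \<bullet> b)\<^sup>2)"
  shows "norm x = norm y"
  using assms by (simp add: norm_eq euclidean_inner[of x x] euclidean_inner[of y y] power2_eq_square)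

definition reflect :: "'a::euclidean_space \<Rightarrow> 'a \<Rightarrow> 'a" where
  "reflect i w = (\<Sum>j\<in>Basis. ((if j = i then -1 else 1) * (w \<bullet> j)) *\<^sub>R j)"

definition permute_coords :: "('a::euclidean_space \<Rightarrow> 'a) \<Rightarrow> 'a \<Rightarrow> 'a" where
  "permute_coords \<sigma> w = (\<Sum>j\<in>Basis. (w \<bullet> \<sigma> j) *\<^sub>R j)"

lemma reflect_inner: "b \<in> Basis \<Longrightarrow> reflect i w \<bullet> b = (if b = i then - (w \<bullet> b) else w \<bullet> b)"
  by (simp add: reflect_def)

lemma permute_coords_inner: "b \<in> Basis \<Longrightarrow> permute_coords \<sigma> w \<bullet> b = w \<bullet> \<sigma> b"
  by (simp add: permute_coords_def)

lemma integral_ball_prob_reflect: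
  fixes f :: "'a::euclidean_space \<Rightarrow> real"
  assumes "f \<in> borel_measurable borel"
  shows "(\<integral>w. f (reflect i w) \<partial>ball_prob) = (\<integral>w. f w \<partial>ball_prob)"
proof (rule integral_ball_prob_isometry[OF _ assms])
  let ?c = "\<lambda>j. if j = i then -1 else 1 :: real"
  have "(\<Prod>j\<in>Basis. \<bar>?c j\<bar>) = 1" by (intro prod.neutral) auto
  then show "distr lborel borel (reflect i) = lborel"
    using lborel_affine_euclidean[of ?c 0]
    by (simp add: reflect_def[abs_def] density_1 flip: one_ennreal_def)
  show "norm (reflect i w) = norm w" for w
    by (rule norm_eq_of_coordinates) (auto intro!: sum.cong simp: reflect_inner power2_eq_square)
qed (simp add: reflect_def[abs_def])

lemma lborel_distr_permute_coords:
  assumes \<sigma>: "\<sigma> permutes Basis"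
  shows "distr lborel borel (permute_coords \<sigma>) = (lborel :: 'a::euclidean_space measure)"
proof (rule lborel_eqI[symmetric])
  let ?T = "permute_coords \<sigma> :: 'a \<Rightarrow> 'a" and ?S = "permute_coords (inv \<sigma>) :: 'a \<Rightarrow> 'a"
  have [measurable]: "?T \<in> borel_measurable borel" by (simp add: permute_coords_def[abs_def])
  note inv = permutes_inv[OF \<sigma>]
  have inv_Basis: "b \<in> Basis \<Longrightarrow> inv \<sigma> b \<in> Basis" for b by (simp add: permutes_in_image[OF inv])
  fix l u :: 'a assume lower_le_upper: "\<And>b. b \<in> Basis \<Longrightarrow> l \<bullet> b \<le> u \<bullet> b"
  have "?T w \<in> box l u \<longleftrightarrow> w \<in> box (?S l) (?S u)" for w
  proof -
    have "?T w \<in> box l u \<longleftrightarrow> (\<forall>b\<in>Basis. l \<bullet> inv \<sigma> (\<sigma> b) < w \<bullet> \<sigma> b \<and> w \<bullet> \<sigma> b < u \<bullet> inv \<sigma> (\<sigma> b))"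
      by (simp add: mem_box permute_coords_inner permutes_inverses[OF \<sigma>])
    also have "\<dots> \<longleftrightarrow> (\<forall>b\<in>\<sigma> ` Basis. l \<bullet> inv \<sigma> b < w \<bullet> b \<and> w \<bullet> b < u \<bullet> inv \<sigma> b)" by simp
    finally show ?thesis by (simp add: permutes_image[OF \<sigma>] mem_box permute_coords_inner)
  qed
  then have "?T -` box l u = box (?S l) (?S u)" by auto
  then have "emeasure (distr lborel borel ?T) (box l u) = emeasure lborel (box (?S l) (?S u))"
    by (subst emeasure_distr) auto
  also have "\<dots> = (\<Prod>b\<in>Basis. (u - l) \<bullet> inv \<sigma> b)"
    using lower_le_upper inv_Basis
    by (subst emeasure_lborel_box) (auto simp: permute_coords_inner inner_diff_left)
  also have "\<dots> = (\<Prod>b\<in>Basis. (u - l) \<bullet> b)"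
    using prod.permute[OF inv, of "\<lambda>b. (u - l) \<bullet> b"] by (simp add: comp_def)
  finally show "emeasure (distr lborel borel ?T) (box l u) = (\<Prod>b\<in>Basis. (u - l) \<bullet> b)" .
qed simp

lemma integral_ball_prob_permute_coords:
  fixes f :: "'a::euclidean_space \<Rightarrow> real"
  assumes "\<sigma> permutes Basis" and "f \<in> borel_measurable borel"
  shows "(\<integral>w. f (permute_coords \<sigma> w) \<partial>ball_prob) = (\<integral>w. f w \<partial>ball_prob)"
proof (rule integral_ball_prob_isometry[OF _ assms(2) lborel_distr_permute_coords[OF assms(1)]])
  show "norm (permute_coords \<sigma> w) = norm w" for w
    by (rule norm_eq_of_coordinates)
       (use sum.permute[OF assms(1), of "\<lambda>b. (w \<bullet> b)\<^sup>2"] in \<open>simp add: permute_coords_inner comp_def\<close>)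
qed (simp add: permute_coords_def[abs_def])

lemma integrable_ball_prob_linear:
  fixes f :: "'a::euclidean_space \<Rightarrow> real"
  assumes "linear f"
  shows "integrable ball_prob f"
proof -
  obtain B where "B > 0" and B: "\<And>w. norm (f w) \<le> B * norm w"
    using linear_bounded_pos[OF assms] by blast
  have "\<bar>f w\<bar> \<le> B" if "norm w < 1" for w
    using order_trans[OF B[of w] mult_left_mono[of "norm w" 1 B]] \<open>B > 0\<close> that by simp
  then show ?thesis
    using linear_continuous_on[of f] assms
    by (intro integrable_ball_prob_bounded[where B=B] borel_measurable_continuous_onI)
       (auto simp: linear_conv_bounded_linear)
qed

lemma integral_ball_prob_linear:
  fixes f :: "'a::euclidean_space \<Rightarrow> real"
  assumes "linear f"
  shows "(\<integral>w. f w \<partial>ball_prob) = 0"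
  using integral_ball_prob_uminus[of f] integrable_ball_prob_linear[OF assms]
  by (simp add: linear_neg[OF assms] borel_measurable_integrable)

lemma integrable_ball_prob_coordinates:
  "integrable ball_prob (\<lambda>w. (w \<bullet> i) * (w \<bullet> j))" if "i \<in> Basis" "j \<in> Basis"
  for i j :: "'a::euclidean_space"
proof (rule integrable_ball_prob_bounded)
  show "\<bar>(w \<bullet> i) * (w \<bullet> j)\<bar> \<le> 1" if "norm w < 1" for w
    using that \<open>i \<in> Basis\<close> \<open>j \<in> Basis\<close> Basis_le_norm[of i w] Basis_le_norm[of j w]
    by (simp add: abs_mult mult_le_one)
qed simp

lemma integral_ball_prob_coordinates_distinct:
  fixes i j :: "'a::euclidean_space"
  assumes "i \<in> Basis" "j \<in> Basis" "i \<noteq> j"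
  shows "(\<integral>w. (w \<bullet> i) * (w \<bullet> j) \<partial>ball_prob) = 0"
  using integral_ball_prob_reflect[of "\<lambda>w. (w \<bullet> i) * (w \<bullet> j)" i] assms by (simp add: reflect_inner)

lemma integral_ball_prob_coordinate_square_eq:
  fixes i j :: "'a::euclidean_space"
  assumes "i \<in> Basis" "j \<in> Basis"
  shows "(\<integral>w. (w \<bullet> i)\<^sup>2 \<partial>ball_prob) = (\<integral>w. (w \<bullet> j)\<^sup>2 \<partial>ball_prob)"
  using integral_ball_prob_permute_coords[OF permutes_swap_id[OF assms], of "\<lambda>w. (w \<bullet> j)\<^sup>2"] assms
  by (simp add: permute_coords_inner)

lemma integral_ball_prob_coordinate_square_pos:
  fixes i :: "'a::euclidean_space"
  assumes "i \<in> Basis"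
  shows "0 < (\<integral>w. (w \<bullet> i)\<^sup>2 \<partial>ball_prob)"
proof -
  have "(\<integral>w. (w \<bullet> i)\<^sup>2 \<partial>ball_prob) \<noteq> 0"
  proof
    assume "(\<integral>w. (w \<bullet> i)\<^sup>2 \<partial>ball_prob) = 0"
    then have "AE w in ball_prob. w \<bullet> i = 0"
      using integrable_ball_prob_coordinates[OF assms assms]
      by (subst (asm) integral_nonneg_eq_0_iff_AE) (auto simp: power2_eq_square)
    moreover have "AE w in ball_prob. w \<notin> {w. i \<bullet> w = 0}"
    proof -
      have "negligible {w. i \<bullet> w = 0}" using assms by (intro negligible_hyperplane) auto
      then have "{w. i \<bullet> w = 0} \<in> null_sets lborel"
        by (auto simp: negligible_iff_null_sets null_sets_completion_iff)
      from AE_not_in[OF this] show ?thesis unfolding AE_ball_prob by eventually_elim auto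
    qed
    ultimately have "AE w in (ball_prob :: 'a measure). False"
      by eventually_elim (auto simp: inner_commute)
    then show False by simp
  qed
  then show ?thesis by (simp add: order_less_le)
qed

definition bilinear_trace :: "('a::euclidean_space \<Rightarrow> 'a \<Rightarrow> real) \<Rightarrow> real" where
  "bilinear_trace B = (\<Sum>i\<in>Basis. B i i)"

lemma integral_ball_prob_bilinear:
  obtains c where "c > 0" "\<And>B :: 'a::euclidean_space \<Rightarrow> 'a \<Rightarrow> real. bilinear B \<Longrightarrow>
    integrable ball_prob (\<lambda>w. B w w) \<and> (\<integral>w. B w w \<partial>ball_prob) = c * bilinear_trace B"
proof -
  obtain b :: 'a where b: "b \<in> Basis" using nonempty_Basis by blast
  define c where "c = (\<integral>w. (w \<bullet> b)\<^sup>2 \<partial>ball_prob)"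
  have moment: "(\<integral>w. (w \<bullet> i) * (w \<bullet> j) \<partial>ball_prob) = (if i = j then c else 0)"
    if "i \<in> Basis" "j \<in> Basis" for i j :: 'a
    using that integral_ball_prob_coordinates_distinct[OF that]
      integral_ball_prob_coordinate_square_eq[OF b that(1)] by (simp add: c_def power2_eq_square)
  have "integrable ball_prob (\<lambda>w. B w w) \<and> (\<integral>w. B w w \<partial>ball_prob) = c * bilinear_trace B"
    if B: "bilinear B" for B :: "'a \<Rightarrow> 'a \<Rightarrow> real"
  proof -
    have "B w w = (\<Sum>i\<in>Basis. \<Sum>j\<in>Basis. B i j * ((w \<bullet> i) * (w \<bullet> j)))" for w
    proof -
      have "B w w = B (\<Sum>i\<in>Basis. (w \<bullet> i) *\<^sub>R i) (\<Sum>j\<in>Basis. (w \<bullet> j) *\<^sub>R j)"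
        by (simp add: euclidean_representation)
      also have "\<dots> = (\<Sum>i\<in>Basis. \<Sum>j\<in>Basis. B i j * ((w \<bullet> i) * (w \<bullet> j)))"
        unfolding bilinear_sum[OF B] sum.cartesian_product
        by (intro sum.cong) (auto simp: bilinear_lmul[OF B] bilinear_rmul[OF B])
      finally show ?thesis .
    qed
    then show ?thesis
      by (simp add: integrable_ball_prob_coordinates Bochner_Integration.integral_sum moment
          sum.delta sum_distrib_left mult.commute if_distrib bilinear_trace_def cong: if_cong)
  qed
  then show ?thesis
    using integral_ball_prob_coordinate_square_pos[OF b] by (intro that[of c]) (auto simp: c_def)
qed

subsection \<open>Twice continuously differentiable functions\<close>

definition C2_on ::
  "'a::real_normed_vector set \<Rightarrow> ('a \<Rightarrow> real) \<Rightarrow> ('a \<Rightarrow> 'a \<Rightarrow> real) \<Rightarrow> ('a \<Rightarrow> 'a \<Rightarrow> 'a \<Rightarrow> real) \<Rightarrow> bool"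
  where
  "C2_on D f f' f'' \<longleftrightarrow>
     (\<forall>x\<in>D. (f has_derivative f' x) (at x)) \<and>
     (\<forall>x\<in>D. \<forall>v. ((\<lambda>y. f' y v) has_derivative f'' x v) (at x)) \<and>
     (\<forall>v w. continuous_on D (\<lambda>y. f'' y v w))"

lemma harmonic_on_iff_C2_on:
  "harmonic_on D u \<longleftrightarrow> (\<exists>u' u''. C2_on D u u' u'' \<and> (\<forall>x\<in>D. bilinear_trace (u'' x) = 0))"
  unfolding harmonic_on_def C2_on_def bilinear_trace_def by auto

lemma C2_onD:
  assumes "C2_on D f f' f''"
  shows "x \<in> D \<Longrightarrow> (f has_derivative f' x) (at x)"
    and "x \<in> D \<Longrightarrow> ((\<lambda>y. f' y v) has_derivative f'' x v) (at x)"
    and "continuous_on D (\<lambda>y. f'' y v w)"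
  using assms by (auto simp: C2_on_def)

lemma C2_on_subset: "C2_on D f f' f'' \<Longrightarrow> S \<subseteq> D \<Longrightarrow> C2_on S f f' f''"
  unfolding C2_on_def by (blast intro: continuous_on_subset)

lemma C2_on_diff:
  assumes "C2_on D f f' f''" "C2_on D g g' g''"
  shows "C2_on D (\<lambda>x. f x - g x) (\<lambda>x v. f' x v - g' x v) (\<lambda>x v w. f'' x v w - g'' x v w)"
  using assms unfolding C2_on_def by (auto intro!: has_derivative_diff continuous_on_diff)

lemma C2_on_cmult:
  assumes "C2_on D f f' f''"
  shows "C2_on D (\<lambda>x. c * f x) (\<lambda>x v. c * f' x v) (\<lambda>x v w. c * f'' x v w)"
  unfolding C2_on_def
  by (intro conjI ballI allI has_derivative_mult_right continuous_on_mult_left C2_onD[OF assms])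

lemma bilinear_trace_cmult: "bilinear_trace (\<lambda>v w. c * B v w) = c * bilinear_trace B"
  by (simp add: bilinear_trace_def sum_distrib_left)

lemma C2_on_inner_self:
  "C2_on D (\<lambda>x. x \<bullet> x) (\<lambda>x v. 2 * (x \<bullet> v)) (\<lambda>x v w. 2 * (w \<bullet> v))" for D :: "'a::real_inner set"
  unfolding C2_on_def
proof (intro conjI ballI allI)
  show "((\<lambda>x. x \<bullet> x) has_derivative (\<lambda>v. 2 * (x \<bullet> v))) (at x)" for x :: 'a
    by (auto intro!: derivative_eq_intros simp: inner_commute)
  show "((\<lambda>x. 2 * (x \<bullet> v)) has_derivative (\<lambda>w. 2 * (w \<bullet> v))) (at x)" for x v :: 'a
    by (auto intro!: derivative_eq_intros)
qed simp

lemma C2_on_bilinear: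
  assumes f: "C2_on D f f' f''" and D: "open D" "x \<in> D"
  shows "bilinear (f'' x)"
  unfolding bilinear_def
proof (intro conjI allI)
  note f' = C2_onD(2)[OF f D(2)]
  show "linear (f'' x v)" for v using has_derivative_linear[OF f'] .
  have lin: "linear (f' y)" if "y \<in> D" for y
    using has_derivative_linear[OF C2_onD(1)[OF f that]] .
  have "f'' x (v + v') = (\<lambda>w. f'' x v w + f'' x v' w)" for v v'
  proof (rule has_derivative_unique[OF f'])
    show "((\<lambda>y. f' y (v + v')) has_derivative (\<lambda>w. f'' x v w + f'' x v' w)) (at x)"
      by (rule has_derivative_transform_within_open[OF has_derivative_add[OF f' f'] D])
         (simp add: linear_add[OF lin])
  qed
  moreover have "f'' x (c *\<^sub>R v) = (\<lambda>w. c * f'' x v w)" for c v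
  proof (rule has_derivative_unique[OF f'])
    show "((\<lambda>y. f' y (c *\<^sub>R v)) has_derivative (\<lambda>w. c * f'' x v w)) (at x)"
      by (rule has_derivative_transform_within_open[OF has_derivative_mult_right[OF f'] D])
         (simp add: linear_scale[OF lin])
  qed
  ultimately show "linear (\<lambda>v. f'' x v w)" for w by (intro linearI) auto
qed

lemma C2_on_Taylor:
  assumes f: "C2_on D f f' f''" and seg: "\<And>t. 0 \<le> t \<Longrightarrow> t \<le> 1 \<Longrightarrow> x + t *\<^sub>R h \<in> D"
  obtains t where "0 < t" "t < 1" "f (x + h) = f x + f' x h + f'' (x + t *\<^sub>R h) h h / 2"
proof -
  define d where "d m t = (if m = 0 then f (x + t *\<^sub>R h)
    else if m = 1 then f' (x + t *\<^sub>R h) h else f'' (x + t *\<^sub>R h) h h)" for m :: nat and t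
  have line: "((\<lambda>t. x + t *\<^sub>R h) has_derivative (\<lambda>s. s *\<^sub>R h)) (at t)" for t
    by (auto intro!: derivative_eq_intros)
  have along: "((\<lambda>t. g (x + t *\<^sub>R h)) has_real_derivative g' h) (at t)"
    if g: "(g has_derivative g') (at (x + t *\<^sub>R h))" for g g' t
    using has_derivative_compose[OF line g] linear_scale[OF has_derivative_linear[OF g]]
    by (simp add: has_field_derivative_def mult_commute_abs)
  have "\<exists>t>0. t < 1 \<and> f (x + 1 *\<^sub>R h) = (\<Sum>m<2. d m 0 / fact m * 1 ^ m) + d 2 t / fact 2 * 1 ^ 2"
  proof (rule Maclaurin[where diff=d])
    show "\<forall>m t. m < 2 \<and> 0 \<le> t \<and> t \<le> 1 \<longrightarrow> (d m has_real_derivative d (Suc m) t) (at t)"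
    proof (intro allI impI)
      fix m :: nat and t :: real assume "m < 2 \<and> 0 \<le> t \<and> t \<le> 1"
      then consider "m = 0" "x + t *\<^sub>R h \<in> D" | "m = 1" "x + t *\<^sub>R h \<in> D"
        using seg[of t] by linarith
      then show "(d m has_real_derivative d (Suc m) t) (at t)"
        using along[OF C2_onD(1)[OF f]] along[OF C2_onD(2)[OF f, of _ h]]
        by cases (simp_all add: d_def[abs_def])
    qed
  qed (auto simp: d_def)
  then show ?thesis using that by (auto simp: d_def numeral_2_eq_2)
qed

subsection \<open>Uniform Taylor expansions\<close>

definition bounded_support :: "('a::metric_space \<Rightarrow> 'b::zero) \<Rightarrow> bool" where
  "bounded_support f \<longleftrightarrow> bounded {x. f x \<noteq> 0}"

lemma bounded_supportI: "bounded K \<Longrightarrow> (\<And>x. x \<notin> K \<Longrightarrow> f x = 0) \<Longrightarrow> bounded_support f"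
  unfolding bounded_support_def by (rule bounded_subset) auto

lemma bounded_support_imp_bounded_range:
  fixes L :: "'a::heine_borel \<Rightarrow> real"
  assumes "continuous_on UNIV L" "bounded_support L"
  obtains B where "\<And>z. \<bar>L z\<bar> \<le> B"
proof -
  have "compact (L ` closure {x. L x \<noteq> 0})"
    using assms unfolding bounded_support_def
    by (intro compact_continuous_image) (auto intro: continuous_on_subset simp: compact_closure)
  then obtain B where B: "\<And>z. L z \<noteq> 0 \<Longrightarrow> \<bar>L z\<bar> \<le> B"
    using closure_subset[of "{x. L x \<noteq> 0}"] unfolding compact_eq_bounded_closed bounded_iff by auto
  have "\<bar>L z\<bar> \<le> max 0 B" for z using B[of z] by (cases "L z = 0") auto
  then show ?thesis by (rule that)
qed

lemma bounded_support_imp_uniformly_continuous: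
  fixes L :: "'a::{heine_borel,real_normed_vector} \<Rightarrow> 'b::real_normed_vector"
  assumes L: "continuous_on UNIV L" "bounded_support L"
  shows "uniformly_continuous_on UNIV L"
  unfolding uniformly_continuous_on_def
proof (intro allI impI)
  fix e :: real assume "e > 0"
  obtain R where R: "\<And>z. L z \<noteq> 0 \<Longrightarrow> norm z \<le> R"
    using L(2) by (auto simp: bounded_support_def bounded_iff)
  have "uniformly_continuous_on (cball 0 (R + 1)) L"
    using L(1) by (intro compact_uniformly_continuous) (auto intro: continuous_on_subset)
  then obtain d where d: "d > 0" "\<And>x y. norm x \<le> R + 1 \<Longrightarrow> norm y \<le> R + 1 \<Longrightarrow> dist y x < d \<Longrightarrow>
      dist (L y) (L x) < e"
    using \<open>e > 0\<close> unfolding uniformly_continuous_on_def by (auto simp: Ball_def)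
  have "dist (L y) (L x) < e" if "dist y x < min d 1" for x y
  proof (cases "norm x \<le> R \<or> norm y \<le> R")
    case True
    have "norm x \<le> norm y + dist y x" "norm y \<le> norm x + dist y x"
      using norm_triangle_sub[of x y] norm_triangle_sub[of y x]
      by (auto simp: dist_norm norm_minus_commute)
    then show ?thesis using True that by (intro d) auto
  next
    case False
    then have "L x = 0" "L y = 0" using R by blast+
    then show ?thesis using \<open>e > 0\<close> by simp
  qed
  then show "\<exists>d>0. \<forall>x\<in>UNIV. \<forall>y\<in>UNIV. dist y x < d \<longrightarrow> dist (L y) (L x) < e"
    using d(1) by (intro exI[of _ "min d 1"]) auto
qed

lemma abs_sum_coordinates_le:
  fixes v :: "'a::euclidean_space" and a :: "'a \<Rightarrow> real" and e :: real
  assumes "\<And>i. i \<in> Basis \<Longrightarrow> \<bar>a i\<bar> \<le> e"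
  shows "\<bar>\<Sum>i\<in>Basis. (v \<bullet> i) * a i\<bar> \<le> DIM('a) * e * norm v"
proof -
  have "\<bar>\<Sum>i\<in>Basis. (v \<bullet> i) * a i\<bar> \<le> (\<Sum>i\<in>Basis. \<bar>(v \<bullet> i) * a i\<bar>)" by (rule sum_abs)
  also have "\<dots> \<le> (\<Sum>i\<in>(Basis :: 'a set). norm v * e)"
    using assms by (intro sum_mono) (auto simp: abs_mult intro!: mult_mono Basis_le_norm)
  finally show ?thesis by (simp add: ac_simps)
qed

lemma linear_family_equicontinuous:
  fixes L :: "'p::metric_space \<Rightarrow> 'a::euclidean_space \<Rightarrow> real"
  assumes lin: "\<And>x. linear (L x)" and uc: "\<And>v. uniformly_continuous_on UNIV (\<lambda>x. L x v)" and "e > 0"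
  obtains d where "d > 0" "\<And>x y v. dist x y < d \<Longrightarrow> \<bar>L x v - L y v\<bar> \<le> e * norm v"
proof -
  define e' where "e' = e / DIM('a)"
  have "e' > 0" using \<open>e > 0\<close> by (simp add: e'_def)
  have "\<exists>d>0. \<forall>x y. dist x y < d \<longrightarrow> \<bar>L x i - L y i\<bar> < e'" for i
    using uc[of i] \<open>e' > 0\<close> unfolding uniformly_continuous_on_def dist_real_def by (metis UNIV_I)
  then obtain d where d: "\<And>i. d i > 0" "\<And>i x y. dist x y < d i \<Longrightarrow> \<bar>L x i - L y i\<bar> < e'"
    by metis
  show ?thesis
  proof (rule that[of "Min (d ` Basis)"])
    show "Min (d ` Basis) > 0" using d(1) by simp
    fix x y :: 'p and v :: 'a assume "dist x y < Min (d ` Basis)"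
    then have close: "\<bar>L x i - L y i\<bar> \<le> e'" if "i \<in> Basis" for i
      using that by (intro less_imp_le d(2)) simp
    have "L x v - L y v = L x (\<Sum>i\<in>Basis. (v \<bullet> i) *\<^sub>R i) - L y (\<Sum>i\<in>Basis. (v \<bullet> i) *\<^sub>R i)"
      by (simp add: euclidean_representation)
    also have "\<dots> = (\<Sum>i\<in>Basis. (v \<bullet> i) * (L x i - L y i))"
      by (simp add: linear_sum[OF lin] linear_scale[OF lin] right_diff_distrib sum_subtractf)
    also have "\<bar>\<dots>\<bar> \<le> DIM('a) * e' * norm v"
      by (rule abs_sum_coordinates_le) (rule close)
    finally show "\<bar>L x v - L y v\<bar> \<le> e * norm v" by (simp add: e'_def)
  qed
qed

lemma bilinear_family_equicontinuous:
  fixes B :: "'p::metric_space \<Rightarrow> 'a::euclidean_space \<Rightarrow> 'a \<Rightarrow> real"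
  assumes bil: "\<And>x. bilinear (B x)" and uc: "\<And>v w. uniformly_continuous_on UNIV (\<lambda>x. B x v w)"
    and "e > 0"
  obtains d where "d > 0" "\<And>x y v w. dist x y < d \<Longrightarrow> \<bar>B x v w - B y v w\<bar> \<le> e * norm v * norm w"
proof -
  define e' where "e' = e / DIM('a)"
  have "e' > 0" using \<open>e > 0\<close> by (simp add: e'_def)
  have lin: "linear (B x i)" "linear (\<lambda>v. B x v w)" for x i w using bil by (auto simp: bilinear_def)
  have "\<exists>d>0. \<forall>x y w. dist x y < d \<longrightarrow> \<bar>B x i w - B y i w\<bar> \<le> e' * norm w" for i
    using linear_family_equicontinuous[of "\<lambda>x. B x i", OF lin(1) uc \<open>e' > 0\<close>] by metis
  then obtain d where d: "\<And>i. d i > 0" "\<And>i x y w. dist x y < d i \<Longrightarrow> \<bar>B x i w - B y i w\<bar> \<le> e' * norm w"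
    by metis
  show ?thesis
  proof (rule that[of "Min (d ` Basis)"])
    show "Min (d ` Basis) > 0" using d(1) by simp
    fix x y :: 'p and v w :: 'a assume "dist x y < Min (d ` Basis)"
    then have close: "\<bar>B x i w - B y i w\<bar> \<le> e' * norm w" if "i \<in> Basis" for i
      using that by (intro d(2)) simp
    have "B x v w - B y v w = B x (\<Sum>i\<in>Basis. (v \<bullet> i) *\<^sub>R i) w - B y (\<Sum>i\<in>Basis. (v \<bullet> i) *\<^sub>R i) w"
      by (simp add: euclidean_representation)
    also have "\<dots> = (\<Sum>i\<in>Basis. (v \<bullet> i) * (B x i w - B y i w))"
      by (simp add: linear_sum[OF lin(2)] linear_scale[OF lin(2)] right_diff_distrib sum_subtractf)
    also have "\<bar>\<dots>\<bar> \<le> DIM('a) * (e' * norm w) * norm v"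
      by (rule abs_sum_coordinates_le) (rule close)
    finally show "\<bar>B x v w - B y v w\<bar> \<le> e * norm v * norm w" by (simp add: e'_def ac_simps)
  qed
qed

lemma uniform_linearization:
  fixes f :: "'a::euclidean_space \<Rightarrow> real"
  assumes f: "\<And>x. (f has_derivative f' x) (at x)"
    and uc: "\<And>v. uniformly_continuous_on UNIV (\<lambda>x. f' x v)" and "e > 0"
  obtains d where "d > 0" "\<And>x h. norm h < d \<Longrightarrow> \<bar>f (x + h) - f x - f' x h\<bar> \<le> e * norm h"
proof -
  obtain d where d: "d > 0" "\<And>x y v. dist x y < d \<Longrightarrow> \<bar>f' x v - f' y v\<bar> \<le> e * norm v"
    using linear_family_equicontinuous[OF has_derivative_linear[OF f] uc \<open>e > 0\<close>] by blast
  have "\<bar>f (x + h) - f x - f' x h\<bar> \<le> e * norm h" if h: "norm h < d" for x h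
  proof -
    have "norm (f (x + h) - f x - f' x (x + h - x)) \<le> norm (x + h - x) * e"
    proof (rule differentiable_bound_linearization[where S="ball x d"])
      show "x + t *\<^sub>R (x + h - x) \<in> ball x d" if "t \<in> {0..1}" for t
        using that h mult_right_mono[of t 1 "norm h"] by (simp add: dist_norm)
      show "onorm (f' y - f' x) \<le> e" if "y \<in> ball x d" for y
        using d(2)[of y x] that by (intro onorm_le) (auto simp: dist_commute)
    qed (use d(1) f in \<open>auto intro: has_derivative_at_withinI\<close>)
    then show ?thesis by (simp add: mult.commute)
  qed
  then show ?thesis using d(1) that by blast
qed

definition test_function ::
  "'a::euclidean_space set \<Rightarrow> ('a \<Rightarrow> real) \<Rightarrow> ('a \<Rightarrow> 'a \<Rightarrow> real) \<Rightarrow> ('a \<Rightarrow> 'a \<Rightarrow> 'a \<Rightarrow> real) \<Rightarrow> bool"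
  where
  "test_function D \<phi> \<phi>' \<phi>'' \<longleftrightarrow>
     C2_on UNIV \<phi> \<phi>' \<phi>'' \<and> (\<exists>K. compact K \<and> K \<subseteq> D \<and> (\<forall>x. x \<notin> K \<longrightarrow> \<phi> x = 0))"

lemma test_function_support:
  assumes "test_function D \<phi> \<phi>' \<phi>''"
  obtains K where "compact K" "K \<subseteq> D" "\<And>x. x \<notin> K \<Longrightarrow> \<phi> x = 0"
    "\<And>x v. x \<notin> K \<Longrightarrow> \<phi>' x v = 0" "\<And>x v w. x \<notin> K \<Longrightarrow> \<phi>'' x v w = 0"
proof -
  obtain K where K: "compact K" "K \<subseteq> D" "\<And>x. x \<notin> K \<Longrightarrow> \<phi> x = 0" and \<phi>: "C2_on UNIV \<phi> \<phi>' \<phi>''"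
    using assms unfolding test_function_def by auto
  have derivative_outside: "f' = (\<lambda>_. 0)" if f: "\<And>y. y \<notin> K \<Longrightarrow> f y = 0"
    and f': "(f has_derivative f') (at x)"
    and "x \<notin> K"
    for f :: "'a \<Rightarrow> real" and f' x
  proof (rule has_derivative_unique[OF f'])
    show "(f has_derivative (\<lambda>_. 0)) (at x)"
      by (rule has_derivative_transform_within_open[OF has_derivative_const, of "- K" x 0])
         (use K(1) f \<open>x \<notin> K\<close> in \<open>auto dest: compact_imp_closed\<close>)
  qed
  have \<phi>': "\<phi>' x v = 0" if "x \<notin> K" for x v
    using derivative_outside[OF K(3) C2_onD(1)[OF \<phi>] that] by simp
  moreover have "\<phi>'' x v w = 0" if "x \<notin> K" for x v w
    using derivative_outside[OF \<phi>' C2_onD(2)[OF \<phi>] that] by simp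
  ultimately show ?thesis using K by (intro that[of K])
qed

lemma test_function_imp_continuous:
  assumes "test_function D \<phi> \<phi>' \<phi>''"
  shows "continuous_on UNIV \<phi>" "continuous_on UNIV (\<lambda>x. \<phi>' x v)" "continuous_on UNIV (\<lambda>x. \<phi>'' x v w)"
proof -
  have \<phi>: "C2_on UNIV \<phi> \<phi>' \<phi>''" using assms by (simp add: test_function_def)
  show "continuous_on UNIV \<phi>" "continuous_on UNIV (\<lambda>x. \<phi>' x v)"
    unfolding continuous_on_eq_continuous_at[OF open_UNIV]
    using has_derivative_continuous[OF C2_onD(1)[OF \<phi>]] has_derivative_continuous[OF C2_onD(2)[OF \<phi>]]
    by auto
  show "continuous_on UNIV (\<lambda>x. \<phi>'' x v w)" by (rule C2_onD(3)[OF \<phi>])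
qed

lemma test_function_imp_bounded_support:
  assumes "test_function D \<phi> \<phi>' \<phi>''"
  shows "bounded_support \<phi>" "bounded_support (\<lambda>x. \<phi>' x v)" "bounded_support (\<lambda>x. \<phi>'' x v w)"
  using test_function_support[OF assms] by (metis bounded_supportI compact_imp_bounded)+

definition Taylor_remainder ::
  "('a::real_normed_vector \<Rightarrow> real) \<Rightarrow> ('a \<Rightarrow> 'a \<Rightarrow> real) \<Rightarrow> ('a \<Rightarrow> 'a \<Rightarrow> 'a \<Rightarrow> real) \<Rightarrow> 'a \<Rightarrow> 'a \<Rightarrow> real"
  where
  "Taylor_remainder f f' f'' x h = f (x + h) - f x - f' x h - f'' x h h / 2"

lemma test_function_Taylor_remainder:
  assumes \<phi>: "test_function D \<phi> \<phi>' \<phi>''" and "e > 0"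
  obtains d where "d > 0" "\<And>x h. norm h < d \<Longrightarrow> \<bar>Taylor_remainder \<phi> \<phi>' \<phi>'' x h\<bar> \<le> e * (norm h)\<^sup>2"
proof -
  have C2: "C2_on UNIV \<phi> \<phi>' \<phi>''" using \<phi> by (simp add: test_function_def)
  have uc: "uniformly_continuous_on UNIV (\<lambda>x. \<phi>'' x v w)" for v w
    by (rule bounded_support_imp_uniformly_continuous
        [OF test_function_imp_continuous(3)[OF \<phi>] test_function_imp_bounded_support(3)[OF \<phi>]])
  obtain d where d: "d > 0" "\<And>x y v w. dist x y < d \<Longrightarrow>
      \<bar>\<phi>'' x v w - \<phi>'' y v w\<bar> \<le> 2 * e * norm v * norm w"
    using bilinear_family_equicontinuous[OF C2_on_bilinear[OF C2 open_UNIV UNIV_I] uc, of "2 * e"]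
      \<open>e > 0\<close> by auto
  have "\<bar>Taylor_remainder \<phi> \<phi>' \<phi>'' x h\<bar> \<le> e * (norm h)\<^sup>2" if h: "norm h < d" for x h
  proof -
    obtain t where t: "0 < t" "t < 1" "\<phi> (x + h) = \<phi> x + \<phi>' x h + \<phi>'' (x + t *\<^sub>R h) h h / 2"
      using C2_on_Taylor[OF C2, of x h] by auto
    have "\<bar>\<phi>'' (x + t *\<^sub>R h) h h - \<phi>'' x h h\<bar> \<le> 2 * e * norm h * norm h"
      using h t mult_right_mono[of t 1 "norm h"] by (intro d(2)) (auto simp: dist_norm)
    then show ?thesis unfolding Taylor_remainder_def t(3) by (simp add: power2_eq_square)
  qed
  then show ?thesis using d(1) that by blast
qed

subsection \<open>Mean values over balls\<close>

definition ball_mean :: "real \<Rightarrow> ('a::euclidean_space \<Rightarrow> real) \<Rightarrow> 'a \<Rightarrow> real" where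
  "ball_mean \<epsilon> f x = (\<integral>w. f (x + \<epsilon> *\<^sub>R w) \<partial>ball_prob)"

lemma borel_measurable_ball_mean [measurable]:
  assumes [measurable]: "f \<in> borel_measurable borel"
  shows "ball_mean \<epsilon> f \<in> borel_measurable borel"
  unfolding ball_mean_def[abs_def] by measurable

lemma ball_mean_const [simp]: "ball_mean \<epsilon> (\<lambda>_. c) x = c"
  by (simp add: ball_mean_def)

lemma ball_mean_cong:
  assumes "f \<in> borel_measurable borel" "g \<in> borel_measurable borel" "0 < \<epsilon>"
    and agree: "\<And>y. dist x y < \<epsilon> \<Longrightarrow> f y = g y"
  shows "ball_mean \<epsilon> f x = ball_mean \<epsilon> g x"
  unfolding ball_mean_def
proof (rule integral_cong_AE)
  show "AE w in ball_prob. f (x + \<epsilon> *\<^sub>R w) = g (x + \<epsilon> *\<^sub>R w)"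
    using \<open>0 < \<epsilon>\<close> by (intro AE_ball_probI agree) (simp add: dist_norm)
qed (use assms in measurable)

definition mean_quotient :: "real \<Rightarrow> ('a::euclidean_space \<Rightarrow> real) \<Rightarrow> 'a \<Rightarrow> real" where
  "mean_quotient \<epsilon> f x = (ball_mean \<epsilon> f x - f x) / \<epsilon>\<^sup>2"

lemma integral_Taylor_remainder:
  fixes \<phi> :: "'a::euclidean_space \<Rightarrow> real"
  assumes \<phi>: "test_function D \<phi> \<phi>' \<phi>''"
  obtains c where "c > 0"
    "\<And>\<epsilon> x. integrable ball_prob (\<lambda>w. Taylor_remainder \<phi> \<phi>' \<phi>'' x (\<epsilon> *\<^sub>R w))"
    "\<And>\<epsilon> x. (\<integral>w. Taylor_remainder \<phi> \<phi>' \<phi>'' x (\<epsilon> *\<^sub>R w) \<partial>ball_prob)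
      = ball_mean \<epsilon> \<phi> x - \<phi> x - \<epsilon>\<^sup>2 * (c * bilinear_trace (\<phi>'' x))"
proof -
  obtain c where c_pos: "c > 0" and bil: "\<And>B :: 'a \<Rightarrow> 'a \<Rightarrow> real. bilinear B \<Longrightarrow>
      integrable ball_prob (\<lambda>w. B w w) \<and> (\<integral>w. B w w \<partial>ball_prob) = c * bilinear_trace B"
    using integral_ball_prob_bilinear by blast
  have C2: "C2_on UNIV \<phi> \<phi>' \<phi>''" using \<phi> by (simp add: test_function_def)
  note lin = has_derivative_linear[OF C2_onD(1)[OF C2 UNIV_I]]
    and bilin = C2_on_bilinear[OF C2 open_UNIV UNIV_I]
    and cont = test_function_imp_continuous(1)[OF \<phi>]
  have [measurable]: "\<phi> \<in> borel_measurable borel" by (rule borel_measurable_continuous_onI[OF cont])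
  obtain B where B: "\<And>y. \<bar>\<phi> y\<bar> \<le> B"
    using bounded_support_imp_bounded_range[OF cont test_function_imp_bounded_support(1)[OF \<phi>]]
    by blast
  have "integrable ball_prob (\<lambda>w. \<phi> (x + \<epsilon> *\<^sub>R w))" for \<epsilon> x
    by (rule integrable_ball_prob_bounded[where B=B]) (simp_all add: B)
  note ints = this integrable_ball_prob_linear[OF lin] bil[OF bilin]
  have rem: "Taylor_remainder \<phi> \<phi>' \<phi>'' x (\<epsilon> *\<^sub>R w)
      = \<phi> (x + \<epsilon> *\<^sub>R w) - \<phi> x - \<epsilon> * \<phi>' x w - \<epsilon>\<^sup>2 / 2 * \<phi>'' x w w" for \<epsilon> x w
    using bilin by (simp add: Taylor_remainder_def linear_scale[OF lin] bilinear_lmul bilinear_rmul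
        power2_eq_square)
  show ?thesis
  proof (rule that[of "c / 2"])
    show "integrable ball_prob (\<lambda>w. Taylor_remainder \<phi> \<phi>' \<phi>'' x (\<epsilon> *\<^sub>R w))" for \<epsilon> x
      unfolding rem using ints by simp
    show "(\<integral>w. Taylor_remainder \<phi> \<phi>' \<phi>'' x (\<epsilon> *\<^sub>R w) \<partial>ball_prob)
        = ball_mean \<epsilon> \<phi> x - \<phi> x - \<epsilon>\<^sup>2 * (c / 2 * bilinear_trace (\<phi>'' x))" for \<epsilon> x
      unfolding rem using ints integral_ball_prob_linear[OF lin] by (simp add: ball_mean_def)
  qed (use c_pos in simp)
qed

lemma mean_quotient_tendsto_laplacian:
  fixes \<phi> :: "'a::euclidean_space \<Rightarrow> real"
  assumes \<phi>: "test_function D \<phi> \<phi>' \<phi>''"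
  obtains c where "c > 0"
    "uniform_limit UNIV (\<lambda>\<epsilon>. mean_quotient \<epsilon> \<phi>) (\<lambda>x. c * bilinear_trace (\<phi>'' x)) (at_right 0)"
proof -
  let ?rem = "Taylor_remainder \<phi> \<phi>' \<phi>''"
  obtain c where c_pos: "c > 0" and rem: "\<And>\<epsilon> x. integrable ball_prob (\<lambda>w. ?rem x (\<epsilon> *\<^sub>R w))"
    "\<And>\<epsilon> x. (\<integral>w. ?rem x (\<epsilon> *\<^sub>R w) \<partial>ball_prob) = ball_mean \<epsilon> \<phi> x - \<phi> x
        - \<epsilon>\<^sup>2 * (c * bilinear_trace (\<phi>'' x))"
    by (rule integral_Taylor_remainder[OF \<phi>]) blast
  have "uniform_limit UNIV (\<lambda>\<epsilon>. mean_quotient \<epsilon> \<phi>) (\<lambda>x. c * bilinear_trace (\<phi>'' x)) (at_right 0)"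
  proof (rule uniform_limitI)
    fix e :: real assume "e > 0"
    then obtain d where d: "d > 0" "\<And>x h. norm h < d \<Longrightarrow> \<bar>?rem x h\<bar> \<le> e / 2 * (norm h)\<^sup>2"
      using test_function_Taylor_remainder[OF \<phi>, of "e / 2"] by auto
    have "dist (mean_quotient \<epsilon> \<phi> x) (c * bilinear_trace (\<phi>'' x)) < e" if \<epsilon>: "0 < \<epsilon>" "\<epsilon> < d" for \<epsilon> x
    proof -
      have "\<bar>?rem x (\<epsilon> *\<^sub>R w)\<bar> \<le> e / 2 * \<epsilon>\<^sup>2" if "norm w < 1" for w
      proof -
        have w: "norm (\<epsilon> *\<^sub>R w) \<le> \<epsilon>" using \<epsilon> that by (simp add: mult_left_le)
        then have "\<bar>?rem x (\<epsilon> *\<^sub>R w)\<bar> \<le> e / 2 * (norm (\<epsilon> *\<^sub>R w))\<^sup>2" using \<epsilon> by (intro d(2)) linarith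
        also have "\<dots> \<le> e / 2 * \<epsilon>\<^sup>2" using w \<open>e > 0\<close> by (intro mult_left_mono power_mono) auto
        finally show ?thesis .
      qed
      then have "\<bar>\<integral>w. ?rem x (\<epsilon> *\<^sub>R w) \<partial>ball_prob\<bar> \<le> e / 2 * \<epsilon>\<^sup>2"
        using rem(1) by (intro ball_prob.abs_expectation_le AE_ball_probI) auto
      moreover have "mean_quotient \<epsilon> \<phi> x - c * bilinear_trace (\<phi>'' x)
          = (\<integral>w. ?rem x (\<epsilon> *\<^sub>R w) \<partial>ball_prob) / \<epsilon>\<^sup>2"
        using \<epsilon> by (simp add: mean_quotient_def rem(2) diff_divide_distrib)
      ultimately have "dist (mean_quotient \<epsilon> \<phi> x) (c * bilinear_trace (\<phi>'' x)) \<le> e / 2"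
        using \<epsilon> by (simp add: dist_real_def divide_le_eq)
      then show ?thesis using \<open>e > 0\<close> by simp
    qed
    then show "\<forall>\<^sub>F \<epsilon> in at_right 0. \<forall>x\<in>UNIV.
        dist (mean_quotient \<epsilon> \<phi> x) (c * bilinear_trace (\<phi>'' x)) < e"
      using d(1) unfolding eventually_at_right_field by blast
  qed
  then show ?thesis using c_pos by (rule that[rotated])
qed

lemma lborel_integral_translate:
  fixes f :: "'a::euclidean_space \<Rightarrow> real"
  assumes "f \<in> borel_measurable borel"
  shows "(\<integral>y. f (y + c) \<partial>lborel) = (\<integral>y. f y \<partial>lborel)"
proof -
  have "(\<integral>y. f (c + y) \<partial>lborel) = integral\<^sup>L (distr lborel borel ((+) c)) f"
    using assms by (subst integral_distr) auto
  then show ?thesis by (simp add: lborel_distr_plus add.commute)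
qed

lemma Fubini_ball_prob_lborel:
  fixes f :: "'a::euclidean_space \<Rightarrow> 'a \<Rightarrow> real"
  assumes [measurable]: "case_prod f \<in> borel_measurable (borel \<Otimes>\<^sub>M borel)"
    and int: "\<And>w. integrable lborel (f w)" and B: "\<And>w. (\<integral>y. \<bar>f w y\<bar> \<partial>lborel) \<le> B"
  shows "(\<integral>y. (\<integral>w. f w y \<partial>ball_prob) \<partial>lborel) = (\<integral>w. (\<integral>y. f w y \<partial>lborel) \<partial>ball_prob)"
    and "integrable lborel (\<lambda>y. \<integral>w. f w y \<partial>ball_prob)"
proof -
  interpret P: pair_sigma_finite "ball_prob :: 'a measure" "lborel :: 'a measure"
    by (intro pair_sigma_finite.intro ball_prob.sigma_finite_measure_axioms sigma_finite_lborel)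
  have "sets ((ball_prob :: 'a measure) \<Otimes>\<^sub>M (lborel :: 'a measure)) = sets (borel \<Otimes>\<^sub>M borel)"
    by (rule sets_pair_measure_cong) auto
  then have [measurable]: "case_prod f \<in> borel_measurable (ball_prob \<Otimes>\<^sub>M lborel)"
    using assms(1) by (simp cong: measurable_cong_sets)
  have "integrable (ball_prob \<Otimes>\<^sub>M lborel) (case_prod f)"
  proof (rule P.Fubini_integrable)
    show "integrable ball_prob (\<lambda>w. \<integral>y. norm (case_prod f (w, y)) \<partial>lborel)"
      using B by (intro ball_prob.integrable_const_bound[of _ B]) auto
  qed (use int in auto)
  then show "(\<integral>y. (\<integral>w. f w y \<partial>ball_prob) \<partial>lborel) = (\<integral>w. (\<integral>y. f w y \<partial>lborel) \<partial>ball_prob)"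
    and "integrable lborel (\<lambda>y. \<integral>w. f w y \<partial>ball_prob)"
    by (rule P.Fubini_integral, rule P.integrable_snd)
qed

lemma integrable_mult_bounded:
  fixes f g :: "'a \<Rightarrow> real"
  assumes "integrable M g" "f \<in> borel_measurable M" "\<And>y. \<bar>f y\<bar> \<le> C"
  shows "integrable M (\<lambda>y. g y * f y)"
    and "\<bar>\<integral>y. g y * f y \<partial>M\<bar> \<le> C * (\<integral>y. \<bar>g y\<bar> \<partial>M)"
    and "(\<integral>y. \<bar>g y * f y\<bar> \<partial>M) \<le> C * (\<integral>y. \<bar>g y\<bar> \<partial>M)"
proof -
  have bound: "\<bar>g y * f y\<bar> \<le> C * \<bar>g y\<bar>" for y
    using mult_left_mono[OF assms(3)[of y], of "\<bar>g y\<bar>"] by (simp add: abs_mult mult.commute)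
  show int: "integrable M (\<lambda>y. g y * f y)"
  proof (rule Bochner_Integration.integrable_bound)
    show "integrable M (\<lambda>y. C * \<bar>g y\<bar>)" using assms(1) by simp
    show "AE y in M. norm (g y * f y) \<le> norm (C * \<bar>g y\<bar>)"
      using order_trans[OF bound abs_ge_self] by simp
  qed (use assms in measurable)
  have "(\<integral>y. \<bar>g y * f y\<bar> \<partial>M) \<le> (\<integral>y. C * \<bar>g y\<bar> \<partial>M)"
    using int assms(1) bound by (intro integral_mono) auto
  then show "(\<integral>y. \<bar>g y * f y\<bar> \<partial>M) \<le> C * (\<integral>y. \<bar>g y\<bar> \<partial>M)" by simp
  then show "\<bar>\<integral>y. g y * f y \<partial>M\<bar> \<le> C * (\<integral>y. \<bar>g y\<bar> \<partial>M)"
    by (rule order_trans[OF integral_abs_bound])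
qed

lemma integrable_lborel_translate:
  fixes g :: "'a::euclidean_space \<Rightarrow> real"
  assumes "integrable lborel g"
  shows "integrable lborel (\<lambda>y. g (y + c))"
  using integrable_distr_eq[where g="(+) c" and f=g and M=lborel and N=borel] assms
  by (simp add: lborel_distr_plus add.commute)

lemma integrable_ball_mean:
  assumes g: "integrable lborel g"
  shows "integrable lborel (ball_mean \<epsilon> g)"
proof -
  have [measurable]: "g \<in> borel_measurable borel" using g by simp
  show ?thesis
    unfolding ball_mean_def[abs_def]
    using lborel_integral_translate[of "\<lambda>y. \<bar>g y\<bar>"]
    by (intro Fubini_ball_prob_lborel(2)[where B="\<integral>y. \<bar>g y\<bar> \<partial>lborel"])
       (auto intro: integrable_lborel_translate[OF g])
qed

lemma ball_mean_self_adjoint: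
  fixes f g :: "'a::euclidean_space \<Rightarrow> real"
  assumes [measurable]: "f \<in> borel_measurable borel" and C: "\<And>y. \<bar>f y\<bar> \<le> C"
    and g: "integrable lborel g"
  shows "(\<integral>y. g y * ball_mean \<epsilon> f y \<partial>lborel) = (\<integral>y. ball_mean \<epsilon> g y * f y \<partial>lborel)"
proof -
  have [measurable]: "g \<in> borel_measurable borel" using g by simp
  note shift = integrable_lborel_translate[OF g]
  have bound: "(\<integral>y. \<bar>g (y + c) * f y\<bar> \<partial>lborel) \<le> C * (\<integral>y. \<bar>g y\<bar> \<partial>lborel)" for c
    using integrable_mult_bounded(3)[OF shift[of c] _ C] lborel_integral_translate[of "\<lambda>y. \<bar>g y\<bar>"]
    by simp
  have "(\<integral>y. g y * ball_mean \<epsilon> f y \<partial>lborel) = (\<integral>y. (\<integral>w. g y * f (y + \<epsilon> *\<^sub>R w) \<partial>ball_prob) \<partial>lborel)"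
    by (simp add: ball_mean_def)
  also have "\<dots> = (\<integral>w. (\<integral>y. g y * f (y + \<epsilon> *\<^sub>R w) \<partial>lborel) \<partial>ball_prob)"
    by (rule Fubini_ball_prob_lborel(1)) (auto intro!: integrable_mult_bounded g C)
  also have "\<dots> = (\<integral>w. (\<integral>y. g (y + \<epsilon> *\<^sub>R (- w)) * f y \<partial>lborel) \<partial>ball_prob)"
  proof (rule Bochner_Integration.integral_cong[OF refl])
    show "(\<integral>y. g y * f (y + \<epsilon> *\<^sub>R w) \<partial>lborel) = (\<integral>y. g (y + \<epsilon> *\<^sub>R (- w)) * f y \<partial>lborel)" for w
      using lborel_integral_translate[of "\<lambda>y. g (y + \<epsilon> *\<^sub>R (- w)) * f y", where c="\<epsilon> *\<^sub>R w"] by simp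
  qed
  also have "\<dots> = (\<integral>w. (\<integral>y. g (y + \<epsilon> *\<^sub>R w) * f y \<partial>lborel) \<partial>ball_prob)"
    by (rule integral_ball_prob_uminus) measurable
  also have "\<dots> = (\<integral>y. (\<integral>w. g (y + \<epsilon> *\<^sub>R w) * f y \<partial>ball_prob) \<partial>lborel)"
    by (rule Fubini_ball_prob_lborel(1)[symmetric])
       (auto intro!: integrable_mult_bounded(1) shift C bound)
  finally show ?thesis by (simp add: ball_mean_def)
qed

lemma bounded_support_imp_integrable:
  fixes L :: "'a::euclidean_space \<Rightarrow> real"
  assumes "continuous_on UNIV L" "bounded_support L"
  shows "integrable lborel L"
proof -
  let ?K = "closure {x. L x \<noteq> 0}"
  have "integrable lborel (\<lambda>x. indicator ?K x *\<^sub>R L x)"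
    using assms unfolding bounded_support_def
    by (intro borel_integrable_compact) (auto intro: continuous_on_subset simp: compact_closure)
  also have "(\<lambda>x. indicator ?K x *\<^sub>R L x) = L"
    using closure_subset[of "{x. L x \<noteq> 0}"] by (auto simp: indicator_def fun_eq_iff)
  finally show ?thesis .
qed

lemma integral_mult_mean_quotient_eq_0:
  fixes u \<phi> :: "'a::euclidean_space \<Rightarrow> real"
  assumes u: "u \<in> borel_measurable borel" "\<And>y. \<bar>u y\<bar> \<le> M" and \<phi>: "integrable lborel \<phi>"
    and mean: "\<And>x. \<phi> x \<noteq> 0 \<Longrightarrow> u x = ball_mean \<epsilon> u x"
  shows "(\<integral>y. u y * mean_quotient \<epsilon> \<phi> y \<partial>lborel) = 0"
proof -
  have "(\<integral>y. ball_mean \<epsilon> \<phi> y * u y \<partial>lborel) = (\<integral>y. \<phi> y * ball_mean \<epsilon> u y \<partial>lborel)"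
    by (rule ball_mean_self_adjoint[OF u \<phi>, symmetric])
  also have "\<dots> = (\<integral>y. \<phi> y * u y \<partial>lborel)"
    using mean by (intro Bochner_Integration.integral_cong refl) fastforce
  finally show ?thesis
    using integrable_mult_bounded(1)[OF integrable_ball_mean[OF \<phi>] _ u(2)]
      integrable_mult_bounded(1)[OF \<phi> _ u(2)] u(1)
    by (simp add: mean_quotient_def right_diff_distrib mult.commute[of "u _"])
qed

lemma continuous_bilinear_trace:
  assumes "\<And>i. continuous_on S (\<lambda>x. B x i i)"
  shows "continuous_on S (\<lambda>x. bilinear_trace (B x))"
  unfolding bilinear_trace_def by (intro continuous_on_sum assms)

lemma mean_quotient_eventually_bounded:
  fixes \<phi> :: "'a::euclidean_space \<Rightarrow> real"
  assumes \<phi>: "test_function D \<phi> \<phi>' \<phi>''"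
  obtains B where "\<forall>\<^sub>F \<epsilon> in at_right 0. \<forall>x. \<bar>mean_quotient \<epsilon> \<phi> x\<bar> \<le> B"
proof -
  obtain K where K: "compact K" "\<And>x v w. x \<notin> K \<Longrightarrow> \<phi>'' x v w = 0"
    by (rule test_function_support[OF \<phi>]) blast
  obtain c where expansion:
    "uniform_limit UNIV (\<lambda>\<epsilon>. mean_quotient \<epsilon> \<phi>) (\<lambda>x. c * bilinear_trace (\<phi>'' x)) (at_right 0)"
    by (rule mean_quotient_tendsto_laplacian[OF \<phi>])
  obtain B where B: "\<And>x. \<bar>c * bilinear_trace (\<phi>'' x)\<bar> \<le> B"
  proof (rule bounded_support_imp_bounded_range)
    show "continuous_on UNIV (\<lambda>x. c * bilinear_trace (\<phi>'' x))"
      by (intro continuous_intros continuous_bilinear_trace test_function_imp_continuous(3)[OF \<phi>])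
    show "bounded_support (\<lambda>x. c * bilinear_trace (\<phi>'' x))"
      by (rule bounded_supportI[OF compact_imp_bounded[OF K(1)]]) (simp add: bilinear_trace_def K(2))
  qed blast
  have "\<forall>\<^sub>F \<epsilon> in at_right 0. \<forall>x. \<bar>mean_quotient \<epsilon> \<phi> x\<bar> \<le> B + 1"
    using uniform_limitD[OF expansion zero_less_one]
  proof eventually_elim
    case (elim \<epsilon>)
    show ?case
    proof
      fix x
      have "\<bar>mean_quotient \<epsilon> \<phi> x - c * bilinear_trace (\<phi>'' x)\<bar> < 1" using elim
        by (simp add: dist_real_def)
      then show "\<bar>mean_quotient \<epsilon> \<phi> x\<bar> \<le> B + 1" using B[of x] by linarith
    qed
  qed
  then show ?thesis by (rule that)
qed

lemma mean_quotient_eq_0: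
  fixes f :: "'a::euclidean_space \<Rightarrow> real"
  assumes "f \<in> borel_measurable borel" "0 < \<epsilon>" and zero: "\<And>y. dist x y < \<epsilon> \<Longrightarrow> f y = 0"
  shows "mean_quotient \<epsilon> f x = 0"
  using ball_mean_cong[of f "\<lambda>_. 0" \<epsilon> x] assms(1,2) zero zero[of x] by (simp add: mean_quotient_def)

lemma mean_quotient_dominated:
  fixes \<phi> :: "'a::euclidean_space \<Rightarrow> real"
  assumes \<phi>: "test_function D \<phi> \<phi>' \<phi>''"
  obtains w where "integrable lborel w" "\<forall>\<^sub>F \<epsilon> in at_right 0. \<forall>x. \<bar>mean_quotient \<epsilon> \<phi> x\<bar> \<le> w x"
proof -
  have \<phi>_measurable: "\<phi> \<in> borel_measurable borel"
    by (rule borel_measurable_continuous_onI[OF test_function_imp_continuous(1)[OF \<phi>]])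
  obtain R where R: "\<And>x. \<phi> x \<noteq> 0 \<Longrightarrow> norm x \<le> R"
    using test_function_imp_bounded_support(1)[OF \<phi>] by (auto simp: bounded_support_def bounded_iff)
  obtain B where B: "\<forall>\<^sub>F \<epsilon> in at_right 0. \<forall>x. \<bar>mean_quotient \<epsilon> \<phi> x\<bar> \<le> B"
    by (rule mean_quotient_eventually_bounded[OF \<phi>])
  show ?thesis
  proof (rule that[of "\<lambda>x. B * indicator (cball 0 (R + 1)) x"])
    show "integrable lborel (\<lambda>x::'a. B * indicator (cball 0 (R + 1)) x)"
      using emeasure_lborel_cball_finite[of "0::'a" "R + 1"] by (intro integrable_mult_right) auto
    have "\<forall>\<^sub>F \<epsilon> in at_right (0::real). 0 < \<epsilon> \<and> \<epsilon> < 1"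
      using eventually_at_right_real[of 0 "1::real"] by simp
    then show "\<forall>\<^sub>F \<epsilon> in at_right 0. \<forall>x. \<bar>mean_quotient \<epsilon> \<phi> x\<bar> \<le> B * indicator (cball 0 (R + 1)) x"
      using B
    proof eventually_elim
      case (elim \<epsilon>)
      have "mean_quotient \<epsilon> \<phi> x = 0" if "x \<notin> cball 0 (R + 1)" for x
      proof (rule mean_quotient_eq_0[OF \<phi>_measurable])
        fix y assume "dist x y < \<epsilon>"
        moreover have "norm x \<le> norm y + dist x y" using norm_triangle_sub[of x y]
          by (simp add: dist_norm)
        ultimately show "\<phi> y = 0" using R[of y] that elim(1) by force
      qed (use elim(1) in simp)
      then show ?case using elim(2) by (auto simp: indicator_def)
    qed
  qed
qed

subsection \<open>Weakly harmonic functions\<close>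

definition weakly_harmonic_on :: "'a::euclidean_space set \<Rightarrow> ('a \<Rightarrow> real) \<Rightarrow> bool" where
  "weakly_harmonic_on D u \<longleftrightarrow>
     (\<forall>\<phi> \<phi>' \<phi>''. test_function D \<phi> \<phi>' \<phi>'' \<longrightarrow> (\<integral>y. u y * bilinear_trace (\<phi>'' y) \<partial>lborel) = 0)"

lemma integral_dominated_convergence_eventually:
  fixes f :: "'a \<Rightarrow> real"
  assumes s: "\<And>n. s n \<in> borel_measurable M" and w: "integrable M w"
    and bound: "\<forall>\<^sub>F n in sequentially. \<forall>x. \<bar>s n x\<bar> \<le> w x" and lim: "\<And>x. (\<lambda>n. s n x) \<longlonglongrightarrow> f x"
  shows "(\<lambda>n. \<integral>x. s n x \<partial>M) \<longlonglongrightarrow> (\<integral>x. f x \<partial>M)"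
proof -
  obtain N where N: "\<And>n x. N \<le> n \<Longrightarrow> \<bar>s n x\<bar> \<le> w x"
    using bound unfolding eventually_sequentially by blast
  have "(\<lambda>n. \<integral>x. s (n + N) x \<partial>M) \<longlonglongrightarrow> (\<integral>x. f x \<partial>M)"
    using s borel_measurable_LIMSEQ_real[OF lim s] w LIMSEQ_ignore_initial_segment[OF lim] N
    by (intro integral_dominated_convergence[where w=w]) auto
  then show ?thesis by (rule LIMSEQ_offset)
qed

lemma integral_mult_mean_quotient_tendsto:
  fixes u :: "nat \<Rightarrow> 'a::euclidean_space \<Rightarrow> real"
  assumes \<phi>: "test_function D \<phi> \<phi>' \<phi>''"
    and u [measurable]: "\<And>n. u n \<in> borel_measurable borel" and M: "\<And>n y. \<bar>u n y\<bar> \<le> M"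
    and \<epsilon>: "filterlim \<epsilon> (at_right 0) sequentially"
    and lim: "\<And>x. x \<in> D \<Longrightarrow> (\<lambda>n. u n x) \<longlonglongrightarrow> v x"
  obtains c where "c > 0"
    "(\<lambda>n. \<integral>y. u n y * mean_quotient (\<epsilon> n) \<phi> y \<partial>lborel) \<longlonglongrightarrow>
      c * (\<integral>y. v y * bilinear_trace (\<phi>'' y) \<partial>lborel)"
proof -
  have [measurable]: "\<phi> \<in> borel_measurable borel"
    by (rule borel_measurable_continuous_onI[OF test_function_imp_continuous(1)[OF \<phi>]])
  obtain K where K: "K \<subseteq> D" "\<And>x v w. x \<notin> K \<Longrightarrow> \<phi>'' x v w = 0"
    by (rule test_function_support[OF \<phi>]) blast
  obtain w where w: "integrable lborel w" "\<forall>\<^sub>F \<epsilon> in at_right 0. \<forall>x. \<bar>mean_quotient \<epsilon> \<phi> x\<bar> \<le> w x"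
    by (rule mean_quotient_dominated[OF \<phi>])
  obtain c where c_pos: "c > 0" and expansion:
    "uniform_limit UNIV (\<lambda>\<epsilon>. mean_quotient \<epsilon> \<phi>) (\<lambda>x. c * bilinear_trace (\<phi>'' x)) (at_right 0)"
    by (rule mean_quotient_tendsto_laplacian[OF \<phi>])
  define q where "q n = mean_quotient (\<epsilon> n) \<phi>" for n
  have q_lim: "(\<lambda>n. q n y) \<longlonglongrightarrow> c * bilinear_trace (\<phi>'' y)" for y
    using tendsto_uniform_limitI[OF filterlim_compose[OF expansion \<epsilon>]] by (simp add: q_def)
  have tendsto: "(\<lambda>n. u n y * q n y) \<longlonglongrightarrow> v y * (c * bilinear_trace (\<phi>'' y))" for y
  proof (cases "y \<in> K")
    case True
    then show ?thesis using lim[of y] K(1) q_lim by (intro tendsto_mult) auto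
  next
    case False
    then have "(\<lambda>n. M * \<bar>q n y\<bar>) \<longlonglongrightarrow> 0"
      using q_lim[of y]
      by (intro tendsto_mult_right_zero tendsto_rabs_zero) (simp add: K(2) bilinear_trace_def)
    then have "(\<lambda>n. u n y * q n y) \<longlonglongrightarrow> 0"
      by (rule Lim_null_comparison[rotated]) (simp add: abs_mult mult_right_mono M)
    then show ?thesis using False by (simp add: K(2) bilinear_trace_def)
  qed
  have "(\<lambda>n. \<integral>y. u n y * q n y \<partial>lborel) \<longlonglongrightarrow> (\<integral>y. v y * (c * bilinear_trace (\<phi>'' y)) \<partial>lborel)"
  proof (rule integral_dominated_convergence_eventually[where w="\<lambda>y. M * w y", OF _ _ _ tendsto])
    show "(\<lambda>y. u n y * q n y) \<in> borel_measurable lborel" for n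
      unfolding q_def mean_quotient_def by measurable
    show "\<forall>\<^sub>F n in sequentially. \<forall>y. \<bar>u n y * q n y\<bar> \<le> M * w y"
      using eventually_compose_filterlim[OF w(2) \<epsilon>]
    proof eventually_elim
      case (elim n)
      then show ?case
        using M order_trans[OF abs_ge_zero M] by (auto simp: q_def abs_mult intro!: mult_mono)
    qed
  qed (use w(1) in simp)
  then show ?thesis using c_pos by (intro that[of c]) (auto simp: q_def mult.left_commute)
qed

lemma weakly_harmonic_on_limit:
  fixes u :: "nat \<Rightarrow> 'a::euclidean_space \<Rightarrow> real"
  assumes u: "\<And>n. u n \<in> borel_measurable borel" "\<And>n y. \<bar>u n y\<bar> \<le> M"
    and \<epsilon>: "filterlim \<epsilon> (at_right 0) sequentially"
    and mean: "\<And>K. compact K \<Longrightarrow> K \<subseteq> D \<Longrightarrow>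
      \<forall>\<^sub>F n in sequentially. \<forall>x\<in>K. u n x = ball_mean (\<epsilon> n) (u n) x"
    and lim: "\<And>x. x \<in> D \<Longrightarrow> (\<lambda>n. u n x) \<longlonglongrightarrow> v x"
  shows "weakly_harmonic_on D v"
  unfolding weakly_harmonic_on_def
proof (intro allI impI)
  fix \<phi> \<phi>' \<phi>'' assume \<phi>: "test_function D \<phi> \<phi>' \<phi>''"
  note int = bounded_support_imp_integrable
    [OF test_function_imp_continuous(1)[OF \<phi>] test_function_imp_bounded_support(1)[OF \<phi>]]
  obtain K where K: "compact K" "K \<subseteq> D" "\<And>x. x \<notin> K \<Longrightarrow> \<phi> x = 0"
    by (rule test_function_support[OF \<phi>]) blast
  have "\<forall>\<^sub>F n in sequentially. (\<integral>y. u n y * mean_quotient (\<epsilon> n) \<phi> y \<partial>lborel) = 0"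
    using mean[OF K(1,2)]
    by eventually_elim (rule integral_mult_mean_quotient_eq_0[OF u int], use K(3) in blast)
  moreover obtain c where "c > 0" and
    "(\<lambda>n. \<integral>y. u n y * mean_quotient (\<epsilon> n) \<phi> y \<partial>lborel) \<longlonglongrightarrow>
      c * (\<integral>y. v y * bilinear_trace (\<phi>'' y) \<partial>lborel)"
    by (rule integral_mult_mean_quotient_tendsto[OF \<phi> u \<epsilon> lim])
  ultimately show "(\<integral>y. v y * bilinear_trace (\<phi>'' y) \<partial>lborel) = 0"
    by (simp add: tendsto_cong LIMSEQ_const_iff)
qed

lemma weakly_harmonic_on_const: "weakly_harmonic_on D (\<lambda>_. c)"
proof (rule weakly_harmonic_on_limit)
  show "filterlim (\<lambda>n. inverse (real (Suc n))) (at_right 0) sequentially"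
    using LIMSEQ_inverse_real_of_nat by (simp add: filterlim_at)
  show "\<bar>c\<bar> \<le> \<bar>c\<bar>" by simp
  show "(\<lambda>_. c) \<longlonglongrightarrow> c" by (rule tendsto_const)
  show "(\<lambda>_. c) \<in> borel_measurable borel" by simp
  show "\<forall>\<^sub>F n in sequentially. \<forall>x\<in>K. c = ball_mean (inverse (real (Suc n))) (\<lambda>_. c) x" for K
    by simp
qed

subsection \<open>Convolution with smooth kernels\<close>

definition conv :: "('a::euclidean_space \<Rightarrow> real) \<Rightarrow> ('a \<Rightarrow> real) \<Rightarrow> 'a \<Rightarrow> real" where
  "conv g L x = (\<integral>y. g y * L (x - y) \<partial>lborel)"

lemma integrable_conv:
  fixes g L :: "'a::euclidean_space \<Rightarrow> real"
  assumes "integrable lborel g" "continuous_on UNIV L" "bounded_support L"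
  shows "integrable lborel (\<lambda>y. g y * L (x - y))"
proof -
  obtain B where B: "\<And>z. \<bar>L z\<bar> \<le> B" by (rule bounded_support_imp_bounded_range[OF assms(2,3)]) blast
  have [measurable]: "L \<in> borel_measurable borel"
    by (rule borel_measurable_continuous_onI[OF assms(2)])
  show ?thesis by (rule integrable_mult_bounded(1)[OF assms(1) _ B]) measurable
qed

lemma continuous_on_conv:
  fixes g L :: "'a::euclidean_space \<Rightarrow> real"
  assumes g: "integrable lborel g" and L: "continuous_on UNIV L" "bounded_support L"
  shows "continuous_on UNIV (conv g L)"
  unfolding continuous_on_iff
proof (intro ballI allI impI)
  fix x :: 'a and e :: real assume "e > 0"
  have [measurable]: "L \<in> borel_measurable borel" by (rule borel_measurable_continuous_onI[OF L(1)])
  define G where "G = (\<integral>y. \<bar>g y\<bar> \<partial>lborel)"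
  have "G \<ge> 0" by (simp add: G_def)
  then have "e / (G + 1) > 0" using \<open>e > 0\<close> by simp
  then obtain d where d: "d > 0" "\<And>x y. dist y x < d \<Longrightarrow> dist (L y) (L x) < e / (G + 1)"
    using bounded_support_imp_uniformly_continuous[OF L] unfolding uniformly_continuous_on_def
    by (metis UNIV_I)
  have "dist (conv g L x') (conv g L x) < e" if "dist x' x < d" for x'
  proof -
    have "\<bar>L (x' - y) - L (x - y)\<bar> \<le> e / (G + 1)" for y
      using d(2)[of "x' - y" "x - y"] that by (simp add: dist_norm)
    then have "\<bar>\<integral>y. g y * (L (x' - y) - L (x - y)) \<partial>lborel\<bar> \<le> e / (G + 1) * G"
      unfolding G_def by (intro integrable_mult_bounded(2)[OF g]) auto
    also have "\<dots> < e" using \<open>G \<ge> 0\<close> \<open>e > 0\<close> by (simp add: field_simps)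
    finally show ?thesis
      using integrable_conv[OF g L] by (simp add: conv_def dist_real_def right_diff_distrib)
  qed
  then show "\<exists>d>0. \<forall>x'\<in>UNIV. dist x' x < d \<longrightarrow> dist (conv g L x') (conv g L x) < e" using d(1) by blast
qed

lemma has_derivative_conv:
  fixes g :: "'a::euclidean_space \<Rightarrow> real"
  assumes g: "integrable lborel g" and K: "continuous_on UNIV K" "bounded_support K"
    and der: "\<And>z. (K has_derivative K' z) (at z)"
    and K': "\<And>v. continuous_on UNIV (\<lambda>z. K' z v)" "\<And>v. bounded_support (\<lambda>z. K' z v)"
  shows "(conv g K has_derivative (\<lambda>v. conv g (\<lambda>z. K' z v) x)) (at x)"
  unfolding has_derivative_at_alt
proof (intro conjI allI impI)
  have [measurable]: "K \<in> borel_measurable borel" "(\<lambda>z. K' z v) \<in> borel_measurable borel" for v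
    using K(1) K'(1) by (auto intro: borel_measurable_continuous_onI)
  note ints = integrable_conv[OF g K] integrable_conv[OF g K']
  note lin = has_derivative_linear[OF der]
  have "linear (\<lambda>v. conv g (\<lambda>z. K' z v) x)"
    unfolding conv_def
    by (rule linearI)
       (simp_all add: linear_add[OF lin] linear_scale[OF lin] distrib_left ints mult.left_commute)
  then show "bounded_linear (\<lambda>v. conv g (\<lambda>z. K' z v) x)" by (simp add: linear_conv_bounded_linear)
  fix e :: real assume "e > 0"
  define G where "G = (\<integral>y. \<bar>g y\<bar> \<partial>lborel)"
  have "G \<ge> 0" by (simp add: G_def)
  then have "e / (G + 1) > 0" using \<open>e > 0\<close> by simp
  then obtain d where d: "d > 0" "\<And>z h. norm h < d \<Longrightarrow>
      \<bar>K (z + h) - K z - K' z h\<bar> \<le> e / (G + 1) * norm h"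
    using uniform_linearization[OF der bounded_support_imp_uniformly_continuous[OF K']] by blast
  have "norm (conv g K x' - conv g K x - conv g (\<lambda>z. K' z (x' - x)) x) \<le> e * norm (x' - x)"
    if "norm (x' - x) < d" for x'
  proof -
    have "\<bar>K (x' - y) - K (x - y) - K' (x - y) (x' - x)\<bar> \<le> e / (G + 1) * norm (x' - x)" for y
      using d(2)[OF that, of "x - y"] by simp
    then have "\<bar>\<integral>y. g y * (K (x' - y) - K (x - y) - K' (x - y) (x' - x)) \<partial>lborel\<bar>
        \<le> e / (G + 1) * norm (x' - x) * G"
      unfolding G_def by (intro integrable_mult_bounded(2)[OF g]) auto
    also have "\<dots> \<le> e * norm (x' - x)"
      using \<open>G \<ge> 0\<close> \<open>e > 0\<close> mult_right_mono[of G "G + 1" "e * norm (x' - x)"]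
      by (simp add: field_simps)
    finally show ?thesis by (simp add: conv_def right_diff_distrib ints)
  qed
  then show "\<exists>d>0. \<forall>x'. norm (x' - x) < d \<longrightarrow>
      norm (conv g K x' - conv g K x - conv g (\<lambda>z. K' z (x' - x)) x) \<le> e * norm (x' - x)"
    using d(1) by blast
qed

lemma C2_on_conv:
  assumes g: "integrable lborel g" and K: "test_function D K K' K''"
  shows "C2_on UNIV (conv g K) (\<lambda>x v. conv g (\<lambda>z. K' z v) x) (\<lambda>x v w. conv g (\<lambda>z. K'' z v w) x)"
proof -
  note cont = test_function_imp_continuous[OF K] and supp = test_function_imp_bounded_support[OF K]
  have C2: "C2_on UNIV K K' K''" using K by (simp add: test_function_def)
  show ?thesis
    unfolding C2_on_def
    using has_derivative_conv[OF g cont(1) supp(1) C2_onD(1)[OF C2 UNIV_I] cont(2) supp(2)]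
      has_derivative_conv[OF g cont(2) supp(2) C2_onD(2)[OF C2 UNIV_I] cont(3) supp(3)]
      continuous_on_conv[OF g cont(3) supp(3)]
    by simp
qed

lemma bilinear_trace_conv:
  assumes g: "integrable lborel g" and K: "test_function D K K' K''"
  shows "bilinear_trace (\<lambda>v w. conv g (\<lambda>z. K'' z v w) x)
      = (\<integral>y. g y * bilinear_trace (K'' (x - y)) \<partial>lborel)"
  using integrable_conv[OF g test_function_imp_continuous(3)[OF K]
      test_function_imp_bounded_support(3)[OF K]]
  by (simp add: bilinear_trace_def conv_def sum_distrib_left)

lemma C2_on_reflect:
  fixes x :: "'a::real_normed_vector"
  assumes "C2_on UNIV f f' f''"
  shows "C2_on UNIV (\<lambda>y. f (x - y)) (\<lambda>y v. f' (x - y) (- v)) (\<lambda>y v w. f'' (x - y) (- v) (- w))"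
proof -
  have reflect: "((\<lambda>y. x - y) has_derivative uminus) (at y)" for y
    by (auto intro!: derivative_eq_intros)
  have "continuous_on UNIV (\<lambda>y. f'' (x - y) v w)" for v w
    using continuous_on_compose2[OF C2_onD(3)[OF assms], of UNIV "\<lambda>y. x - y"]
    by (simp add: continuous_intros)
  then show ?thesis
    unfolding C2_on_def
    using has_derivative_compose[OF reflect C2_onD(1)[OF assms UNIV_I]]
      has_derivative_compose[OF reflect C2_onD(2)[OF assms UNIV_I]]
    by auto
qed

subsection \<open>The polynomial kernels\<close>

lemma DERIV_pos_part_power:
  assumes "k \<ge> 2"
  shows "((\<lambda>t::real. (max 0 t) ^ k) has_real_derivative real k * (max 0 t) ^ (k - 1)) (at t)"
proof -
  consider "t > 0" | "t < 0" | "t = 0" by linarith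
  then show ?thesis
  proof cases
    assume "t > 0"
    have "((\<lambda>t. t ^ k) has_real_derivative real k * t ^ (k - 1)) (at t)"
      by (auto intro!: derivative_eq_intros)
    then have "((\<lambda>t. (max 0 t) ^ k) has_real_derivative real k * t ^ (k - 1)) (at t)"
      by (rule has_field_derivative_transform_within_open[of _ _ _ "{0<..}"]) (use \<open>t > 0\<close> in auto)
    then show ?thesis using \<open>t > 0\<close> by simp
  next
    assume "t < 0"
    have "((\<lambda>t. 0) has_real_derivative 0) (at t)" by simp
    then have "((\<lambda>t. (max 0 t) ^ k) has_real_derivative 0) (at t)"
      by (rule has_field_derivative_transform_within_open[of _ _ _ "{..<0}"])
         (use \<open>t < 0\<close> assms in auto)
    then show ?thesis using \<open>t < 0\<close> assms by (simp add: zero_power)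
  next
    assume "t = 0"
    have "((\<lambda>h::real. (max 0 h) ^ k / h) \<longlongrightarrow> 0) (at 0)"
    proof (rule Lim_null_comparison)
      show "\<forall>\<^sub>F h in at 0. norm ((max 0 h) ^ k / h) \<le> \<bar>h :: real\<bar> ^ (k - 1)"
        using assms
        by (intro always_eventually)
           (auto simp: max_def power_abs power_diff abs_divide divide_simps zero_power)
      show "((\<lambda>h::real. \<bar>h\<bar> ^ (k - 1)) \<longlongrightarrow> 0) (at 0)"
        using assms by (auto intro!: tendsto_eq_intros simp: zero_power)
    qed
    then show ?thesis using \<open>t = 0\<close> assms by (simp add: DERIV_def zero_power)
  qed
qed

definition bump :: "nat \<Rightarrow> real \<Rightarrow> 'a::euclidean_space \<Rightarrow> real" where
  "bump k s z = (max 0 (s\<^sup>2 - z \<bullet> z)) ^ k"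

definition bump_deriv :: "nat \<Rightarrow> real \<Rightarrow> 'a::euclidean_space \<Rightarrow> 'a \<Rightarrow> real" where
  "bump_deriv k s z v = - 2 * real k * (z \<bullet> v) * bump (k - 1) s z"

definition bump_deriv2 :: "nat \<Rightarrow> real \<Rightarrow> 'a::euclidean_space \<Rightarrow> 'a \<Rightarrow> 'a \<Rightarrow> real" where
  "bump_deriv2 k s z v w = - 2 * real k * ((w \<bullet> v) * bump (k - 1) s z
      + (z \<bullet> v) * bump_deriv (k - 1) s z w)"

lemma bump_nonneg [simp]: "bump k s z \<ge> 0"
  by (simp add: bump_def)

lemma bump_minus_commute: "bump k s (x - y) = bump k s (y - x)"
  by (simp add: bump_def inner_diff_left inner_diff_right inner_commute ac_simps)

lemma bump_eq_0: "0 \<le> s \<Longrightarrow> s \<le> norm z \<Longrightarrow> 0 < k \<Longrightarrow> bump k s z = 0"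
  by (simp add: bump_def dot_square_norm power_mono)

lemma continuous_on_bump [continuous_intros]:
  "continuous_on A f \<Longrightarrow> continuous_on A (\<lambda>x. bump k s (f x))"
  unfolding bump_def by (intro continuous_intros)

lemma borel_measurable_bump [measurable]: "bump k s \<in> borel_measurable borel"
  by (intro borel_measurable_continuous_onI continuous_intros)

lemma has_derivative_bump:
  assumes "k \<ge> 2"
  shows "(bump k s has_derivative bump_deriv k s z) (at z)"
proof -
  have "((\<lambda>z. s\<^sup>2 - z \<bullet> z) has_derivative (\<lambda>v. - (2 * (z \<bullet> v)))) (at z)"
    by (auto intro!: derivative_eq_intros simp: inner_commute)
  from has_derivative_compose
      [OF this DERIV_pos_part_power[OF assms, THEN has_field_derivative_imp_has_derivative]]
  show ?thesis unfolding bump_def[abs_def] bump_deriv_def[abs_def] by (simp add: ac_simps)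
qed

lemma C2_on_bump:
  assumes "k \<ge> 3"
  shows "C2_on UNIV (bump k s) (bump_deriv k s) (bump_deriv2 k s)"
  unfolding C2_on_def
proof (intro conjI ballI allI)
  show "(bump k s has_derivative bump_deriv k s x) (at x)" for x
    using assms by (intro has_derivative_bump) simp
  show "((\<lambda>y. bump_deriv k s y v) has_derivative bump_deriv2 k s x v) (at x)" for x v
    using assms unfolding bump_deriv_def[of k] bump_deriv2_def
    by (auto intro!: derivative_eq_intros has_derivative_bump simp: algebra_simps)
  show "continuous_on UNIV (\<lambda>y. bump_deriv2 k s y v w)" for v w
    unfolding bump_deriv2_def bump_deriv_def by (intro continuous_intros)
qed

lemma test_function_bump:
  assumes "k \<ge> 3" "0 \<le> s"
  shows "test_function UNIV (bump k s) (bump_deriv k s) (bump_deriv2 k s)"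
  unfolding test_function_def using assms
  by (auto intro!: C2_on_bump exI[of _ "cball 0 s"] bump_eq_0)

lemma test_function_bump_reflect:
  assumes "k \<ge> 3" "0 \<le> s" "cball x s \<subseteq> D"
  shows "test_function D (\<lambda>y. bump k s (x - y)) (\<lambda>y v. bump_deriv k s (x - y) (- v))
    (\<lambda>y v w. bump_deriv2 k s (x - y) (- v) (- w))"
  unfolding test_function_def using assms
  by (auto intro!: C2_on_reflect[OF C2_on_bump] exI[of _ "cball x s"] bump_eq_0 simp: dist_norm)

lemma bilinear_trace_bump_deriv2:
  assumes "j \<ge> 1"
  shows "bilinear_trace (bump_deriv2 (j + 2) s (z :: 'a::euclidean_space))
    = 2 * real (j + 2)
      * (2 * real (j + 1) * s\<^sup>2 * bump j s z - (DIM('a) + 2 * real (j + 1)) * bump (Suc j) s z)"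
proof -
  have inner_self_mult_bump: "(z \<bullet> z) * bump j s z = s\<^sup>2 * bump j s z - bump (Suc j) s z"
    using assms by (cases "z \<bullet> z \<le> s\<^sup>2") (auto simp: bump_def max_def algebra_simps)
  have "bump_deriv2 (j + 2) s z i i
      = - 2 * real (j + 2) * (bump (Suc j) s z - 2 * real (j + 1) * bump j s z * ((z \<bullet> i) * (z \<bullet> i)))"
    if "i \<in> Basis" for i
    using that by (simp add: bump_deriv2_def bump_deriv_def algebra_simps)
  then have "bilinear_trace (bump_deriv2 (j + 2) s z)
      = - 2 * real (j + 2) * (DIM('a) * bump (Suc j) s z - 2 * real (j + 1) * bump j s z * (z \<bullet> z))"
    by (simp add: bilinear_trace_def sum_subtractf euclidean_inner[of z z] flip: sum_distrib_left)
  also have "\<dots> = - 2 * real (j + 2) * (DIM('a) * bump (Suc j) s z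
      - 2 * real (j + 1) * ((z \<bullet> z) * bump j s z))"
    by (simp only: ac_simps)
  finally show ?thesis unfolding inner_self_mult_bump by (simp add: algebra_simps)
qed

subsection \<open>Weyl's lemma\<close>

lemma conv_one_bump: "conv (\<lambda>_. 1) (bump k s) x = (\<integral>z. bump k s (z :: 'a) \<partial>lborel)"
  for x :: "'a::euclidean_space"
  using lborel_integral_translate[of "bump k s", where c="- x"]
  by (simp add: conv_def bump_minus_commute[of _ _ x])

lemma integrable_mult_bump:
  fixes u :: "'a::euclidean_space \<Rightarrow> real"
  assumes u: "set_integrable lborel (cball x s) u" and "0 \<le> s" "0 < k"
  shows "integrable lborel (\<lambda>y. u y * bump k s (x - y))"
proof -
  have "\<bar>bump k s (x - y)\<bar> \<le> (s\<^sup>2) ^ k" for y :: 'a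
    by (auto simp: bump_def power_abs intro!: power_mono)
  then have "integrable lborel (\<lambda>y. (indicator (cball x s) y *\<^sub>R u y) * bump k s (x - y))"
    using u unfolding set_integrable_def by (intro integrable_mult_bounded(1)) auto
  moreover have "bump k s (x - y) = 0" if "y \<notin> cball x s" for y
    using that assms(2,3) by (intro bump_eq_0) (auto simp: dist_norm)
  then have "(\<lambda>y. (indicator (cball x s) y *\<^sub>R u y) * bump k s (x - y))
      = (\<lambda>y. u y * bump k s (x - y))"
    by (auto simp: fun_eq_iff indicator_def)
  ultimately show ?thesis by simp
qed

lemma set_integrable_cball_const: "set_integrable lborel (cball x s) (\<lambda>_. c :: real)"
  for x :: "'a::euclidean_space"
  unfolding set_integrable_def using emeasure_lborel_cball_finite[of x s] by auto

lemma conv_one_bump_ge: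
  fixes x :: "'a::euclidean_space"
  assumes "0 \<le> r" "r \<le> s" "0 < k"
  shows "(s\<^sup>2 - r\<^sup>2) ^ k * measure lborel (cball x r) \<le> conv (\<lambda>_. 1) (bump k s) x"
proof -
  have "(\<integral>y. (s\<^sup>2 - r\<^sup>2) ^ k * indicator (cball x r) y \<partial>lborel) \<le> (\<integral>y. 1 * bump k s (x - y) \<partial>lborel)"
  proof (rule integral_mono)
    show "integrable lborel (\<lambda>y. (s\<^sup>2 - r\<^sup>2) ^ k * indicator (cball x r) y)"
      using emeasure_lborel_cball_finite[of x r] by (intro integrable_mult_right) auto
    show "integrable lborel (\<lambda>y. 1 * bump k s (x - y))"
      using assms by (intro integrable_mult_bump set_integrable_cball_const) auto
    show "(s\<^sup>2 - r\<^sup>2) ^ k * indicator (cball x r) y \<le> 1 * bump k s (x - y)" for y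
    proof (cases "y \<in> cball x r")
      case True
      then have "(norm (x - y))\<^sup>2 \<le> r\<^sup>2" "r\<^sup>2 \<le> s\<^sup>2" using assms
        by (auto simp: dist_norm intro!: power_mono)
      then show ?thesis using True by (auto simp: bump_def dot_square_norm intro!: power_mono)
    qed simp
  qed
  then show ?thesis by (simp add: conv_def)
qed

lemma conv_one_bump_pos:
  assumes "0 < s" "0 < k"
  shows "0 < conv (\<lambda>_. 1) (bump k s) (x :: 'a::euclidean_space)"
proof -
  have "0 < (s\<^sup>2 - (s / 2)\<^sup>2) ^ k * measure lborel (cball x (s / 2))"
    using assms
    by (intro mult_pos_pos zero_less_power) (auto simp: power2_eq_square content_cball_pos)
  then show ?thesis using conv_one_bump_ge[of "s / 2" s k x] assms by simp
qed

lemma weakly_harmonic_integral_bump: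
  assumes "weakly_harmonic_on D u" "cball x s \<subseteq> D" "0 \<le> s" "3 \<le> k"
  shows "(\<integral>y. u y * bilinear_trace (bump_deriv2 k s (x - y)) \<partial>lborel) = 0"
proof -
  have "bilinear_trace (\<lambda>v w. bump_deriv2 k s z (- v) (- w)) = bilinear_trace (bump_deriv2 k s z)"
    for z :: 'a
    by (simp add: bilinear_trace_def bump_deriv2_def bump_deriv_def)
  then show ?thesis
    using assms(1)[unfolded weakly_harmonic_on_def, rule_format,
      OF test_function_bump_reflect[OF assms(4,3,2)]]
    by simp
qed

lemma weakly_harmonic_conv_bump_Suc:
  fixes u :: "'a::euclidean_space \<Rightarrow> real"
  assumes u: "set_integrable lborel (cball x s) u" and harm: "weakly_harmonic_on D u"
    and "cball x s \<subseteq> D" "0 \<le> s" "j \<ge> 1"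
  shows "2 * real (j + 1) * s\<^sup>2 * conv u (bump j s) x
      = (DIM('a) + 2 * real (j + 1)) * conv u (bump (Suc j) s) x"
proof -
  let ?a = "2 * real (j + 1) * s\<^sup>2" and ?b = "DIM('a) + 2 * real (j + 1)"
  have "0 = (\<integral>y. u y * bilinear_trace (bump_deriv2 (j + 2) s (x - y)) \<partial>lborel)"
    using assms by (intro weakly_harmonic_integral_bump[symmetric]) auto
  also have "\<dots> = (\<integral>y. 2 * real (j + 2) * (?a * (u y * bump j s (x - y))
      - ?b * (u y * bump (Suc j) s (x - y))) \<partial>lborel)"
    using \<open>j \<ge> 1\<close>
    by (intro Bochner_Integration.integral_cong refl)
       (simp only: bilinear_trace_bump_deriv2 algebra_simps)
  also have "\<dots> = 2 * real (j + 2) * (?a * conv u (bump j s) x - ?b * conv u (bump (Suc j) s) x)"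
    unfolding conv_def using integrable_mult_bump[OF u] assms(4,5) by simp
  finally show ?thesis by simp
qed

lemma weakly_harmonic_conv_bump_ratio:
  fixes u :: "'a::euclidean_space \<Rightarrow> real"
  assumes u: "set_integrable lborel (cball x s) u" "weakly_harmonic_on D u"
    and "cball x s \<subseteq> D" "0 < s" "1 \<le> k" "k \<le> j"
  shows "conv u (bump j s) x / conv (\<lambda>_. 1) (bump j s) x
    = conv u (bump k s) x / conv (\<lambda>_. 1) (bump k s) x"
  using \<open>k \<le> j\<close>
proof (induction j rule: dec_induct)
  case (step j)
  define \<kappa> where "\<kappa> = 2 * real (j + 1) * s\<^sup>2 / (DIM('a) + 2 * real (j + 1))"
  have "\<kappa> > 0" using \<open>0 < s\<close> by (simp add: \<kappa>_def add_nonneg_pos)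
  have "conv f (bump (Suc j) s) x = \<kappa> * conv f (bump j s) x"
    if "set_integrable lborel (cball x s) f" "weakly_harmonic_on D f" for f
    using weakly_harmonic_conv_bump_Suc[OF that assms(3), of j] assms(4,5) step(1)
      add_nonneg_pos[of "DIM('a)" "2 * real (j + 1)"]
    by (simp add: \<kappa>_def field_simps)
  from this[OF u] this[OF set_integrable_cball_const weakly_harmonic_on_const] show ?case
    using \<open>\<kappa> > 0\<close> step(3) by simp
qed simp

lemma conv_bump_diff_le:
  fixes u :: "'a::euclidean_space \<Rightarrow> real"
  assumes u: "set_integrable lborel (cball x s) u" and r: "0 \<le> r" "r \<le> s" and "0 < k" "0 \<le> e"
    and close: "\<And>y. norm (x - y) < r \<Longrightarrow> \<bar>u y - a\<bar> \<le> e"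
  shows "\<bar>conv u (bump k s) x - a * conv (\<lambda>_. 1) (bump k s) x\<bar>
    \<le> e * conv (\<lambda>_. 1) (bump k s) x + (s\<^sup>2 - r\<^sup>2) ^ k * (LINT y:cball x s|lborel. \<bar>u y - a\<bar>)"
proof -
  let ?G = "\<lambda>y. indicator (cball x s) y *\<^sub>R \<bar>u y - a\<bar>"
  have "0 \<le> s" and power_diff_nonneg: "0 \<le> s\<^sup>2 - r\<^sup>2" using r by (auto simp: power_mono)
  note ints = integrable_mult_bump[OF u \<open>0 \<le> s\<close> \<open>0 < k\<close>]
    integrable_mult_bump[OF set_integrable_cball_const[of x s 1] \<open>0 \<le> s\<close> \<open>0 < k\<close>]
  have int_G: "integrable lborel ?G"
    using set_integrable_abs[OF set_integral_diff(1)[OF u set_integrable_cball_const]]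
    by (simp add: set_integrable_def)
  have bound: "\<bar>(u y - a) * bump k s (x - y)\<bar> \<le> e * bump k s (x - y) + (s\<^sup>2 - r\<^sup>2) ^ k * ?G y" for y
  proof (cases "norm (x - y) < r \<or> s < norm (x - y)")
    case True
    then have "\<bar>(u y - a) * bump k s (x - y)\<bar> \<le> e * bump k s (x - y)"
      using close[of y] bump_eq_0[of s "x - y" k] \<open>0 \<le> s\<close> \<open>0 < k\<close>
      by (auto simp: abs_mult mult_right_mono)
    moreover have "0 \<le> (s\<^sup>2 - r\<^sup>2) ^ k * ?G y" using power_diff_nonneg by simp
    ultimately show ?thesis by linarith
  next
    case False
    then have "r\<^sup>2 \<le> (norm (x - y))\<^sup>2" using r(1) by (auto intro: power_mono)
    then have "bump k s (x - y) \<le> (s\<^sup>2 - r\<^sup>2) ^ k"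
      using power_diff_nonneg unfolding bump_def by (intro power_mono) (auto simp: dot_square_norm)
    then have "\<bar>(u y - a) * bump k s (x - y)\<bar> \<le> (s\<^sup>2 - r\<^sup>2) ^ k * ?G y"
      using False by (simp add: abs_mult dist_norm mult_left_mono mult.commute[of "(_ - _) ^ k"])
    moreover have "0 \<le> e * bump k s (x - y)" using \<open>0 \<le> e\<close> by simp
    ultimately show ?thesis by linarith
  qed
  have "conv u (bump k s) x - a * conv (\<lambda>_. 1) (bump k s) x
      = (\<integral>y. (u y - a) * bump k s (x - y) \<partial>lborel)"
    unfolding conv_def using ints by (simp add: left_diff_distrib)
  also have "\<bar>\<dots>\<bar> \<le> (\<integral>y. \<bar>(u y - a) * bump k s (x - y)\<bar> \<partial>lborel)" by (rule integral_abs_bound)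
  also have "\<dots> \<le> (\<integral>y. e * bump k s (x - y) + (s\<^sup>2 - r\<^sup>2) ^ k * ?G y \<partial>lborel)"
    using ints int_G bound by (intro integral_mono) (auto simp: left_diff_distrib)
  also have "\<dots> = e * conv (\<lambda>_. 1) (bump k s) x
      + (s\<^sup>2 - r\<^sup>2) ^ k * (LINT y:cball x s|lborel. \<bar>u y - a\<bar>)"
    using ints int_G by (simp add: conv_def set_lebesgue_integral_def)
  finally show ?thesis .
qed

lemma conv_bump_average_diff_le:
  fixes u :: "'a::euclidean_space \<Rightarrow> real"
  assumes u: "set_integrable lborel (cball x s) u" and r: "0 < r" "r \<le> s" and "0 < k" "0 \<le> e"
    and close: "\<And>y. norm (x - y) < r \<Longrightarrow> \<bar>u y - a\<bar> \<le> e"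
  shows "\<bar>conv u (bump k s) x / conv (\<lambda>_. 1) (bump k s) x - a\<bar>
    \<le> e + (LINT y:cball x s|lborel. \<bar>u y - a\<bar>) / measure lborel (cball x (r / 2))
        * ((s\<^sup>2 - r\<^sup>2) / (s\<^sup>2 - (r / 2)\<^sup>2)) ^ k"
proof -
  define m where "m = conv (\<lambda>_. 1) (bump k s) x"
  define G where "G = (LINT y:cball x s|lborel. \<bar>u y - a\<bar>)"
  define V where "V = measure lborel (cball x (r / 2))"
  define \<rho> where "\<rho> = (s\<^sup>2 - r\<^sup>2) / (s\<^sup>2 - (r / 2)\<^sup>2)"
  have "V > 0" using r by (simp add: V_def content_cball_pos)
  have "r\<^sup>2 \<le> s\<^sup>2" "(r / 2)\<^sup>2 < r\<^sup>2" using r by (auto simp: power_divide intro: power_mono)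
  then have "0 \<le> \<rho>" and pos: "0 < s\<^sup>2 - (r / 2)\<^sup>2" by (auto simp: \<rho>_def)
  have "G \<ge> 0" unfolding G_def set_lebesgue_integral_def by simp
  have m: "(s\<^sup>2 - (r / 2)\<^sup>2) ^ k * V \<le> m"
    unfolding V_def m_def using r \<open>0 < k\<close> by (intro conv_one_bump_ge) auto
  moreover have "0 < (s\<^sup>2 - (r / 2)\<^sup>2) ^ k * V" using pos \<open>V > 0\<close> by simp
  ultimately have "m > 0" by linarith
  have "\<bar>conv u (bump k s) x - a * m\<bar> \<le> e * m + (s\<^sup>2 - r\<^sup>2) ^ k * G"
    unfolding m_def G_def
    by (rule conv_bump_diff_le[OF u _ r(2) \<open>0 < k\<close> \<open>0 \<le> e\<close> close]) (use r(1) in simp)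
  also have "(s\<^sup>2 - r\<^sup>2) ^ k * G = G / V * \<rho> ^ k * ((s\<^sup>2 - (r / 2)\<^sup>2) ^ k * V)"
    using pos \<open>V > 0\<close> by (simp add: \<rho>_def power_divide)
  also have "\<dots> \<le> G / V * \<rho> ^ k * m"
    using m \<open>G \<ge> 0\<close> \<open>V > 0\<close> \<open>0 \<le> \<rho>\<close> by (intro mult_left_mono) auto
  finally have "\<bar>conv u (bump k s) x - a * m\<bar> \<le> (e + G / V * \<rho> ^ k) * m"
    by (simp add: distrib_right)
  moreover have "conv u (bump k s) x / m - a = (conv u (bump k s) x - a * m) / m"
    using \<open>m > 0\<close> by (simp add: field_simps)
  ultimately have "\<bar>conv u (bump k s) x / m - a\<bar> \<le> e + G / V * \<rho> ^ k"
    using \<open>m > 0\<close> by (simp add: divide_le_eq)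
  then show ?thesis by (simp add: m_def G_def V_def \<rho>_def)
qed

lemma bump_approximate_identity:
  fixes u :: "'a::euclidean_space \<Rightarrow> real"
  assumes u: "set_integrable lborel (cball x s) u" and cont: "isCont u x" and s: "0 < s"
  shows "(\<lambda>k. conv u (bump k s) x / conv (\<lambda>_. 1) (bump k s) x) \<longlonglongrightarrow> u x"
proof (rule LIMSEQ_I)
  fix e :: real assume "e > 0"
  then have "e / 2 > 0" by simp
  then obtain d where d: "d > 0" "\<And>y. dist y x < d \<Longrightarrow> dist (u y) (u x) < e / 2"
    using cont unfolding continuous_at_eps_delta by metis
  define r where "r = min d s"
  have r: "0 < r" "r \<le> s" "r \<le> d" using d(1) s by (auto simp: r_def)
  have close: "\<bar>u y - u x\<bar> \<le> e / 2" if "norm (x - y) < r" for y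
    using d(2)[of y] that r(3) by (simp add: dist_norm norm_minus_commute)
  define C where "C = (LINT y:cball x s|lborel. \<bar>u y - u x\<bar>) / measure lborel (cball x (r / 2))"
  define \<rho> where "\<rho> = (s\<^sup>2 - r\<^sup>2) / (s\<^sup>2 - (r / 2)\<^sup>2)"
  have "r\<^sup>2 \<le> s\<^sup>2" "(r / 2)\<^sup>2 < r\<^sup>2" using r by (auto simp: power_divide intro: power_mono)
  then have "0 \<le> \<rho>" "\<rho> < 1" by (auto simp: \<rho>_def)
  then have "(\<lambda>k. C * \<rho> ^ k) \<longlonglongrightarrow> 0"
    by (intro tendsto_mult_right_zero LIMSEQ_realpow_zero)
  then have "\<forall>\<^sub>F k in sequentially. C * \<rho> ^ k < e / 2" using \<open>e / 2 > 0\<close> by (rule order_tendstoD(2))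
  then have "\<forall>\<^sub>F k in sequentially. \<bar>conv u (bump k s) x / conv (\<lambda>_. 1) (bump k s) x - u x\<bar> < e"
    using eventually_gt_at_top[of "0 :: nat"]
  proof eventually_elim
    case (elim k)
    have "\<bar>conv u (bump k s) x / conv (\<lambda>_. 1) (bump k s) x - u x\<bar> \<le> e / 2 + C * \<rho> ^ k"
      unfolding C_def \<rho>_def
      by (rule conv_bump_average_diff_le[OF u r(1,2) elim(2) _ close]) (use \<open>e / 2 > 0\<close> in auto)
    then show ?case using elim(1) by linarith
  qed
  then show "\<exists>N. \<forall>k\<ge>N. norm (conv u (bump k s) x / conv (\<lambda>_. 1) (bump k s) x - u x) < e"
    unfolding eventually_sequentially real_norm_def .
qed

text \<open>The ratio of \<open>conv u (bump k s) x\<close> to the mass of the kernel does not depend on \<open>k\<close>, and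
  the kernels concentrate at the origin as \<open>k\<close> grows.\<close>

lemma weakly_harmonic_mean_value:
  fixes u :: "'a::euclidean_space \<Rightarrow> real"
  assumes u: "set_integrable lborel (cball x s) u" "weakly_harmonic_on D u"
    and D: "cball x s \<subseteq> D" "0 < s" and cont: "isCont u x" and "1 \<le> k"
  shows "conv u (bump k s) x = u x * conv (\<lambda>_. 1) (bump k s) x"
proof -
  let ?c = "conv u (bump k s) x / conv (\<lambda>_. 1) (bump k s) x"
  have "\<forall>\<^sub>F j in sequentially. conv u (bump j s) x / conv (\<lambda>_. 1) (bump j s) x = ?c"
    using eventually_ge_at_top[of k]
    by eventually_elim (rule weakly_harmonic_conv_bump_ratio[OF u D \<open>1 \<le> k\<close>])
  then have "?c = u x"
    using bump_approximate_identity[OF u(1) cont D(2)] by (simp add: tendsto_cong LIMSEQ_const_iff)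
  then show ?thesis using conv_one_bump_pos[OF D(2), of k x] \<open>1 \<le> k\<close> by (simp add: field_simps)
qed

lemma weakly_harmonic_on_subset: "weakly_harmonic_on D u \<Longrightarrow> S \<subseteq> D \<Longrightarrow> weakly_harmonic_on S u"
  unfolding weakly_harmonic_on_def test_function_def by (meson order_trans)

lemma weakly_harmonic_on_cong:
  assumes "\<And>x. x \<in> D \<Longrightarrow> u x = v x" "weakly_harmonic_on D u"
  shows "weakly_harmonic_on D v"
  unfolding weakly_harmonic_on_def
proof (intro allI impI)
  fix \<phi> \<phi>' \<phi>'' assume \<phi>: "test_function D \<phi> \<phi>' \<phi>''"
  obtain K where "K \<subseteq> D" and K: "\<And>x v w. x \<notin> K \<Longrightarrow> \<phi>'' x v w = 0"
    by (rule test_function_support[OF \<phi>]) blast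
  have integrand_eq: "u y * bilinear_trace (\<phi>'' y) = v y * bilinear_trace (\<phi>'' y)" for y
    using assms(1)[of y] \<open>K \<subseteq> D\<close> K[of y] by (cases "y \<in> K") (auto simp: bilinear_trace_def)
  have "(\<integral>y. u y * bilinear_trace (\<phi>'' y) \<partial>lborel) = 0"
    using assms(2) \<phi> by (simp add: weakly_harmonic_on_def)
  then show "(\<integral>y. v y * bilinear_trace (\<phi>'' y) \<partial>lborel) = 0" by (simp only: integrand_eq)
qed

lemma C2_on_cong_open:
  assumes "C2_on D f f' f''" "open D" "\<And>x. x \<in> D \<Longrightarrow> f x = g x"
  shows "C2_on D g f' f''"
  using assms unfolding C2_on_def by (auto intro: has_derivative_transform_within_open[where s=D])

lemma harmonic_on_cong_open:
  "harmonic_on D u \<Longrightarrow> open D \<Longrightarrow> (\<And>x. x \<in> D \<Longrightarrow> u x = v x) \<Longrightarrow> harmonic_on D v"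
  unfolding harmonic_on_iff_C2_on by (blast intro: C2_on_cong_open)

lemma harmonic_on_local:
  assumes "\<And>x. x \<in> D \<Longrightarrow> \<exists>S. open S \<and> x \<in> S \<and> harmonic_on S u"
  shows "harmonic_on D u"
proof -
  define u' where "u' x = frechet_derivative u (at x)" for x
  define u'' where "u'' x v = frechet_derivative (\<lambda>y. u' y v) (at x)" for x v
  have local: "(u has_derivative u' x) (at x) \<and> (\<forall>v. ((\<lambda>y. u' y v) has_derivative u'' x v) (at x)) \<and>
      (\<forall>v w. isCont (\<lambda>y. u'' y v w) x) \<and> bilinear_trace (u'' x) = 0" if x: "x \<in> D" for x
  proof -
    obtain S f' f'' where S: "open S" "x \<in> S" and u: "C2_on S u f' f''"
      and trace: "bilinear_trace (f'' x) = 0"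
      using assms[OF x] unfolding harmonic_on_iff_C2_on by blast
    have u': "u' y = f' y" if "y \<in> S" for y
      unfolding u'_def using frechet_derivative_at[OF C2_onD(1)[OF u that]] by simp
    have deriv2: "((\<lambda>y. u' y v) has_derivative f'' y v) (at y)" if "y \<in> S" for y v
      by (rule has_derivative_transform_within_open[OF C2_onD(2)[OF u that] S(1) that]) (simp add: u')
    have u'': "u'' y v = f'' y v" if "y \<in> S" for y v
      unfolding u''_def using frechet_derivative_at[OF deriv2[OF that]] by simp
    have "continuous_on S (\<lambda>y. u'' y v w)" for v w
      using C2_onD(3)[OF u] by (rule continuous_on_eq) (simp add: u'')
    then have "isCont (\<lambda>y. u'' y v w) x" for v w
      using S by (simp add: continuous_on_eq_continuous_at)
    moreover have "u'' x = f'' x" using u''[OF S(2)] by (simp add: fun_eq_iff)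
    ultimately show ?thesis using C2_onD(1)[OF u S(2)] deriv2[OF S(2)] u'[OF S(2)] trace by simp
  qed
  then have "C2_on D u u' u''" unfolding C2_on_def by (auto intro!: continuous_at_imp_continuous_on)
  then show ?thesis using local unfolding harmonic_on_iff_C2_on by blast
qed

text \<open>The mean value formula exhibits \<open>u\<close> locally as a convolution with a \<open>C\<^sup>2\<close> kernel.\<close>

lemma integrable_weakly_harmonic_imp_harmonic_on_ball:
  fixes u :: "'a::euclidean_space \<Rightarrow> real"
  assumes u: "integrable lborel u" and harm: "weakly_harmonic_on (ball a (2 * s)) u"
    and cont: "continuous_on (ball a (2 * s)) u" and s: "0 < s"
  shows "harmonic_on (ball a s) u"
proof -
  let ?K = "bump 3 s :: 'a \<Rightarrow> real" and ?K' = "bump_deriv 3 s :: 'a \<Rightarrow> 'a \<Rightarrow> real"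
    and ?K'' = "bump_deriv2 3 s :: 'a \<Rightarrow> 'a \<Rightarrow> 'a \<Rightarrow> real"
  define T where "T = (\<integral>z. ?K z \<partial>lborel)"
  have T: "conv (\<lambda>_. 1) ?K x = T" for x by (simp add: conv_one_bump T_def)
  have "T > 0" using conv_one_bump_pos[OF s, of 3 "0::'a"] by (simp add: T)
  have K: "test_function UNIV ?K ?K' ?K''" using s by (intro test_function_bump) auto
  have sub: "cball x s \<subseteq> ball a (2 * s)" if "x \<in> ball a s" for x
  proof
    fix y assume "y \<in> cball x s"
    then show "y \<in> ball a (2 * s)" using that dist_triangle[of a y x] by simp
  qed
  have "conv u ?K x = T * u x" if x: "x \<in> ball a s" for x
  proof -
    have "set_integrable lborel (cball x s) u"
      unfolding set_integrable_def using u by (intro integrable_mult_indicator) auto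
    moreover have "isCont u x"
      using cont sub[OF x] s by (simp add: continuous_on_eq_continuous_at subset_iff)
    ultimately show ?thesis
      using weakly_harmonic_mean_value[OF _ harm sub[OF x] s] by (simp add: T)
  qed
  then have "1 / T * conv u ?K x = u x" if "x \<in> ball a s" for x
    using that \<open>T > 0\<close> by simp
  then have C2: "C2_on (ball a s) u (\<lambda>x v. 1 / T * conv u (\<lambda>z. ?K' z v) x)
      (\<lambda>x v w. 1 / T * conv u (\<lambda>z. ?K'' z v w) x)"
    by (intro C2_on_cong_open[OF C2_on_subset[OF C2_on_cmult[OF C2_on_conv[OF u K]]]]) auto
  have "bilinear_trace (\<lambda>v w. 1 / T * conv u (\<lambda>z. ?K'' z v w) x) = 0" if x: "x \<in> ball a s" for x
    unfolding bilinear_trace_cmult bilinear_trace_conv[OF u K]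
    using weakly_harmonic_integral_bump[OF harm sub[OF x], of 3] s by simp
  then show ?thesis unfolding harmonic_on_iff_C2_on using C2 by blast
qed

theorem Weyl_lemma:
  fixes u :: "'a::euclidean_space \<Rightarrow> real"
  assumes D: "open D" and cont: "continuous_on D u" and harm: "weakly_harmonic_on D u"
  shows "harmonic_on D u"
proof (rule harmonic_on_local)
  fix a assume "a \<in> D"
  then obtain r where "r > 0" and r: "cball a r \<subseteq> D" using D by (meson open_contains_cball)
  define s where "s = r / 2"
  have s: "0 < s" "ball a (2 * s) \<subseteq> cball a r" using \<open>r > 0\<close> by (auto simp: s_def)
  define g where "g y = indicator (cball a r) y *\<^sub>R u y" for y
  have g_eq: "g y = u y" if "y \<in> ball a (2 * s)" for y using that s(2) by (auto simp: g_def)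
  have "integrable lborel g"
    unfolding g_def by (intro borel_integrable_compact continuous_on_subset[OF cont r]) auto
  moreover have "weakly_harmonic_on (ball a (2 * s)) g"
    by (rule weakly_harmonic_on_cong[OF _ weakly_harmonic_on_subset[OF harm order_trans[OF s(2) r]]])
       (simp add: g_eq)
  moreover have "continuous_on (ball a (2 * s)) g"
    using continuous_on_subset[OF cont order_trans[OF s(2) r]]
    by (rule continuous_on_eq) (simp add: g_eq)
  ultimately have "harmonic_on (ball a s) g"
    using s(1) by (rule integrable_weakly_harmonic_imp_harmonic_on_ball)
  then have "harmonic_on (ball a s) u"
    by (rule harmonic_on_cong_open) (use s(1) in \<open>auto intro!: g_eq\<close>)
  then show "\<exists>S. open S \<and> a \<in> S \<and> harmonic_on S u" using s(1) by (intro exI[of _ "ball a s"]) simp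
qed

subsection \<open>The maximum principle\<close>

lemma C2_on_second_derivative_at_max:
  assumes f: "C2_on D f f' f''" and D: "open D" "z \<in> D" and max: "\<And>y. y \<in> D \<Longrightarrow> f y \<le> f z"
  shows "f'' z v v \<le> 0"
proof (rule ccontr)
  assume "\<not> f'' z v v \<le> 0"
  then have "0 < f'' z v v" by simp
  have "((\<lambda>y. f'' y v v) \<longlongrightarrow> f'' z v v) (nhds z)"
    using C2_onD(3)[OF f] D tendsto_at_iff_tendsto_nhds[of "\<lambda>y. f'' y v v" z]
    by (simp add: continuous_on_eq_continuous_at isCont_def)
  then have "\<forall>\<^sub>F y in nhds z. 0 < f'' y v v \<and> y \<in> D"
    using \<open>0 < f'' z v v\<close> D
    by (intro eventually_conj order_tendstoD(1) eventually_nhds_in_open) auto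
  then obtain d where d: "d > 0" "\<And>y. dist y z < d \<Longrightarrow> 0 < f'' y v v \<and> y \<in> D"
    unfolding eventually_nhds_metric by blast
  define t where "t = d / (norm v + 1)"
  have "t > 0" using d(1) by (simp add: t_def add_nonneg_pos)
  have "t * norm v < d"
    using d(1) norm_ge_zero[of v] by (simp add: t_def field_simps del: norm_ge_zero)
  have near: "0 < f'' (z + r *\<^sub>R t *\<^sub>R v) v v \<and> z + r *\<^sub>R t *\<^sub>R v \<in> D" if "0 \<le> r" "r \<le> 1" for r
  proof (rule d(2))
    have "norm (r *\<^sub>R t *\<^sub>R v) \<le> t * norm v"
      using that \<open>t > 0\<close> mult_right_mono[of r 1 "t * norm v"] by (simp add: abs_mult)
    then show "dist (z + r *\<^sub>R t *\<^sub>R v) z < d" using \<open>t * norm v < d\<close> by (simp add: dist_norm)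
  qed
  obtain r where r: "0 < r" "r < 1"
    "f (z + t *\<^sub>R v) = f z + f' z (t *\<^sub>R v) + f'' (z + r *\<^sub>R t *\<^sub>R v) (t *\<^sub>R v) (t *\<^sub>R v) / 2"
    using C2_on_Taylor[OF f, of z "t *\<^sub>R v"] near by blast
  have "f' z = (\<lambda>_. 0)"
    using differential_zero_maxmin[OF D(2,1) C2_onD(1)[OF f D(2)]] max by blast
  moreover have "f'' (z + r *\<^sub>R t *\<^sub>R v) (t *\<^sub>R v) (t *\<^sub>R v) = t\<^sup>2 * f'' (z + r *\<^sub>R t *\<^sub>R v) v v"
    using C2_on_bilinear[OF f D(1) conjunct2[OF near]] r
    by (simp add: bilinear_lmul bilinear_rmul power2_eq_square)
  ultimately have "f z < f (z + t *\<^sub>R v)" using near[of r] r \<open>t > 0\<close> by simp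
  then show False using max[OF conjunct2[OF near[of 1]]] by simp
qed

lemma bilinear_trace_at_max_le_0:
  fixes f :: "'a::euclidean_space \<Rightarrow> real"
  assumes "C2_on D f f' f''" "open D" "z \<in> D" "\<And>y. y \<in> D \<Longrightarrow> f y \<le> f z"
  shows "bilinear_trace (f'' z) \<le> 0"
  unfolding bilinear_trace_def by (intro sum_nonpos C2_on_second_derivative_at_max[OF assms])

lemma closure_eq_Un_frontier: "open D \<Longrightarrow> closure D = D \<union> frontier D"
  using closure_subset[of D] by (auto simp: frontier_def interior_open)

lemma harmonic_le_frontier:
  fixes D :: "'a::euclidean_space set"
  assumes D: "open D" "bounded D" and u: "continuous_on (closure D) u" "harmonic_on D u"
    and v: "continuous_on (closure D) v" "harmonic_on D v"
    and frontier_le: "\<And>x. x \<in> frontier D \<Longrightarrow> u x \<le> v x" and x: "x \<in> closure D"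
  shows "u x \<le> v x"
proof (rule field_le_epsilon)
  fix e :: real assume "e > 0"
  obtain u' u'' v' v'' where C2: "C2_on D u u' u''" "C2_on D v v' v''"
    and trace: "\<And>x. x \<in> D \<Longrightarrow> bilinear_trace (u'' x) = 0" "\<And>x. x \<in> D \<Longrightarrow> bilinear_trace (v'' x) = 0"
    using u(2) v(2) unfolding harmonic_on_iff_C2_on by blast
  obtain R where R: "R > 0" "closure D \<subseteq> cball 0 R"
    using bounded_closure[OF D(2)] by (auto simp: bounded_pos subset_iff)
  define \<mu> where "\<mu> = e / R\<^sup>2"
  have \<mu>: "\<mu> > 0" "\<mu> * R\<^sup>2 = e" using R \<open>e > 0\<close> by (auto simp: \<mu>_def)
  define g where "g y = u y - (v y - \<mu> * (y \<bullet> y))" for y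
  have g: "C2_on D g (\<lambda>y h. u' y h - (v' y h - \<mu> * (2 * (y \<bullet> h))))
      (\<lambda>y h k. u'' y h k - (v'' y h k - \<mu> * (2 * (k \<bullet> h))))"
    unfolding g_def[abs_def] by (intro C2_on_diff C2 C2_on_cmult C2_on_inner_self)
  have "compact (closure D)" using D(2) by (simp add: compact_closure)
  moreover have "continuous_on (closure D) g" unfolding g_def
    by (intro continuous_on_diff continuous_on_mult continuous_on_inner continuous_on_const
        continuous_on_id u(1) v(1))
  ultimately have "\<exists>z\<in>closure D. \<forall>y\<in>closure D. g y \<le> g z"
    using x by (intro continuous_attains_sup) auto
  then obtain z where z: "z \<in> closure D" "\<And>y. y \<in> closure D \<Longrightarrow> g y \<le> g z" by auto
  have "z \<notin> D"
  proof
    assume "z \<in> D"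
    then have "2 * \<mu> * DIM('a) \<le> 0"
      using bilinear_trace_at_max_le_0[OF g D(1) \<open>z \<in> D\<close>] z(2) trace[OF \<open>z \<in> D\<close>] closure_subset[of D]
      by (simp add: bilinear_trace_def sum_subtractf mult.commute subset_iff)
    then show False using \<mu>(1) by (simp add: mult_le_0_iff)
  qed
  then have "u z - v z \<le> 0" using z(1) frontier_le by (simp add: closure_eq_Un_frontier[OF D(1)])
  moreover have "norm z \<le> R" using R(2) z(1) by auto
  then have "\<mu> * (z \<bullet> z) \<le> \<mu> * R\<^sup>2"
    using \<mu>(1) unfolding dot_square_norm by (intro mult_left_mono power_mono) auto
  moreover have "u x - v x \<le> g x" using \<mu>(1) by (simp add: g_def)
  ultimately show "u x \<le> v x + e" using z(2)[OF x] unfolding g_def \<mu>(2) by linarith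
qed

lemma harmonic_on_unique:
  fixes D :: "'a::euclidean_space set"
  assumes "open D" "bounded D" and "continuous_on (closure D) u" "harmonic_on D u"
    and "continuous_on (closure D) v" "harmonic_on D v"
    and "\<And>x. x \<in> frontier D \<Longrightarrow> u x = v x" and "x \<in> closure D"
  shows "u x = v x"
proof (rule antisym)
  show "u x \<le> v x"
    by (rule harmonic_le_frontier[OF assms(1-6) _ assms(8)]) (simp add: assms(7))
  show "v x \<le> u x"
    by (rule harmonic_le_frontier[OF assms(1,2,5,6,3,4) _ assms(8)]) (simp add: assms(7))
qed

subsection \<open>The discrete maximum principle\<close>

lemma ball_mean_norm_square:
  obtains c where "c > 0"
    "\<And>\<epsilon> (x :: 'a::euclidean_space). ball_mean \<epsilon> (\<lambda>y. (norm y)\<^sup>2) x = (norm x)\<^sup>2 + \<epsilon>\<^sup>2 * c"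
proof -
  obtain c where c_pos: "c > 0" and bil: "\<And>B :: 'a \<Rightarrow> 'a \<Rightarrow> real. bilinear B \<Longrightarrow>
      integrable ball_prob (\<lambda>w. B w w) \<and> (\<integral>w. B w w \<partial>ball_prob) = c * bilinear_trace B"
    using integral_ball_prob_bilinear by blast
  have inner: "bilinear (\<lambda>v w :: 'a. v \<bullet> w)"
    by (simp add: bilinear_def linear_iff inner_add_left inner_add_right)
  have lin: "linear (\<lambda>w. x \<bullet> w)" for x :: 'a by (simp add: linear_iff inner_add_right)
  have "ball_mean \<epsilon> (\<lambda>y. (norm y)\<^sup>2) x = (norm x)\<^sup>2 + \<epsilon>\<^sup>2 * (c * DIM('a))" for \<epsilon> and x :: 'a
  proof -
    have "(norm (x + \<epsilon> *\<^sub>R w))\<^sup>2 = (norm x)\<^sup>2 + (2 * \<epsilon>) * (x \<bullet> w) + \<epsilon>\<^sup>2 * (w \<bullet> w)" for w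
      unfolding power2_norm_eq_inner
      by (simp add: inner_add_left inner_add_right inner_commute power2_eq_square algebra_simps)
    then show ?thesis
      using bil[OF inner] integrable_ball_prob_linear[OF lin] integral_ball_prob_linear[OF lin, of x]
      by (simp add: ball_mean_def bilinear_trace_def)
  qed
  then show ?thesis using c_pos by (intro that[of "c * DIM('a)"]) auto
qed

lemma ball_mean_add:
  assumes "integrable ball_prob (\<lambda>w. f (x + \<epsilon> *\<^sub>R w))" "integrable ball_prob (\<lambda>w. g (x + \<epsilon> *\<^sub>R w))"
  shows "ball_mean \<epsilon> (\<lambda>y. f y + g y) x = ball_mean \<epsilon> f x + ball_mean \<epsilon> g x"
  using assms by (simp add: ball_mean_def)

lemma ball_mean_le:
  assumes "integrable ball_prob (\<lambda>w. f (x + \<epsilon> *\<^sub>R w))" "0 < \<epsilon>" "\<And>y. dist x y < \<epsilon> \<Longrightarrow> f y \<le> C"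
  shows "ball_mean \<epsilon> f x \<le> C"
  unfolding ball_mean_def
  using assms by (intro ball_prob.integral_le_const AE_ball_probI) (auto simp: dist_norm)

lemma integrable_ball_prob_affine:
  fixes v :: "'a::euclidean_space \<Rightarrow> real"
  assumes [measurable]: "v \<in> borel_measurable borel" and "\<And>y. \<bar>v y\<bar> \<le> M"
  shows "integrable ball_prob (\<lambda>w. v (x + \<epsilon> *\<^sub>R w))"
  by (rule integrable_ball_prob_bounded[where B=M]) (simp_all add: assms(2))

lemma integrable_ball_prob_norm_square:
  fixes x :: "'a::euclidean_space"
  shows "integrable ball_prob (\<lambda>w. (norm (x + \<epsilon> *\<^sub>R w))\<^sup>2)"
proof (rule integrable_ball_prob_bounded)
  fix w :: 'a assume "norm w < 1"
  then have "norm (x + \<epsilon> *\<^sub>R w) \<le> norm x + \<bar>\<epsilon>\<bar>" by (intro norm_triangle_le) (simp add: mult_left_le)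
  then show "\<bar>(norm (x + \<epsilon> *\<^sub>R w))\<^sup>2\<bar> \<le> (norm x + \<bar>\<epsilon>\<bar>)\<^sup>2" by (simp add: power_mono)
qed simp

lemma strict_discrete_maximum_principle:
  fixes \<phi> :: "'a::euclidean_space \<Rightarrow> real"
  assumes int: "\<And>x. x \<in> S \<Longrightarrow> integrable ball_prob (\<lambda>w. \<phi> (x + \<epsilon> *\<^sub>R w))"
    and bdd: "bdd_above (\<phi> ` S)" and \<epsilon>: "0 < \<epsilon>" and \<kappa>: "0 < \<kappa>"
    and mean: "\<And>x. x \<in> S \<Longrightarrow> \<phi> x + \<kappa> \<le> ball_mean \<epsilon> \<phi> x"
    and outside: "\<And>x y. x \<in> S \<Longrightarrow> dist x y < \<epsilon> \<Longrightarrow> y \<notin> S \<Longrightarrow> \<phi> y \<le> B"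
    and x: "x \<in> S"
  shows "\<phi> x \<le> B"
proof (rule ccontr)
  assume "\<not> \<phi> x \<le> B"
  define \<sigma> where "\<sigma> = Sup (\<phi> ` S)"
  have upper: "\<phi> y \<le> \<sigma>" if "y \<in> S" for y
    unfolding \<sigma>_def by (rule cSup_upper[OF imageI[OF that] bdd])
  obtain y where y: "y \<in> S" "\<sigma> - \<kappa> < \<phi> y"
    using less_cSupD[of "\<phi> ` S" "\<sigma> - \<kappa>"] x \<kappa> unfolding \<sigma>_def by auto
  have "\<phi> y + \<kappa> \<le> ball_mean \<epsilon> \<phi> y" by (rule mean[OF y(1)])
  also have "\<dots> \<le> \<sigma>"
  proof (rule ball_mean_le[OF int[OF y(1)] \<epsilon>])
    show "\<phi> z \<le> \<sigma>" if "dist y z < \<epsilon>" for z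
      using upper[of z] upper[OF x] outside[OF y(1) that] \<open>\<not> \<phi> x \<le> B\<close> by linarith
  qed
  finally show False using y(2) by linarith
qed

text \<open>Adding a small multiple of \<open>|y|\<^sup>2\<close> makes the mean value inequality strict by a fixed
  amount, so that an approximate maximiser suffices; \<open>v\<close> need not be continuous.\<close>

lemma discrete_maximum_principle:
  fixes v :: "'a::euclidean_space \<Rightarrow> real"
  assumes v: "v \<in> borel_measurable borel" "\<And>y. \<bar>v y\<bar> \<le> M" and \<epsilon>: "0 < \<epsilon>" and "bounded S"
    and mean: "\<And>x. x \<in> S \<Longrightarrow> v x \<le> ball_mean \<epsilon> v x"
    and outside: "\<And>x y. x \<in> S \<Longrightarrow> dist x y < \<epsilon> \<Longrightarrow> y \<notin> S \<Longrightarrow> v y \<le> B"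
    and x: "x \<in> S"
  shows "v x \<le> B"
proof (rule field_le_epsilon)
  fix e :: real assume "e > 0"
  obtain R where R: "R > 0" "\<And>y. y \<in> S \<Longrightarrow> norm y \<le> R"
    using \<open>bounded S\<close> by (auto simp: bounded_pos)
  define \<mu> where "\<mu> = e / (R + \<epsilon>)\<^sup>2"
  have \<mu>: "\<mu> > 0" "\<mu> * (R + \<epsilon>)\<^sup>2 = e" using \<open>e > 0\<close> R(1) \<epsilon> by (auto simp: \<mu>_def)
  obtain c where c: "c > 0" "\<And>\<epsilon> (x :: 'a). ball_mean \<epsilon> (\<lambda>y. (norm y)\<^sup>2) x = (norm x)\<^sup>2 + \<epsilon>\<^sup>2 * c"
    by (rule ball_mean_norm_square[where 'a='a]) blast
  define \<phi> where "\<phi> y = v y + \<mu> * (norm y)\<^sup>2" for y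
  have \<phi>_le: "\<phi> y \<le> v y + e" if "norm y \<le> R + \<epsilon>" for y
    using that \<mu>(1) unfolding \<phi>_def \<mu>(2)[symmetric]
    by (intro add_left_mono mult_left_mono power_mono) auto
  have int: "integrable ball_prob (\<lambda>w. v (y + \<epsilon> *\<^sub>R w))"
      "integrable ball_prob (\<lambda>w. \<mu> * (norm (y + \<epsilon> *\<^sub>R w))\<^sup>2)" for y
    by (rule integrable_ball_prob_affine[OF v],
        rule integrable_mult_right[OF integrable_ball_prob_norm_square])
  have "\<phi> x \<le> B + e"
  proof (rule strict_discrete_maximum_principle[OF _ _ \<epsilon> _ _ _ x])
    show "integrable ball_prob (\<lambda>w. \<phi> (y + \<epsilon> *\<^sub>R w))" for y using int by (simp add: \<phi>_def)
    show "0 < \<mu> * (\<epsilon>\<^sup>2 * c)" using \<mu> \<epsilon> c by simp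
    show "bdd_above (\<phi> ` S)"
    proof (rule bdd_aboveI2)
      show "\<phi> y \<le> M + e" if "y \<in> S" for y using \<phi>_le[of y] R(2)[OF that] v(2)[of y] \<epsilon> by linarith
    qed
    fix y assume y: "y \<in> S"
    have "ball_mean \<epsilon> \<phi> y = ball_mean \<epsilon> v y + \<mu> * ball_mean \<epsilon> (\<lambda>y. (norm y)\<^sup>2) y"
      using ball_mean_add[OF int] by (simp add: \<phi>_def[abs_def] ball_mean_def)
    then show "\<phi> y + \<mu> * (\<epsilon>\<^sup>2 * c) \<le> ball_mean \<epsilon> \<phi> y"
      using mean[OF y] by (simp add: \<phi>_def c(2) distrib_left)
    fix z assume z: "dist y z < \<epsilon>" "z \<notin> S"
    have "norm z \<le> norm y + dist y z" using norm_triangle_sub[of z y]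
      by (simp add: dist_norm norm_minus_commute)
    then have "\<phi> z \<le> v z + e" using R(2)[OF y] z by (intro \<phi>_le) linarith
    then show "\<phi> z \<le> B + e" using outside[OF y z] by linarith
  qed
  moreover have "v x \<le> \<phi> x" using \<mu>(1) by (simp add: \<phi>_def)
  ultimately show "v x \<le> B + e" by linarith
qed

subsection \<open>Asymptotic equicontinuity\<close>

definition asymptotically_equicontinuous_on ::
  "'a::metric_space set \<Rightarrow> ('i \<Rightarrow> 'a \<Rightarrow> 'b::metric_space) \<Rightarrow> 'i filter \<Rightarrow> bool" where
  "asymptotically_equicontinuous_on S f F \<longleftrightarrow>
     (\<forall>e>0. \<exists>d>0. \<forall>\<^sub>F i in F. \<forall>x\<in>S. \<forall>y\<in>S. dist x y < d \<longrightarrow> dist (f i x) (f i y) \<le> e)"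

lemma asymptotically_equicontinuous_on_compose:
  assumes "asymptotically_equicontinuous_on S f F" "filterlim r F G"
  shows "asymptotically_equicontinuous_on S (\<lambda>i. f (r i)) G"
  unfolding asymptotically_equicontinuous_on_def
proof (intro allI impI)
  fix e :: real assume "e > 0"
  then obtain d where "d > 0" "\<forall>\<^sub>F i in F. \<forall>x\<in>S. \<forall>y\<in>S. dist x y < d \<longrightarrow> dist (f i x) (f i y) \<le> e"
    using assms(1) unfolding asymptotically_equicontinuous_on_def by blast
  then show "\<exists>d>0. \<forall>\<^sub>F i in G. \<forall>x\<in>S. \<forall>y\<in>S. dist x y < d \<longrightarrow> dist (f (r i) x) (f (r i) y) \<le> e"
    using eventually_compose_filterlim[OF _ assms(2)] by (intro exI[of _ d] conjI)
qed

lemma asymptotically_equicontinuous_on_imp_continuous_limit: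
  assumes equi: "asymptotically_equicontinuous_on S f F" and "F \<noteq> bot"
    and lim: "\<And>x. x \<in> S \<Longrightarrow> ((\<lambda>i. f i x) \<longlongrightarrow> g x) F"
  shows "uniformly_continuous_on S g"
  unfolding uniformly_continuous_on_def
proof (intro allI impI)
  fix e :: real assume "e > 0"
  then have "e / 2 > 0" by simp
  then obtain d where "d > 0"
    and d: "\<forall>\<^sub>F i in F. \<forall>x\<in>S. \<forall>y\<in>S. dist x y < d \<longrightarrow> dist (f i x) (f i y) \<le> e / 2"
    using equi unfolding asymptotically_equicontinuous_on_def by blast
  have "dist (g x) (g y) \<le> e / 2" if "x \<in> S" "y \<in> S" "dist x y < d" for x y
  proof (rule tendsto_upperbound[OF tendsto_dist[OF lim lim]])
    show "\<forall>\<^sub>F i in F. dist (f i x) (f i y) \<le> e / 2" using d by eventually_elim (use that in blast)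
  qed (use that \<open>F \<noteq> bot\<close> in auto)
  moreover have "e / 2 < e" using \<open>e > 0\<close> by simp
  ultimately show "\<exists>d>0. \<forall>x\<in>S. \<forall>y\<in>S. dist y x < d \<longrightarrow> dist (g y) (g x) < e"
    using \<open>d > 0\<close> by (meson le_less_trans)
qed

lemma asymptotically_equicontinuous_on_uniformly_Cauchy:
  fixes f :: "nat \<Rightarrow> 'a::metric_space \<Rightarrow> 'b::metric_space"
  assumes S: "compact S" and equi: "asymptotically_equicontinuous_on S f sequentially"
    and T: "T \<subseteq> S" "S \<subseteq> closure T" and Cauchy: "\<And>t. t \<in> T \<Longrightarrow> Cauchy (\<lambda>n. f n t)" and "e > 0"
  shows "\<exists>N. \<forall>m n x. N \<le> m \<and> N \<le> n \<and> x \<in> S \<longrightarrow> dist (f m x) (f n x) < e"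
proof -
  have "e / 4 > 0" using \<open>e > 0\<close> by simp
  then obtain d where "d > 0"
    and "\<forall>\<^sub>F n in sequentially. \<forall>x\<in>S. \<forall>y\<in>S. dist x y < d \<longrightarrow> dist (f n x) (f n y) \<le> e / 4"
    using equi unfolding asymptotically_equicontinuous_on_def by blast
  then obtain N1 where small_oscillation: "dist (f n x) (f n y) \<le> e / 4"
    if "n \<ge> N1" "x \<in> S" "y \<in> S" "dist x y < d" for n x y
    unfolding eventually_sequentially by blast
  have "S \<subseteq> (\<Union>t\<in>T. ball t d)"
    using T(2) \<open>d > 0\<close> by (force simp: closure_approachable)
  then obtain C where C: "C \<subseteq> T" "finite C" "S \<subseteq> (\<Union>t\<in>C. ball t d)"
    using compactE_image[OF S, of T "\<lambda>t. ball t d"] by auto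
  have "\<exists>N. \<forall>m\<ge>N. \<forall>n\<ge>N. dist (f m t) (f n t) < e / 4" if "t \<in> C" for t
    using C(1) that by (intro metric_CauchyD[OF Cauchy \<open>e / 4 > 0\<close>]) auto
  then obtain N2 where Cauchy_on_C: "dist (f m t) (f n t) < e / 4" if "t \<in> C" "m \<ge> N2 t" "n \<ge> N2 t"
    for t m n
    by metis
  define N where "N = max N1 (Max (insert 0 (N2 ` C)))"
  have "dist (f m x) (f n x) < e" if ge_N: "N \<le> m" "N \<le> n" and x: "x \<in> S" for m n x
  proof -
    obtain t where t: "t \<in> C" "dist x t < d" using C(3) x by (auto simp: dist_commute)
    have "t \<in> S" using t(1) C(1) T(1) by blast
    have "N2 t \<le> N" using t(1) C(2) unfolding N_def by (intro max.coboundedI2 Max_ge) auto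
    then have "dist (f m t) (f n t) < e / 4" using ge_N t(1) by (intro Cauchy_on_C) auto
    moreover have "N1 \<le> N" by (simp add: N_def)
    then have "dist (f m x) (f m t) \<le> e / 4" "dist (f n x) (f n t) \<le> e / 4"
      using small_oscillation[OF _ x \<open>t \<in> S\<close> t(2)] ge_N by (meson order_trans)+
    moreover have "dist (f m x) (f n x) \<le> dist (f m x) (f m t) + dist (f m t) (f n t)
        + dist (f n x) (f n t)"
      using dist_triangle[of "f m x" "f n x" "f m t"] dist_triangle[of "f m t" "f n x" "f n t"]
      by (simp add: dist_commute)
    ultimately show ?thesis using \<open>e > 0\<close> by linarith
  qed
  then show ?thesis by blast
qed

theorem asymptotic_Arzela_Ascoli:
  fixes f :: "nat \<Rightarrow> 'a::euclidean_space \<Rightarrow> 'b::{real_normed_vector,heine_borel}"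
  assumes S: "compact S" and bound: "\<And>n x. x \<in> S \<Longrightarrow> norm (f n x) \<le> M"
    and equi: "asymptotically_equicontinuous_on S f sequentially"
  obtains g r where "strict_mono (r :: nat \<Rightarrow> nat)" "uniform_limit S (\<lambda>n. f (r n)) g sequentially"
proof -
  obtain T where T: "countable T" "T \<subseteq> S" "S \<subseteq> closure T" by (rule separable)
  obtain r where r: "strict_mono (r :: nat \<Rightarrow> nat)" "\<And>x. x \<in> T \<Longrightarrow> \<exists>l. (\<lambda>n. f (r n) x) \<longlonglongrightarrow> l"
    using function_convergent_subsequence[OF T(1), of f M] bound T(2) by blast
  have Cauchy: "Cauchy (\<lambda>n. f (r n) t)" if "t \<in> T" for t
    using r(2)[OF that] unfolding convergent_eq_Cauchy .
  obtain g where "\<forall>e>0. \<exists>N. \<forall>n x. N \<le> n \<and> x \<in> S \<longrightarrow> dist (f (r n) x) (g x) < e"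
    using asymptotically_equicontinuous_on_uniformly_Cauchy
        [OF S asymptotically_equicontinuous_on_compose[OF equi filterlim_subseq[OF r(1)]]
          T(2,3) Cauchy]
      uniformly_convergent_eq_cauchy[of "\<lambda>x. x \<in> S" "\<lambda>n. f (r n)"] by auto
  then have "uniform_limit S (\<lambda>n. f (r n)) g sequentially"
    unfolding uniform_limit_sequentially_iff by blast
  then show ?thesis using r(1) by (intro that)
qed

lemma uniform_limit_at_right_from_subsequences:
  fixes W :: "real \<Rightarrow> 'a \<Rightarrow> 'b::metric_space"
  assumes "\<And>\<epsilon>. filterlim \<epsilon> (at_right a) sequentially \<Longrightarrow>
    \<exists>r :: nat \<Rightarrow> nat. strict_mono r \<and> uniform_limit S (\<lambda>n. W (\<epsilon> (r n))) u sequentially"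
  shows "uniform_limit S W u (at_right a)"
proof (rule uniform_limitI, rule sequentially_imp_eventually_within, intro allI impI)
  fix e :: real and \<epsilon> :: "nat \<Rightarrow> real"
  assume "e > 0" and \<epsilon>: "(\<forall>n. \<epsilon> n \<in> {a<..} \<and> \<epsilon> n \<noteq> a) \<and> \<epsilon> \<longlonglongrightarrow> a"
  show "\<forall>\<^sub>F n in sequentially. \<forall>x\<in>S. dist (W (\<epsilon> n) x) (u x) < e"
  proof (rule ccontr)
    define far where "far = {n. \<exists>x\<in>S. \<not> dist (W (\<epsilon> n) x) (u x) < e}"
    assume "\<not> ?thesis"
    then have "infinite far"
      unfolding far_def eventually_sequentially infinite_nat_iff_unbounded_le by blast
    then obtain s :: "nat \<Rightarrow> nat" where s: "strict_mono s" "\<And>n. s n \<in> far"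
      using infinite_enumerate[of far] by blast
    have "(\<lambda>n. \<epsilon> (s n)) \<longlonglongrightarrow> a"
      using LIMSEQ_subseq_LIMSEQ[OF conjunct2[OF \<epsilon>] s(1)] by (simp add: comp_def)
    then have "filterlim (\<lambda>n. \<epsilon> (s n)) (at_right a) sequentially"
      using \<epsilon> by (simp add: filterlim_at)
    then obtain r :: "nat \<Rightarrow> nat" where "uniform_limit S (\<lambda>n. W (\<epsilon> (s (r n)))) u sequentially"
      using assms by blast
    then have "\<forall>\<^sub>F n in sequentially. \<forall>x\<in>S. dist (W (\<epsilon> (s (r n))) x) (u x) < e"
      using \<open>e > 0\<close> by (rule uniform_limitD)
    then obtain n where "\<forall>x\<in>S. dist (W (\<epsilon> (s (r n))) x) (u x) < e"
      by (rule eventually_happens'[OF sequentially_bot, THEN exE])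
    then show False using s(2)[of "r n"] by (simp add: far_def)
  qed
qed

subsection \<open>Families with the discrete mean value property\<close>

lemma ball_infdist_frontier_subset:
  fixes D :: "'a::euclidean_space set"
  assumes "x \<in> D" shows "ball x (infdist x (frontier D)) \<subseteq> D"
proof (rule ccontr)
  assume "\<not> ?thesis"
  moreover from this have "x \<in> ball x (infdist x (frontier D))"
    by (metis ball_empty centre_in_ball empty_subsetI not_le)
  ultimately have "ball x (infdist x (frontier D)) \<inter> frontier D \<noteq> {}"
    using assms by (intro connected_Int_frontier[OF connected_ball]) blast+
  then show False using infdist_le[of _ "frontier D" x] by (force simp: not_less)
qed

lemma mem_if_dist_less_infdist_frontier:
  fixes D :: "'a::euclidean_space set"
  shows "x \<in> D \<Longrightarrow> dist x y < infdist x (frontier D) \<Longrightarrow> y \<in> D"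
  using ball_infdist_frontier_subset[of x D] by auto

lemma mean_value_translation_le:
  fixes W :: "'a::euclidean_space \<Rightarrow> real"
  assumes W [measurable]: "W \<in> borel_measurable borel" and M: "\<And>y. \<bar>W y\<bar> \<le> M" and "bounded D"
    and \<epsilon>: "0 < \<epsilon>"
    and mean: "\<And>x. x \<in> D \<Longrightarrow> \<epsilon> \<le> infdist x (frontier D) \<Longrightarrow> W x = ball_mean \<epsilon> W x"
    and h_small: "norm h + \<epsilon> \<le> \<delta>"
    and near: "\<And>y. y \<in> D \<Longrightarrow> y + h \<in> D \<Longrightarrow> infdist y (frontier D) < \<delta> \<Longrightarrow> W (y + h) - W y \<le> \<eta>"
    and x: "x \<in> D" "\<delta> \<le> infdist x (frontier D)"
  shows "W (x + h) - W x \<le> \<eta>"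
proof (rule discrete_maximum_principle
    [where S="{x \<in> D. \<delta> \<le> infdist x (frontier D)}" and M="2 * M" and \<epsilon>=\<epsilon>])
  show "(\<lambda>x. W (x + h) - W x) \<in> borel_measurable borel" by measurable
  show "\<bar>W (y + h) - W y\<bar> \<le> 2 * M" for y using M[of "y + h"] M[of y] by linarith
  show "bounded {x \<in> D. \<delta> \<le> infdist x (frontier D)}" by (rule bounded_subset[OF \<open>bounded D\<close>]) auto
  have int: "integrable ball_prob (\<lambda>w. W (y + \<epsilon> *\<^sub>R w))" for y
    by (rule integrable_ball_prob_affine[OF W M])
  fix x assume "x \<in> {x \<in> D. \<delta> \<le> infdist x (frontier D)}"
  then have x: "x \<in> D" "\<delta> \<le> infdist x (frontier D)" by auto
  have "x + h \<in> D"
    using x h_small \<epsilon> by (intro mem_if_dist_less_infdist_frontier[OF x(1)]) (simp add: dist_norm)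
  moreover have "\<epsilon> \<le> infdist (x + h) (frontier D)"
    using infdist_triangle[of x "frontier D" "x + h"] x(2) h_small by (simp add: dist_norm)
  ultimately have "W (x + h) = ball_mean \<epsilon> W (x + h)" by (rule mean)
  moreover have "W x = ball_mean \<epsilon> W x" using x h_small norm_ge_zero[of h] by (intro mean) linarith+
  moreover have "ball_mean \<epsilon> (\<lambda>x. W (x + h) - W x) x = ball_mean \<epsilon> W (x + h) - ball_mean \<epsilon> W x"
    using int[of x] int[of "x + h"] by (simp add: ball_mean_def add.assoc add.commute[of h])
  ultimately show "W (x + h) - W x \<le> ball_mean \<epsilon> (\<lambda>x. W (x + h) - W x) x" by simp
  fix y assume y: "dist x y < \<epsilon>" "y \<notin> {x \<in> D. \<delta> \<le> infdist x (frontier D)}"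
  have "dist x (y + h) \<le> dist x y + norm h" using dist_triangle[of x "y + h" y]
    by (simp add: dist_norm)
  then have "dist x (y + h) < infdist x (frontier D)" "dist x y < infdist x (frontier D)"
    using y(1) x(2) h_small norm_ge_zero[of h] by linarith+
  then have "y + h \<in> D" "y \<in> D" by (auto intro: mem_if_dist_less_infdist_frontier[OF x(1)])
  then show "W (y + h) - W y \<le> \<eta>" using y(2) by (intro near) auto
qed (use \<epsilon> x in auto)

definition converges_at_frontier ::
  "'a::metric_space set \<Rightarrow> (real \<Rightarrow> 'a \<Rightarrow> real) \<Rightarrow> ('a \<Rightarrow> real) \<Rightarrow> bool" where
  "converges_at_frontier D W F \<longleftrightarrow> (\<forall>\<eta>>0. \<exists>\<delta>>0. \<forall>\<^sub>F \<epsilon> in at_right 0.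
     \<forall>x\<in>closure D. \<forall>y\<in>frontier D. dist x y < \<delta> \<longrightarrow> \<bar>W \<epsilon> x - F y\<bar> \<le> \<eta>)"

definition converges_at_point ::
  "'a::metric_space set \<Rightarrow> (real \<Rightarrow> 'a \<Rightarrow> real) \<Rightarrow> 'a \<Rightarrow> real \<Rightarrow> bool" where
  "converges_at_point D W a l \<longleftrightarrow> (\<forall>\<eta>>0. \<exists>\<delta>>0. \<forall>\<^sub>F \<epsilon> in at_right 0.
     \<forall>x\<in>closure D. dist a x < \<delta> \<longrightarrow> \<bar>W \<epsilon> x - l\<bar> \<le> \<eta>)"

lemma converges_at_point_continuous:
  assumes "converges_at_point D W a (F a)" and F: "continuous_on (frontier D) F"
    and a: "a \<in> frontier D" and "\<eta> > 0"
  obtains d where "d > 0" "\<forall>\<^sub>F \<epsilon> in at_right 0. \<forall>x\<in>closure D. \<forall>y\<in>frontier D.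
    dist a x < d \<longrightarrow> dist a y < d \<longrightarrow> \<bar>W \<epsilon> x - F y\<bar> \<le> \<eta>"
proof -
  have "\<eta> / 2 > 0" using \<open>\<eta> > 0\<close> by simp
  then obtain d where "d > 0"
    and W: "\<forall>\<^sub>F \<epsilon> in at_right 0. \<forall>x\<in>closure D. dist a x < d \<longrightarrow> \<bar>W \<epsilon> x - F a\<bar> \<le> \<eta> / 2"
    using assms(1) unfolding converges_at_point_def by blast
  obtain d' where "d' > 0" and F: "\<And>y. y \<in> frontier D \<Longrightarrow> dist y a < d' \<Longrightarrow> dist (F y) (F a) < \<eta> / 2"
    using F a \<open>\<eta> / 2 > 0\<close> unfolding continuous_on_iff by meson
  show ?thesis
  proof (rule that[of "min d d'"])
    show "\<forall>\<^sub>F \<epsilon> in at_right 0. \<forall>x\<in>closure D. \<forall>y\<in>frontier D.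
        dist a x < min d d' \<longrightarrow> dist a y < min d d' \<longrightarrow> \<bar>W \<epsilon> x - F y\<bar> \<le> \<eta>"
      using W
    proof eventually_elim
      case (elim \<epsilon>)
      show ?case
      proof (intro ballI impI)
        fix x y assume "x \<in> closure D" "dist a x < min d d'"
          and y: "y \<in> frontier D" "dist a y < min d d'"
        then have "\<bar>W \<epsilon> x - F a\<bar> \<le> \<eta> / 2" using elim by simp
        moreover have "\<bar>F y - F a\<bar> < \<eta> / 2" using F[of y] y by (simp add: dist_real_def dist_commute)
        ultimately show "\<bar>W \<epsilon> x - F y\<bar> \<le> \<eta>" by linarith
      qed
    qed
  qed (use \<open>d > 0\<close> \<open>d' > 0\<close> in simp)
qed

lemma converges_at_frontierI:
  fixes D :: "'a::euclidean_space set"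
  assumes "bounded D" and F: "continuous_on (frontier D) F"
    and W: "\<And>a. a \<in> frontier D \<Longrightarrow> converges_at_point D W a (F a)"
  shows "converges_at_frontier D W F"
  unfolding converges_at_frontier_def
proof (intro allI impI)
  fix \<eta> :: real assume "\<eta> > 0"
  define near where "near a d \<epsilon> \<longleftrightarrow> (\<forall>x\<in>closure D. \<forall>y\<in>frontier D.
    dist a x < d \<longrightarrow> dist a y < d \<longrightarrow> \<bar>W \<epsilon> x - F y\<bar> \<le> \<eta>)" for a d \<epsilon>
  have "\<exists>d>0. \<forall>\<^sub>F \<epsilon> in at_right 0. near a d \<epsilon>" if a: "a \<in> frontier D" for a
    by (rule converges_at_point_continuous[OF W[OF a] F a \<open>\<eta> > 0\<close>]) (auto simp: near_def)
  then obtain d where d: "\<And>a. a \<in> frontier D \<Longrightarrow> d a > 0"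
    and near: "\<And>a. a \<in> frontier D \<Longrightarrow> \<forall>\<^sub>F \<epsilon> in at_right 0. near a (d a) \<epsilon>"
    by metis
  have cover: "frontier D \<subseteq> (\<Union>a\<in>frontier D. ball a (d a / 2))" using d by force
  obtain C where C: "C \<subseteq> frontier D" "finite C" "frontier D \<subseteq> (\<Union>a\<in>C. ball a (d a / 2))"
    by (rule compactE_image[OF compact_frontier_bounded[OF \<open>bounded D\<close>] _ cover]) auto
  define \<delta> where "\<delta> = Min (insert 1 ((\<lambda>a. d a / 2) ` C))"
  have \<delta>_le: "\<delta> \<le> d a / 2" if "a \<in> C" for a
    using that C(2) unfolding \<delta>_def by (intro Min_le) auto
  have "\<delta> > 0" using C d by (auto simp: \<delta>_def)
  moreover have "\<forall>\<^sub>F \<epsilon> in at_right 0. \<forall>a\<in>C. near a (d a) \<epsilon>"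
    using near C(1) by (intro eventually_ball_finite C(2)) auto
  then have "\<forall>\<^sub>F \<epsilon> in at_right 0. \<forall>x\<in>closure D. \<forall>y\<in>frontier D. dist x y < \<delta> \<longrightarrow> \<bar>W \<epsilon> x - F y\<bar> \<le> \<eta>"
  proof eventually_elim
    case (elim \<epsilon>)
    show ?case
    proof (intro ballI impI)
      fix x y assume x: "x \<in> closure D" and y: "y \<in> frontier D" "dist x y < \<delta>"
      obtain a where a: "a \<in> C" "dist a y < d a / 2" using C(3) y(1) by auto
      then have "dist a y < d a" using d[of a] C(1) by auto
      moreover have "dist a x < d a"
        using dist_triangle[of a x y] y(2) a \<delta>_le[OF a(1)] by (simp add: dist_commute)
      ultimately show "\<bar>W \<epsilon> x - F y\<bar> \<le> \<eta>" using elim a(1) x y(1) by (simp add: near_def)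
    qed
  qed
  ultimately show "\<exists>\<delta>>0. \<forall>\<^sub>F \<epsilon> in at_right 0. \<forall>x\<in>closure D. \<forall>y\<in>frontier D. dist x y < \<delta> \<longrightarrow>
      \<bar>W \<epsilon> x - F y\<bar> \<le> \<eta>"
    by blast
qed

locale mean_value_family =
  fixes D :: "'a::euclidean_space set" and F :: "'a \<Rightarrow> real" and W :: "real \<Rightarrow> 'a \<Rightarrow> real" and M :: real
  assumes D: "open D" "bounded D" "D \<noteq> {}"
    and W_measurable: "\<And>\<epsilon>. W \<epsilon> \<in> borel_measurable borel"
    and W_bounded: "\<And>\<epsilon> y. \<bar>W \<epsilon> y\<bar> \<le> M"
    and W_mean: "\<And>\<epsilon> x. 0 < \<epsilon> \<Longrightarrow> x \<in> D \<Longrightarrow> \<epsilon> \<le> infdist x (frontier D) \<Longrightarrow> W \<epsilon> x = ball_mean \<epsilon> (W \<epsilon>) x"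
    and W_frontier: "converges_at_frontier D W F"
begin

lemma near_frontier:
  assumes "infdist x (frontier D) < d"
  obtains a where "a \<in> frontier D" "dist x a < d"
proof -
  have "frontier D \<noteq> {}" using D frontier_eq_empty[of D] not_bounded_UNIV by auto
  then show ?thesis using infdist_attains_inf[OF frontier_closed[of D], of x] assms that by metis
qed

lemma W_oscillation_near_frontier:
  assumes "\<eta> > 0"
  obtains \<delta> where "\<delta> > 0" "\<forall>\<^sub>F \<epsilon> in at_right 0. \<forall>x\<in>closure D. \<forall>y\<in>closure D.
    infdist x (frontier D) < \<delta> \<longrightarrow> dist x y < \<delta> \<longrightarrow> \<bar>W \<epsilon> x - W \<epsilon> y\<bar> \<le> \<eta>"
proof -
  have "\<eta> / 2 > 0" using \<open>\<eta> > 0\<close> by simp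
  then obtain \<delta> where "\<delta> > 0" and frontier: "\<forall>\<^sub>F \<epsilon> in at_right 0. \<forall>x\<in>closure D. \<forall>y\<in>frontier D.
      dist x y < \<delta> \<longrightarrow> \<bar>W \<epsilon> x - F y\<bar> \<le> \<eta> / 2"
    using W_frontier unfolding converges_at_frontier_def by blast
  show ?thesis
  proof (rule that)
    show "\<forall>\<^sub>F \<epsilon> in at_right 0. \<forall>x\<in>closure D. \<forall>y\<in>closure D.
        infdist x (frontier D) < \<delta> / 2 \<longrightarrow> dist x y < \<delta> / 2 \<longrightarrow> \<bar>W \<epsilon> x - W \<epsilon> y\<bar> \<le> \<eta>"
      using frontier
    proof eventually_elim
      case (elim \<epsilon>)
      show ?case
      proof (intro ballI impI)
        fix x y
        assume xy: "x \<in> closure D" "y \<in> closure D" "infdist x (frontier D) < \<delta> / 2" "dist x y < \<delta> / 2"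
        obtain a where a: "a \<in> frontier D" "dist x a < \<delta> / 2" using xy(3) by (rule near_frontier)
        have "dist y a < \<delta>" using dist_triangle[of y a x] a(2) xy(4) by (simp add: dist_commute)
        then have "\<bar>W \<epsilon> x - F a\<bar> \<le> \<eta> / 2" "\<bar>W \<epsilon> y - F a\<bar> \<le> \<eta> / 2" using elim xy a \<open>\<delta> > 0\<close> by auto
        then show "\<bar>W \<epsilon> x - W \<epsilon> y\<bar> \<le> \<eta>" by linarith
      qed
    qed
  qed (use \<open>\<delta> > 0\<close> in simp)
qed

text \<open>The translation difference \<open>W \<epsilon> (x + h) - W \<epsilon> x\<close> has the mean value property as well, so
  the discrete maximum principle transports its smallness near the boundary into the interior.\<close>

lemma W_asymptotically_equicontinuous: "asymptotically_equicontinuous_on (closure D) W (at_right 0)"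
  unfolding asymptotically_equicontinuous_on_def
proof (intro allI impI)
  fix \<eta> :: real assume "\<eta> > 0"
  then obtain \<delta> where "\<delta> > 0" and frontier: "\<forall>\<^sub>F \<epsilon> in at_right 0. \<forall>x\<in>closure D. \<forall>y\<in>closure D.
      infdist x (frontier D) < \<delta> \<longrightarrow> dist x y < \<delta> \<longrightarrow> \<bar>W \<epsilon> x - W \<epsilon> y\<bar> \<le> \<eta>"
    by (rule W_oscillation_near_frontier)
  have "\<forall>\<^sub>F \<epsilon> in at_right 0. 0 < \<epsilon> \<and> \<epsilon> < \<delta> / 2"
    using eventually_at_right_real[of 0 "\<delta> / 2"] \<open>\<delta> > 0\<close> by simp
  with frontier have "\<forall>\<^sub>F \<epsilon> in at_right 0. \<forall>x\<in>closure D. \<forall>y\<in>closure D.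
      dist x y < \<delta> / 2 \<longrightarrow> dist (W \<epsilon> x) (W \<epsilon> y) \<le> \<eta>"
  proof eventually_elim
    case (elim \<epsilon>)
    have increment_le: "W \<epsilon> y - W \<epsilon> x \<le> \<eta>" if xy: "x \<in> closure D" "y \<in> closure D" "dist x y < \<delta> / 2"
      for x y
    proof (cases "infdist x (frontier D) < \<delta>")
      case True
      then have "\<bar>W \<epsilon> x - W \<epsilon> y\<bar> \<le> \<eta>" using elim(1) xy \<open>\<delta> > 0\<close> by simp
      then show ?thesis by linarith
    next
      case False
      then have "x \<in> D" using xy(1) \<open>\<delta> > 0\<close> by (auto simp: closure_eq_Un_frontier[OF D(1)])
      have "W \<epsilon> (x + (y - x)) - W \<epsilon> x \<le> \<eta>"
      proof (rule mean_value_translation_le[OF W_measurable W_bounded D(2) _ W_mean])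
        show step_le: "norm (y - x) + \<epsilon> \<le> \<delta>" using xy(3) elim(2)
          by (simp add: dist_norm norm_minus_commute)
        fix z assume z: "z \<in> D" "z + (y - x) \<in> D" "infdist z (frontier D) < \<delta>"
        have "dist z (z + (y - x)) < \<delta>" using step_le elim(2)
          by (simp add: dist_norm norm_minus_commute)
        then have "\<bar>W \<epsilon> z - W \<epsilon> (z + (y - x))\<bar> \<le> \<eta>" using elim(1) z
          by (simp add: closure_eq_Un_frontier[OF D(1)])
        then show "W \<epsilon> (z + (y - x)) - W \<epsilon> z \<le> \<eta>" by linarith
      qed (use elim(2) False \<open>x \<in> D\<close> in auto)
      then show ?thesis by simp
    qed
    show ?case
      using increment_le by (auto simp: dist_real_def dist_commute abs_le_iff)
  qed
  then show "\<exists>d>0. \<forall>\<^sub>F \<epsilon> in at_right 0. \<forall>x\<in>closure D. \<forall>y\<in>closure D. dist x y < d \<longrightarrow>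
      dist (W \<epsilon> x) (W \<epsilon> y) \<le> \<eta>"
    using \<open>\<delta> > 0\<close> by (intro exI[of _ "\<delta> / 2"]) simp
qed

lemma W_mean_on_compact:
  assumes \<epsilon>: "filterlim \<epsilon> (at_right 0) sequentially" and K: "compact K" "K \<subseteq> D"
  shows "\<forall>\<^sub>F n in sequentially. \<forall>x\<in>K. W (\<epsilon> n) x = ball_mean (\<epsilon> n) (W (\<epsilon> n)) x"
proof -
  have "K \<inter> frontier D = {}" using K(2) D(1) frontier_disjoint_eq[of D] by blast
  then obtain d where d: "d > 0" "\<And>x a. x \<in> K \<Longrightarrow> a \<in> frontier D \<Longrightarrow> d \<le> dist x a"
    using separate_compact_closed[OF K(1) frontier_closed[of D]] by auto
  have far: "d \<le> infdist x (frontier D)" if "x \<in> K" for x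
  proof (rule ccontr)
    assume "\<not> ?thesis"
    then obtain a where "a \<in> frontier D" "dist x a < d" using near_frontier[of x d] by auto
    then show False using d(2)[OF that] by fastforce
  qed
  have "\<forall>\<^sub>F n in sequentially. 0 < \<epsilon> n \<and> \<epsilon> n < d"
    using eventually_compose_filterlim[OF eventually_at_right_real[OF d(1)] \<epsilon>] by simp
  then show ?thesis
  proof eventually_elim
    case (elim n)
    show ?case
    proof
      fix x assume "x \<in> K"
      then show "W (\<epsilon> n) x = ball_mean (\<epsilon> n) (W (\<epsilon> n)) x"
        using elim far[of x] K(2) by (intro W_mean) auto
    qed
  qed
qed

lemma subsequential_limit:
  assumes \<epsilon>: "filterlim \<epsilon> (at_right 0) sequentially"
    and lim: "uniform_limit (closure D) (\<lambda>n. W (\<epsilon> n)) u sequentially"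
  shows "continuous_on (closure D) u" "harmonic_on D u" "\<And>x. x \<in> frontier D \<Longrightarrow> u x = F x"
proof -
  have pointwise: "(\<lambda>n. W (\<epsilon> n) x) \<longlonglongrightarrow> u x" if "x \<in> closure D" for x
    using tendsto_uniform_limitI[OF lim that] .
  show cont: "continuous_on (closure D) u"
    using asymptotically_equicontinuous_on_imp_continuous_limit
      [OF asymptotically_equicontinuous_on_compose[OF W_asymptotically_equicontinuous \<epsilon>] _ pointwise]
    by (simp add: uniformly_continuous_imp_continuous)
  show "harmonic_on D u"
  proof (rule Weyl_lemma[OF D(1) continuous_on_subset[OF cont closure_subset]])
    show "weakly_harmonic_on D u"
      using W_measurable W_bounded \<epsilon> W_mean_on_compact[OF \<epsilon>] pointwise
      by (rule weakly_harmonic_on_limit) (use closure_subset in auto)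
  qed
  show "u x = F x" if x: "x \<in> frontier D" for x
  proof -
    have "\<bar>u x - F x\<bar> \<le> 0 + \<eta>" if "\<eta> > 0" for \<eta>
    proof -
      have x_closure: "x \<in> closure D" using x by (simp add: closure_eq_Un_frontier[OF D(1)])
      have "\<forall>\<^sub>F \<epsilon> in at_right 0. \<bar>W \<epsilon> x - F x\<bar> \<le> \<eta>"
        using W_frontier \<open>\<eta> > 0\<close> x x_closure unfolding converges_at_frontier_def
        by (auto elim!: allE[of _ \<eta>] eventually_mono)
      then have "\<forall>\<^sub>F n in sequentially. \<bar>W (\<epsilon> n) x - F x\<bar> \<le> \<eta>" using \<epsilon>
        by (rule eventually_compose_filterlim)
      then show ?thesis
        using tendsto_upperbound
          [OF tendsto_rabs[OF tendsto_diff[OF pointwise[OF x_closure] tendsto_const]]] by simp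
    qed
    then have "\<bar>u x - F x\<bar> \<le> 0" by (rule field_le_epsilon)
    then show ?thesis by simp
  qed
qed

lemma harmonic_limit:
  "\<exists>u. continuous_on (closure D) u \<and> harmonic_on D u \<and> (\<forall>x\<in>frontier D. u x = F x) \<and>
    uniform_limit (closure D) W u (at_right 0)"
proof -
  have subsequence: "\<exists>r v. strict_mono (r :: nat \<Rightarrow> nat) \<and>
      uniform_limit (closure D) (\<lambda>n. W (\<epsilon> (r n))) v sequentially \<and>
      continuous_on (closure D) v \<and> harmonic_on D v \<and> (\<forall>x\<in>frontier D. v x = F x)"
    if \<epsilon>: "filterlim \<epsilon> (at_right 0) sequentially" for \<epsilon>
  proof -
    have "compact (closure D)" using D(2) by (simp add: compact_closure)
    then obtain v and r :: "nat \<Rightarrow> nat" where r: "strict_mono r"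
      and lim: "uniform_limit (closure D) (\<lambda>n. W (\<epsilon> (r n))) v sequentially"
      by (rule asymptotic_Arzela_Ascoli[where M=M, OF _ _
            asymptotically_equicontinuous_on_compose[OF W_asymptotically_equicontinuous \<epsilon>]])
         (simp_all add: W_bounded)
    then show ?thesis
      using subsequential_limit[OF filterlim_compose[OF \<epsilon> filterlim_subseq[OF r]] lim] by blast
  qed
  have "filterlim (\<lambda>n. inverse (real (Suc n))) (at_right 0) sequentially"
    using LIMSEQ_inverse_real_of_nat by (simp add: filterlim_at)
  from subsequence[OF this] obtain u where u: "continuous_on (closure D) u" "harmonic_on D u"
    "\<forall>x\<in>frontier D. u x = F x" by blast
  have "uniform_limit (closure D) W u (at_right 0)"
  proof (rule uniform_limit_at_right_from_subsequences)
    fix \<epsilon> :: "nat \<Rightarrow> real" assume "filterlim \<epsilon> (at_right 0) sequentially"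
    from subsequence[OF this] obtain r v where r: "strict_mono (r :: nat \<Rightarrow> nat)"
      and lim: "uniform_limit (closure D) (\<lambda>n. W (\<epsilon> (r n))) v sequentially"
      and v: "continuous_on (closure D) v" "harmonic_on D v" "\<forall>x\<in>frontier D. v x = F x" by blast
    have "v x = u x" if "x \<in> closure D" for x
      using harmonic_on_unique[OF D(1,2) v(1,2) u(1,2)] v(3) u(3) that by auto
    then have "uniform_limit (closure D) (\<lambda>n. W (\<epsilon> (r n))) u sequentially"
      using lim by (simp cong: uniform_limit_cong')
    then show "\<exists>r. strict_mono (r :: nat \<Rightarrow> nat) \<and>
        uniform_limit (closure D) (\<lambda>n. W (\<epsilon> (r n))) u sequentially"
      using r by blast
  qed
  with u show ?thesis by blast
qed

end

subsection \<open>The ball walk\<close>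

interpretation ball_seq: sequence_space "ball_prob :: 'a::euclidean_space measure"
  by unfold_locales

abbreviation path_measure :: "(nat \<Rightarrow> 'a::euclidean_space) measure" where
  "path_measure \<equiv> PiM UNIV (\<lambda>_. ball_prob)"

lemma integral_path_measure_iter:
  fixes f :: "(nat \<Rightarrow> 'a::euclidean_space) \<Rightarrow> real"
  assumes [measurable]: "f \<in> borel_measurable path_measure" and B: "\<And>\<omega>. \<bar>f \<omega>\<bar> \<le> B"
  shows "(\<integral>\<omega>. f \<omega> \<partial>path_measure) = (\<integral>s. (\<integral>\<omega>. f (case_nat s \<omega>) \<partial>path_measure) \<partial>ball_prob)"
proof -
  interpret P: pair_prob_space "ball_prob :: 'a measure" "path_measure :: (nat \<Rightarrow> 'a) measure" ..
  let ?g = "\<lambda>(s, \<omega>). case_nat s \<omega> :: nat \<Rightarrow> 'a"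
  have [measurable]: "?g \<in> ball_prob \<Otimes>\<^sub>M path_measure \<rightarrow>\<^sub>M path_measure"
    by measurable
  have "(\<integral>\<omega>. f \<omega> \<partial>path_measure) = integral\<^sup>L (distr (ball_prob \<Otimes>\<^sub>M path_measure) path_measure ?g) f"
    by (simp add: ball_seq.PiM_iter)
  also have "\<dots> = (\<integral>p. f (?g p) \<partial>(ball_prob \<Otimes>\<^sub>M path_measure))"
    by (rule integral_distr) auto
  also have "\<dots> = (\<integral>s. (\<integral>\<omega>. f (?g (s, \<omega>)) \<partial>path_measure) \<partial>ball_prob)"
    by (rule P.integral_fst'[symmetric], rule P.integrable_const_bound[where B=B]) (auto intro: B)
  finally show ?thesis by simp
qed

lemma walk_cong:
  "(\<And>n. \<omega> (Suc n) = \<omega>' (Suc n)) \<Longrightarrow> walk D \<epsilon> x \<omega> n = walk D \<epsilon> x \<omega>' n"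
  by (induction n) auto

lemma walk_limit_cong:
  "(\<And>n. \<omega> (Suc n) = \<omega>' (Suc n)) \<Longrightarrow> walk_limit D \<epsilon> x \<omega> = walk_limit D \<epsilon> x \<omega>'"
  unfolding walk_limit_def using walk_cong[of \<omega> \<omega>' D \<epsilon> x] by presburger

lemma walk_shift:
  "walk D \<epsilon> x \<omega> (Suc n)
    = walk D \<epsilon> (x + min \<epsilon> (infdist x (frontier D)) *\<^sub>R \<omega> 1) (\<lambda>i. \<omega> (Suc i)) n"
  by (induction n) auto

lemma walk_limit_shift:
  "walk_limit D \<epsilon> x \<omega>
    = walk_limit D \<epsilon> (x + min \<epsilon> (infdist x (frontier D)) *\<^sub>R \<omega> 1) (\<lambda>i. \<omega> (Suc i))"
  unfolding walk_limit_def lim_def walk_shift[symmetric]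
  by (simp only: filterlim_sequentially_Suc)

lemma walk_frontier: "0 < \<epsilon> \<Longrightarrow> x \<in> frontier D \<Longrightarrow> walk D \<epsilon> x \<omega> n = x"
  by (induction n) (auto simp: min_def)

lemma walk_limit_frontier: "0 < \<epsilon> \<Longrightarrow> x \<in> frontier D \<Longrightarrow> walk_limit D \<epsilon> x \<omega> = x"
  unfolding walk_limit_def by (rule limI, subst tendsto_cong[of _ "\<lambda>_. x"]) (auto simp: walk_frontier)

lemma borel_measurable_infdist [measurable]:
  "(\<lambda>x. infdist x A) \<in> borel_measurable (borel :: 'a::euclidean_space measure)"
  by (intro borel_measurable_continuous_onI continuous_intros)

lemma measurable_walk:
  "(\<lambda>(x, \<omega>). walk D \<epsilon> x \<omega> n)
    \<in> borel_measurable (borel \<Otimes>\<^sub>M (path_measure :: (nat \<Rightarrow> 'a::euclidean_space) measure))"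
proof (induction n)
  case (Suc n)
  note [measurable] = Suc
  have [measurable]:
    "(\<lambda>p. snd p (Suc n)) \<in> borel_measurable (borel \<Otimes>\<^sub>M (path_measure :: (nat \<Rightarrow> 'a) measure))"
    by measurable
  show ?case by (simp add: case_prod_beta') measurable
qed simp

lemma measurable_walk_limit_pair [measurable]:
  "(\<lambda>(x, \<omega>). walk_limit D \<epsilon> x \<omega>)
    \<in> borel_measurable (borel \<Otimes>\<^sub>M (path_measure :: (nat \<Rightarrow> 'a::euclidean_space) measure))"
  unfolding walk_limit_def case_prod_beta'
  by (rule borel_measurable_lim_metric) (use measurable_walk in \<open>simp add: case_prod_beta'\<close>)

lemma measurable_walk_limit [measurable]:
  "walk_limit D \<epsilon> x \<in> borel_measurable (path_measure :: (nat \<Rightarrow> 'a::euclidean_space) measure)"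
  using measurable_compose[OF measurable_Pair1'[of x borel] measurable_walk_limit_pair[of D \<epsilon>]]
  by simp

subsection \<open>The walk accumulates only at the boundary\<close>

lemma measure_ball_prob_ball:
  assumes "0 \<le> r" "r \<le> 1"
  shows "measure ball_prob (ball (0::'a::euclidean_space) r) = r ^ DIM('a)"
proof -
  have "ball (0::'a) 1 \<inter> ball 0 r = ball 0 r" using assms by auto
  moreover have "unit_ball_vol (real DIM('a)) \<noteq> 0"
    using unit_ball_vol_pos[of "real DIM('a)"] by (metis less_irrefl of_nat_0_le_iff)
  ultimately show ?thesis
    unfolding ball_prob_def using assms emeasure_lborel_unit_ball[where 'a='a]
    by (subst measure_uniform_measure) (auto simp: content_ball)
qed

lemma AE_path_frequently_not_small:
  "AE \<omega> in path_measure. \<exists>i\<ge>m. 1 / 2 \<le> norm (\<omega> i :: 'a::euclidean_space)"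
proof -
  define p where "p = measure ball_prob (ball (0::'a) (1 / 2))"
  have p: "0 \<le> p" "p < 1" by (auto simp: p_def measure_ball_prob_ball power_less_one_iff)
  define A where "A = {\<omega> \<in> space path_measure. \<not> (\<exists>i\<ge>m. 1 / 2 \<le> norm (\<omega> i :: 'a))}"
  have A [measurable]: "A \<in> sets path_measure" unfolding A_def by measurable
  have "measure path_measure A \<le> p ^ n" for n
  proof -
    define B where "B = {\<omega> \<in> space path_measure. \<forall>i\<in>{m..<m + n}. \<omega> i \<in> ball (0::'a) (1 / 2)}"
    have "emeasure path_measure B = (\<Prod>i\<in>{m..<m + n}. emeasure ball_prob (ball (0::'a) (1 / 2)))"
      unfolding B_def by (rule ball_seq.emeasure_PiM_Collect) auto
    also have "\<dots> = ennreal (p ^ n)"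
      using p(1) by (simp add: p_def ball_prob.emeasure_eq_measure ennreal_power)
    finally have "measure path_measure B = p ^ n" using p(1) by (simp add: measure_def)
    moreover have "measure path_measure A \<le> measure path_measure B"
      by (rule ball_seq.P.finite_measure_mono) (auto simp: A_def B_def)
    ultimately show ?thesis by simp
  qed
  then have "measure path_measure A \<le> 0"
    using p by (intro LIMSEQ_le_const[OF LIMSEQ_realpow_zero]) auto
  then have "A \<in> null_sets path_measure"
    by (simp add: null_sets_def ball_seq.P.emeasure_eq_measure measure_le_0_iff)
  then show ?thesis
    by (rule AE_I') (simp add: A_def)
qed

lemma AE_path_not_tendsto_0: "AE \<omega> in path_measure. \<not> (\<omega> \<longlonglongrightarrow> (0 :: 'a::euclidean_space))"
proof -
  have "AE \<omega> in path_measure. \<forall>m. \<exists>i\<ge>m. 1 / 2 \<le> norm (\<omega> i :: 'a)"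
    unfolding AE_all_countable using AE_path_frequently_not_small by blast
  then show ?thesis
  proof eventually_elim
    case (elim \<omega>)
    show ?case
    proof
      assume "\<omega> \<longlonglongrightarrow> 0"
      then obtain m where "\<forall>i\<ge>m. norm (\<omega> i) < 1 / 2" using LIMSEQ_D[of \<omega> 0 "1 / 2"] by auto
      then show False using elim by (meson not_le)
    qed
  qed
qed

text \<open>If the walk converged to an interior point, its step sizes would stay bounded below and
  the increments \<open>\<omega> n\<close> would have to tend to 0.\<close>

lemma walk_tendsto_in_frontier:
  fixes D :: "'a::euclidean_space set"
  assumes "frontier D \<noteq> {}" and \<epsilon>: "0 < \<epsilon>" and \<omega>: "\<not> (\<omega> \<longlonglongrightarrow> 0)" and L: "walk D \<epsilon> x \<omega> \<longlonglongrightarrow> L"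
  shows "L \<in> frontier D"
proof (rule ccontr)
  assume "L \<notin> frontier D"
  then have "infdist L (frontier D) > 0"
    using in_closed_iff_infdist_zero[OF frontier_closed assms(1)] infdist_nonneg[of L "frontier D"]
    by (metis order_le_less)
  define \<rho> where "\<rho> y = min \<epsilon> (infdist y (frontier D))" for y
  have "\<rho> L > 0" using \<epsilon> \<open>infdist L (frontier D) > 0\<close> by (simp add: \<rho>_def)
  define X where "X = walk D \<epsilon> x \<omega>"
  have lim\<rho>: "(\<lambda>n. \<rho> (X n)) \<longlonglongrightarrow> \<rho> L"
    unfolding \<rho>_def X_def by (intro tendsto_min tendsto_const tendsto_infdist L)
  have "(\<lambda>n. X (Suc n) - X n) \<longlonglongrightarrow> L - L"
    unfolding X_def by (intro tendsto_diff L LIMSEQ_Suc)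
  then have "(\<lambda>n. inverse (\<rho> (X n)) *\<^sub>R (\<rho> (X n) *\<^sub>R \<omega> (Suc n))) \<longlonglongrightarrow> inverse (\<rho> L) *\<^sub>R 0"
    using \<open>\<rho> L > 0\<close> by (intro tendsto_scaleR tendsto_inverse lim\<rho>) (auto simp: \<rho>_def X_def)
  moreover have "\<forall>\<^sub>F n in sequentially. inverse (\<rho> (X n)) *\<^sub>R (\<rho> (X n) *\<^sub>R \<omega> (Suc n)) = \<omega> (Suc n)"
    using order_tendstoD(1)[OF lim\<rho> \<open>\<rho> L > 0\<close>] by eventually_elim auto
  ultimately have "(\<lambda>n. \<omega> (Suc n)) \<longlonglongrightarrow> 0" by (simp add: tendsto_cong)
  then have "\<omega> \<longlonglongrightarrow> 0" by (simp only: filterlim_sequentially_Suc)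
  then show False using \<omega> by simp
qed

text \<open>On a divergent walk, \<open>lim\<close> takes this fixed junk value. That divergence has probability
  zero is never needed: walk regularity already controls the junk value.\<close>

definition lim_divergent :: "'a::t2_space" where
  "lim_divergent = (THE L. False)"

lemma lim_eq_lim_divergent: "\<not> convergent X \<Longrightarrow> lim X = lim_divergent"
  by (simp add: lim_def convergent_def lim_divergent_def)

lemma AE_walk_limit:
  fixes D :: "'a::euclidean_space set"
  assumes "frontier D \<noteq> {}" and \<epsilon>: "0 < \<epsilon>"
  shows "AE \<omega> in path_measure. walk_limit D \<epsilon> x \<omega> \<in> insert lim_divergent (frontier D)"
  using AE_path_not_tendsto_0
proof eventually_elim
  case (elim \<omega>)
  show ?case
  proof (cases "convergent (walk D \<epsilon> x \<omega>)")
    case True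
    then have "walk D \<epsilon> x \<omega> \<longlonglongrightarrow> walk_limit D \<epsilon> x \<omega>"
      by (simp add: walk_limit_def convergent_LIMSEQ_iff)
    then show ?thesis using walk_tendsto_in_frontier[OF assms] elim by blast
  next
    case False
    then show ?thesis by (simp add: walk_limit_def lim_eq_lim_divergent)
  qed
qed

subsection \<open>Expected boundary values\<close>

lemma borel_measurable_completion_cong_AE:
  assumes f: "f \<in> borel_measurable M" and ae: "AE x in M. f x = g x"
  shows "g \<in> borel_measurable (completion M)"
proof (rule measurableI)
  fix A :: "'b set" assume A: "A \<in> sets borel"
  show "g -` A \<inter> space (completion M) \<in> sets (completion M)"
  proof (rule completion.in_sets_AE)
    show "f -` A \<inter> space M \<in> sets (completion M)" using measurable_sets[OF f A] by simp
    show "AE x in completion M. (x \<in> f -` A \<inter> space M) = (x \<in> g -` A \<inter> space (completion M))"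
      using AE_completion[OF ae] by eventually_elim auto
  qed simp
qed simp

definition frontier_ext :: "'a::euclidean_space set \<Rightarrow> ('a \<Rightarrow> real) \<Rightarrow> 'a \<Rightarrow> real" where
  "frontier_ext D F y = (if y \<in> frontier D then F y else F lim_divergent)"

definition walk_mean :: "'a::euclidean_space set \<Rightarrow> ('a \<Rightarrow> real) \<Rightarrow> real \<Rightarrow> 'a \<Rightarrow> real" where
  "walk_mean D F \<epsilon> x = (\<integral>\<omega>. frontier_ext D F (walk_limit D \<epsilon> x \<omega>) \<partial>path_measure)"

lemma measurable_frontier_ext:
  assumes "continuous_on (frontier D) F"
  shows "frontier_ext D F \<in> borel_measurable borel"
proof -
  have "(\<lambda>y. indicator (frontier D) y *\<^sub>R F y) \<in> borel_measurable borel"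
    using assms
    by (intro borel_measurable_continuous_on_indicator) (auto simp: frontier_closed borel_closed)
  then have "(\<lambda>y. if y \<in> frontier D then indicator (frontier D) y *\<^sub>R F y else F lim_divergent)
      \<in> borel_measurable borel"
    by (intro measurable_If_set) (auto simp: frontier_closed borel_closed)
  also have "(\<lambda>y. if y \<in> frontier D then indicator (frontier D) y *\<^sub>R F y else F lim_divergent)
      = frontier_ext D F"
    by (auto simp: frontier_ext_def fun_eq_iff)
  finally show ?thesis .
qed

lemma frontier_ext_bounded:
  assumes "bounded D" "continuous_on (frontier D) F"
  obtains M where "\<And>y. \<bar>frontier_ext D F y\<bar> \<le> M"
proof -
  have "compact (F ` frontier D)"
    using assms by (intro compact_continuous_image compact_frontier_bounded)
  then obtain B where B: "\<And>y. y \<in> frontier D \<Longrightarrow> \<bar>F y\<bar> \<le> B"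
    using compact_imp_bounded[of "F ` frontier D"] by (auto simp: bounded_iff)
  have "\<bar>frontier_ext D F y\<bar> \<le> max B \<bar>F lim_divergent\<bar>" for y
    using B[of y] by (auto simp: frontier_ext_def)
  then show ?thesis by (rule that)
qed

lemma u_eps_eq_walk_mean:
  assumes "frontier D \<noteq> {}" and F: "continuous_on (frontier D) F" and "0 < \<epsilon>"
  shows "u_eps D F \<epsilon> x = walk_mean D F \<epsilon> x"
proof -
  note [measurable] = measurable_frontier_ext[OF F]
  let ?g = "\<lambda>\<omega>. frontier_ext D F (walk_limit D \<epsilon> x \<omega>)"
  have ae: "AE \<omega> in path_measure. ?g \<omega> = F (walk_limit D \<epsilon> x \<omega>)"
    using AE_walk_limit[OF assms(1,3)] by eventually_elim (auto simp: frontier_ext_def)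
  have meas: "?g \<in> borel_measurable path_measure" by measurable
  have "u_eps D F \<epsilon> x = (\<integral>\<omega>. ?g \<omega> \<partial>completion path_measure)"
    unfolding u_eps_def walk_space_def
    using borel_measurable_completion_cong_AE[OF meas ae] measurable_completion[OF meas]
      AE_completion[OF ae]
    by (intro integral_cong_AE) auto
  then show ?thesis unfolding walk_mean_def using integral_completion[OF meas] by simp
qed

lemma measurable_walk_mean:
  assumes F: "continuous_on (frontier D) F"
  shows "walk_mean D F \<epsilon> \<in> borel_measurable borel"
proof -
  note [measurable] = measurable_frontier_ext[OF F]
  show ?thesis unfolding walk_mean_def[abs_def] by measurable
qed

lemma walk_mean_le:
  assumes "continuous_on (frontier D) F" "\<And>y. \<bar>frontier_ext D F y\<bar> \<le> M"
  shows "\<bar>walk_mean D F \<epsilon> x\<bar> \<le> M"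
proof -
  note [measurable] = measurable_frontier_ext[OF assms(1)]
  show ?thesis unfolding walk_mean_def by (rule ball_seq.P.abs_expectation_le) (auto simp: assms)
qed

lemma walk_mean_frontier:
  "0 < \<epsilon> \<Longrightarrow> x \<in> frontier D \<Longrightarrow> walk_mean D F \<epsilon> x = F (x :: 'a::euclidean_space)"
  using ball_seq.P.prob_space[where 'a='a]
  by (simp add: walk_mean_def walk_limit_frontier frontier_ext_def)

lemma walk_mean_case_nat:
  assumes F: "continuous_on (frontier D) F" and M: "\<And>y. \<bar>frontier_ext D F y\<bar> \<le> M"
  shows "(\<integral>\<omega>. frontier_ext D F (walk_limit D \<epsilon> x (case_nat s \<omega>)) \<partial>path_measure) = walk_mean D F \<epsilon> x"
proof -
  note [measurable] = measurable_frontier_ext[OF F]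
  define G where "G \<omega> = frontier_ext D F (walk_limit D \<epsilon> x (case_nat 0 \<omega>))" for \<omega>
  have G: "frontier_ext D F (walk_limit D \<epsilon> x (case_nat s \<omega>)) = G \<omega>" for s \<omega>
    unfolding G_def by (intro arg_cong[where f="frontier_ext D F"] walk_limit_cong) simp
  have "walk_mean D F \<epsilon> x
      = (\<integral>s. (\<integral>\<omega>. frontier_ext D F (walk_limit D \<epsilon> x (case_nat s \<omega>)) \<partial>path_measure) \<partial>ball_prob)"
    unfolding walk_mean_def by (rule integral_path_measure_iter[where B=M]) (simp_all add: M)
  then show ?thesis by (simp add: G)
qed

lemma walk_mean_mean_value:
  fixes D :: "'a::euclidean_space set"
  assumes F: "continuous_on (frontier D) F" and M: "\<And>y. \<bar>frontier_ext D F y\<bar> \<le> M"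
  shows "walk_mean D F \<epsilon> x = ball_mean (min \<epsilon> (infdist x (frontier D))) (walk_mean D F \<epsilon>) x"
proof -
  note [measurable] = measurable_frontier_ext[OF F]
  define \<rho> where "\<rho> = min \<epsilon> (infdist x (frontier D))"
  define f where "f \<omega> = frontier_ext D F (walk_limit D \<epsilon> (x + \<rho> *\<^sub>R \<omega> 0) \<omega>)" for \<omega>
  have "(\<lambda>\<omega>. (x + \<rho> *\<^sub>R \<omega> 0, \<omega>)) \<in> path_measure \<rightarrow>\<^sub>M borel \<Otimes>\<^sub>M path_measure" by measurable
  from measurable_compose[OF this measurable_walk_limit_pair[of D \<epsilon>]]
  have [measurable]: "(\<lambda>\<omega>. walk_limit D \<epsilon> (x + \<rho> *\<^sub>R \<omega> 0) \<omega>) \<in> borel_measurable path_measure" by simp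
  have "walk_mean D F \<epsilon> x = (\<integral>\<omega>. f \<omega> \<partial>path_measure)"
    using walk_mean_case_nat[OF F M, of \<epsilon> x 0]
    by (subst (asm) walk_limit_shift) (simp add: f_def \<rho>_def)
  also have "\<dots> = (\<integral>s. (\<integral>\<omega>. f (case_nat s \<omega>) \<partial>path_measure) \<partial>ball_prob)"
    by (rule integral_path_measure_iter[where B=M]) (simp_all add: f_def M)
  also have "\<dots> = ball_mean \<rho> (walk_mean D F \<epsilon>) x"
    by (simp add: f_def walk_mean_case_nat[OF F M] ball_mean_def)
  finally show ?thesis by (simp add: \<rho>_def)
qed

lemma (in prob_space) abs_expectation_diff_le:
  fixes f :: "'a \<Rightarrow> real"
  assumes f: "f \<in> borel_measurable M" and A [measurable]: "A \<in> events" and "0 \<le> \<eta>"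
    and on: "AE \<omega> in M. \<omega> \<in> A \<longrightarrow> \<bar>f \<omega> - c\<bar> \<le> \<eta>" and bound: "AE \<omega> in M. \<bar>f \<omega> - c\<bar> \<le> K"
  shows "\<bar>expectation f - c\<bar> \<le> \<eta> + K * (1 - prob A)"
proof -
  have int: "integrable M (\<lambda>\<omega>. f \<omega> - c)"
    using bound f by (intro integrable_const_bound[of _ K]) auto
  have int_compl: "integrable M (\<lambda>\<omega>. indicat_real (space M - A) \<omega>)"
    by (intro integrable_const_bound[of _ 1]) auto
  have "integrable M (\<lambda>\<omega>. f \<omega> - c + c)" using int by (intro Bochner_Integration.integrable_add) auto
  then have "expectation f - c = (\<integral>\<omega>. f \<omega> - c \<partial>M)" by (simp add: prob_space)
  also have "\<bar>\<dots>\<bar> \<le> (\<integral>\<omega>. \<bar>f \<omega> - c\<bar> \<partial>M)" by (rule integral_abs_bound)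
  also have "\<dots> \<le> (\<integral>\<omega>. \<eta> + K * indicator (space M - A) \<omega> \<partial>M)"
  proof (rule integral_mono_AE)
    show "AE \<omega> in M. \<bar>f \<omega> - c\<bar> \<le> \<eta> + K * indicator (space M - A) \<omega>"
      using on bound AE_space by eventually_elim (use \<open>0 \<le> \<eta>\<close> in \<open>auto simp: indicator_def\<close>)
  qed (use int int_compl in auto)
  also have "\<dots> = \<eta> + K * (1 - prob A)" using prob_compl[OF A] int_compl by (simp add: prob_space)
  finally show ?thesis .
qed

lemma walk_mean_error_le:
  fixes D :: "'a::euclidean_space set"
  assumes F: "continuous_on (frontier D) F" and M: "\<And>y. \<bar>frontier_ext D F y\<bar> \<le> M"
    and a: "a \<in> frontier D" and "0 < \<epsilon>" "0 \<le> \<eta>"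
    and close: "\<And>y. y \<in> frontier D \<Longrightarrow> dist a y < \<delta> \<Longrightarrow> \<bar>F y - F a\<bar> \<le> \<eta>"
    and divergent: "lim_divergent \<in> ball a \<delta> \<Longrightarrow> lim_divergent \<in> frontier D"
  shows "\<bar>walk_mean D F \<epsilon> x - F a\<bar>
    \<le> \<eta> + 2 * M * (1 - measure walk_space {\<omega> \<in> space walk_space. walk_limit D \<epsilon> x \<omega> \<in> ball a \<delta>})"
proof -
  note [measurable] = measurable_frontier_ext[OF F]
  define A where "A = {\<omega> \<in> space path_measure. walk_limit D \<epsilon> x \<omega> \<in> ball a \<delta>}"
  have A: "A \<in> sets path_measure"
    using measurable_sets[OF measurable_walk_limit[of D \<epsilon> x], of "ball a \<delta>"]
    by (simp add: A_def vimage_def Int_def conj_commute)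
  have "\<bar>walk_mean D F \<epsilon> x - F a\<bar> \<le> \<eta> + 2 * M * (1 - measure path_measure A)"
    unfolding walk_mean_def
  proof (rule ball_seq.P.abs_expectation_diff_le[OF _ A \<open>0 \<le> \<eta>\<close>])
    show "(\<lambda>\<omega>. frontier_ext D F (walk_limit D \<epsilon> x \<omega>)) \<in> borel_measurable path_measure" by measurable
    have "frontier D \<noteq> {}" using a by blast
    from AE_walk_limit[OF this \<open>0 < \<epsilon>\<close>]
    show "AE \<omega> in path_measure. \<omega> \<in> A \<longrightarrow> \<bar>frontier_ext D F (walk_limit D \<epsilon> x \<omega>) - F a\<bar> \<le> \<eta>"
      by eventually_elim (use close divergent in \<open>auto simp: A_def frontier_ext_def\<close>)
    have "\<bar>frontier_ext D F y - F a\<bar> \<le> 2 * M" for y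
      using M[of y] M[of a] a by (simp add: frontier_ext_def[of D F a])
    then show "AE \<omega> in path_measure. \<bar>frontier_ext D F (walk_limit D \<epsilon> x \<omega>) - F a\<bar> \<le> 2 * M" by simp
  qed
  moreover have "measure walk_space A = measure path_measure A" using A by (simp add: walk_space_def)
  ultimately show ?thesis by (simp add: A_def walk_space_def)
qed

lemma walk_mean_converges_at_regular_point:
  fixes D :: "'a::euclidean_space set"
  assumes D: "open D" "bounded D" and F: "continuous_on (frontier D) F"
    and reg: "walk_regular_point D a" and a: "a \<in> frontier D"
  shows "converges_at_point D (walk_mean D F) a (F a)"
  unfolding converges_at_point_def
proof (intro allI impI)
  fix \<eta> :: real assume "\<eta> > 0"
  obtain M where M: "\<And>y. \<bar>frontier_ext D F y\<bar> \<le> M"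
    using frontier_ext_bounded[OF D(2) F] by blast
  have "0 \<le> M" using M[of a] by linarith
  obtain d where d: "d > 0" "\<And>y. y \<in> frontier D \<Longrightarrow> dist y a < d \<Longrightarrow> dist (F y) (F a) < \<eta> / 2"
    using F a \<open>\<eta> > 0\<close> unfolding continuous_on_iff by (meson half_gt_zero)
  define r where "r = (if lim_divergent = a then d else min d (dist a lim_divergent))"
  have r: "r > 0" "r \<le> d" "lim_divergent \<in> ball a r \<Longrightarrow> lim_divergent = a" using d(1)
    by (auto simp: r_def split: if_splits)
  have close: "\<bar>F y - F a\<bar> \<le> \<eta> / 2" if "y \<in> frontier D" "dist a y < r" for y
    using d(2)[of y] that r(2) by (simp add: dist_real_def dist_commute)
  define \<theta> where "\<theta> = \<eta> / (4 * (M + 1))"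
  have \<theta>: "\<theta> > 0" "2 * M * \<theta> \<le> \<eta> / 2" using \<open>\<eta> > 0\<close> \<open>0 \<le> M\<close> by (auto simp: \<theta>_def field_simps)
  obtain \<delta> \<epsilon>0 where \<delta>: "0 < \<delta>" "\<delta> < r" and "0 < \<epsilon>0"
    and prob: "\<And>\<epsilon> x. 0 < \<epsilon> \<Longrightarrow> \<epsilon> < \<epsilon>0 \<Longrightarrow> x \<in> ball a \<delta> \<inter> D \<Longrightarrow>
      measure walk_space {\<omega> \<in> space walk_space. walk_limit D \<epsilon> x \<omega> \<in> ball a r} \<ge> 1 - \<theta>"
    using reg[unfolded walk_regular_point_def, rule_format, OF \<theta>(1) r(1)] by blast
  have "\<bar>walk_mean D F \<epsilon> x - F a\<bar> \<le> \<eta>"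
    if \<epsilon>: "0 < \<epsilon>" "\<epsilon> < \<epsilon>0" and x: "x \<in> closure D" "dist a x < \<delta>" for \<epsilon> x
  proof (cases "x \<in> frontier D")
    case True
    then show ?thesis using close[OF True] x \<delta> \<epsilon>(1) \<open>\<eta> > 0\<close> by (simp add: walk_mean_frontier)
  next
    case False
    then have "x \<in> ball a \<delta> \<inter> D" using x D(1) by (simp add: frontier_def interior_open)
    then have "2 * M * (1 - measure walk_space {\<omega> \<in> space walk_space. walk_limit D \<epsilon> x \<omega> \<in> ball a r})
        \<le> 2 * M * \<theta>"
      using prob[OF \<epsilon>] \<open>0 \<le> M\<close> by (intro mult_left_mono) (auto simp: algebra_simps)
    moreover have "\<bar>walk_mean D F \<epsilon> x - F a\<bar>
        \<le> \<eta> / 2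
          + 2 * M * (1 - measure walk_space {\<omega> \<in> space walk_space. walk_limit D \<epsilon> x \<omega> \<in> ball a r})"
      by (rule walk_mean_error_le[OF F M a \<epsilon>(1) _ close]) (use r(3) a \<open>\<eta> > 0\<close> in auto)
    ultimately show ?thesis using \<theta>(2) by linarith
  qed
  then show "\<exists>\<delta>>0. \<forall>\<^sub>F \<epsilon> in at_right 0. \<forall>x\<in>closure D.
      dist a x < \<delta> \<longrightarrow> \<bar>walk_mean D F \<epsilon> x - F a\<bar> \<le> \<eta>"
    using \<delta>(1) \<open>0 < \<epsilon>0\<close> unfolding eventually_at_right_field by blast
qed

lemma mean_value_family_walk_mean:
  fixes D :: "'a::euclidean_space set"
  assumes D: "open D" "bounded D" "D \<noteq> {}" and "walk_regular D" and F: "continuous_on (frontier D) F"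
  shows "\<exists>M. mean_value_family D F (walk_mean D F) M"
proof -
  obtain M where M: "\<And>y. \<bar>frontier_ext D F y\<bar> \<le> M"
    using frontier_ext_bounded[OF D(2) F] by blast
  have "mean_value_family D F (walk_mean D F) M"
  proof
    show "walk_mean D F \<epsilon> x = ball_mean \<epsilon> (walk_mean D F \<epsilon>) x"
      if "\<epsilon> \<le> infdist x (frontier D)" for \<epsilon> x
      using walk_mean_mean_value[OF F M, of \<epsilon> x] that by (simp add: min_absorb1)
    show "converges_at_frontier D (walk_mean D F) F"
      using walk_mean_converges_at_regular_point[OF D(1,2) F] \<open>walk_regular D\<close>
      by (intro converges_at_frontierI D(2) F) (simp add: walk_regular_def)
  qed (use D measurable_walk_mean[OF F] walk_mean_le[OF F M] in auto)
  then show ?thesis by blast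
qed

theorem theorem2p14:
  fixes D :: "'a::euclidean_space set" and F :: "'a \<Rightarrow> real"
  assumes "open D" and "bounded D" and "connected D" and "walk_regular D"
    and "continuous_on (frontier D) F"
  shows "\<exists>u. continuous_on (closure D) u \<and> harmonic_on D u \<and> (\<forall>x\<in>frontier D. u x = F x) \<and>
           (\<forall>v. continuous_on (closure D) v \<and> harmonic_on D v \<and> (\<forall>x\<in>frontier D. v x = F x)
                 \<longrightarrow> (\<forall>x\<in>closure D. v x = u x)) \<and>
           uniform_limit (closure D) (u_eps D F) u (at_right 0)"
proof (cases "D = {}")
  case True
  then show ?thesis by (auto simp: harmonic_on_def intro!: uniform_limitI)
next
  case False
  then obtain M where family: "mean_value_family D F (walk_mean D F) M"
    using mean_value_family_walk_mean assms(1,2,4,5) by blast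
  obtain u where u: "continuous_on (closure D) u" "harmonic_on D u" "\<forall>x\<in>frontier D. u x = F x"
    and lim: "uniform_limit (closure D) (walk_mean D F) u (at_right 0)"
    using mean_value_family.harmonic_limit[OF family] by auto
  have "v x = u x" if v: "continuous_on (closure D) v" "harmonic_on D v" "\<forall>x\<in>frontier D. v x = F x"
    and "x \<in> closure D" for v x
    using harmonic_on_unique[OF assms(1,2) v(1,2) u(1,2)] v(3) u(3) that(4) by simp
  moreover have "frontier D \<noteq> {}"
    using False assms(2) frontier_eq_empty[of D] not_bounded_UNIV by auto
  note u_eps = u_eps_eq_walk_mean[OF this assms(5)]
  have "uniform_limit (closure D) (u_eps D F) u (at_right 0)"
  proof (rule uniform_limit_cong[THEN iffD1, OF _ _ lim])
    show "\<forall>\<^sub>F \<epsilon> in at_right 0. \<forall>x\<in>closure D. walk_mean D F \<epsilon> x = u_eps D F \<epsilon> x"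
      using eventually_at_right_less[of "0::real"] by eventually_elim (simp add: u_eps)
  qed simp
  ultimately show ?thesis using u by (intro exI[of _ u]) blast
qed

end
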